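(* Let $p\in\partial X$ have active index set $I$, i.e. $p\in F_I^\circ$ with $I\neq\varnothing$. Then the following are equivalent: (1) $p$ is accessible for $g_\Sigma$; (2) $p$ is finite-length approachable for $g_\Sigma$; (3) $M_I<2$.
   Context: Let $X$ be a compact smooth $n$-dimensional manifold with corners (locally modelled on $[0,\infty)^k\times\mathbb R^{n-k}$, $0\le k\le n$) whose boundary hypersurfaces $H_1,\dots,H_N$ are globally embedded, and let $X^\circ=X\setminus\partial X$. For each $i$ let $\rho_i:X\to[0,\infty)$ be a smooth boundary-defining function of $H_i$: $H_i=\rho_i^{-1}(0)$, $d\rho_i\neq0$ on $H_i$, and $\rho_i>0$ on $X\setminus H_i$. Let $g_0$ be a smooth Riemannian metric on $X$ (up to the boundary), and let $\alpha_1,\dots,\alpha_N\ge 0$. The sum metric on $X^\circ$ is $g_\Sigma=\bigl(\sum_{i=1}^N\rho_i^{-\alpha_i}\bigr)g_0$. For a Riemannian metric $g$ on $X^\circ$, $d_g$ is the Riemannian distance (infimum of $g$-lengths of absolutely continuous curves in $X^\circ$) and $L_g$ is the $g$-length. The background topology is the topology of $X$. For $p\in X$, $I(p)=\{i: p\in H_i\}$ is the active index set; for $I\subseteq\{1,\dots,N\}$, $F_I^\circ=\{p\in X: I(p)=I\}$ is the corresponding open face; and for nonempty $I$, $M_I=\max_{i\in I}\alpha_i$. A point $p\in\partial X$ is accessible with respect to $g$ if there is a $d_g$-Cauchy sequence $\{p_n\}\subset X^\circ$ with $p_n\to p$ in the background topology. It is finite-length approachable with respect to $g$ if there is an absolutely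 continuous curve $\gamma:[0,1)\to X^\circ$ with $\gamma(t)\to p$ in the background topology as $t\uparrow1$ and $L_g(\gamma)<\infty$. *)

theory Defs
  imports "HOL-Analysis.Analysis"
begin

subsection \<open>Smooth maps on subsets of Euclidean space\<close>

primrec Ck_on :: "nat \<Rightarrow> 'a::real_normed_vector set \<Rightarrow> ('a \<Rightarrow> 'b::real_normed_vector) \<Rightarrow> bool" where
  "Ck_on 0 V f \<longleftrightarrow> continuous_on V f"
| "Ck_on (Suc k) V f \<longleftrightarrow>
     (\<forall>x\<in>V. f differentiable (at x)) \<and> (\<forall>v. Ck_on k V (\<lambda>x. frechet_derivative f (at x) v))"

text \<open>On a set that need not be open, such as a relatively open subset of an orthant, smoothness
  means that there are local smooth extensions to open sets of the ambient space.\<close>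

definition smooth_on :: "'a::real_normed_vector set \<Rightarrow> ('a \<Rightarrow> 'b::real_normed_vector) \<Rightarrow> bool" where
  "smooth_on S f \<longleftrightarrow>
     (\<forall>x\<in>S. \<exists>V F. open V \<and> x \<in> V \<and> (\<forall>k. Ck_on k V F) \<and> (\<forall>y\<in>S \<inter> V. F y = f y))"

subsection \<open>Manifolds with corners\<close>

text \<open>A chart takes values in the model corner in which the coordinates indexed by
  \<open>cidx\<close> are nonnegative and the others are free; up to a permutation of the
  coordinates this is \<open>[0,\<infinity>)\<^sup>k \<times> \<real>\<^sup>n\<^sup>-\<^sup>k\<close> with \<open>k\<close> the cardinality of
  \<open>cidx\<close>. The dimension \<open>n\<close> is \<open>CARD('n)\<close>.\<close>

record ('a, 'n) chart =
  cdom :: "'a set"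
  cidx :: "'n set"
  cmap :: "'a \<Rightarrow> real^'n"

definition corner_model :: "'n::finite set \<Rightarrow> (real^'n) set" where
  "corner_model K = {x. \<forall>j\<in>K. 0 \<le> x $ j}"

abbreviation cimg :: "('a, 'n::finite) chart \<Rightarrow> (real^'n) set" where
  "cimg c \<equiv> cmap c ` cdom c"

abbreviation cinv :: "('a, 'n::finite) chart \<Rightarrow> real^'n \<Rightarrow> 'a" where
  "cinv c \<equiv> inv_into (cdom c) (cmap c)"

definition corner_chart :: "'a topology \<Rightarrow> ('a, 'n::finite) chart \<Rightarrow> bool" where
  "corner_chart X c \<longleftrightarrow>
     openin X (cdom c) \<and>
     openin (top_of_set (corner_model (cidx c))) (cimg c) \<and>
     homeomorphic_map (subtopology X (cdom c)) (top_of_set (cimg c)) (cmap c)"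

text \<open>The atlas is not required to be maximal; all notions below depend only on the
  smooth structure it generates.\<close>

definition manifold_with_corners :: "'a topology \<Rightarrow> ('a, 'n::finite) chart set \<Rightarrow> bool" where
  "manifold_with_corners X A \<longleftrightarrow>
     Hausdorff_space X \<and> second_countable X \<and>
     (\<forall>c\<in>A. corner_chart X c) \<and>
     topspace X = (\<Union>c\<in>A. cdom c) \<and>
     (\<forall>c\<in>A. \<forall>d\<in>A. smooth_on (cmap c ` (cdom c \<inter> cdom d)) (cmap d \<circ> cinv c))"

text \<open>Coordinates of the model corner that vanish at \<open>p\<close>. Their number (the depth of \<open>p\<close>)
  does not depend on the chart around \<open>p\<close>.\<close>

definition zero_coords :: "('a, 'n::finite) chart \<Rightarrow> 'a \<Rightarrow> 'n set" where
  "zero_coords c p = {j \<in> cidx c. cmap c p $ j = 0}"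

definition mbd :: "('a, 'n::finite) chart set \<Rightarrow> 'a set" where
  "mbd A = {p. \<exists>c\<in>A. p \<in> cdom c \<and> zero_coords c p \<noteq> {}}"

definition mint :: "'a topology \<Rightarrow> ('a, 'n::finite) chart set \<Rightarrow> 'a set" where
  "mint X A = topspace X - mbd A"

definition depth_one :: "('a, 'n::finite) chart set \<Rightarrow> 'a set" where
  "depth_one A = {p. \<exists>c\<in>A. p \<in> cdom c \<and> card (zero_coords c p) = 1}"

definition boundary_hypersurfaces :: "'a topology \<Rightarrow> ('a, 'n::finite) chart set \<Rightarrow> 'a set set" where
  "boundary_hypersurfaces X A =
     (\<lambda>C. X closure_of C) ` connected_components_of (subtopology X (depth_one A))"

text \<open>Embeddedness excludes self-intersections, as in the teardrop: near each of its points
  the hypersurface is given by the vanishing of a single corner coordinate.\<close>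

definition embedded_hypersurface ::
    "'a topology \<Rightarrow> ('a, 'n::finite) chart set \<Rightarrow> 'a set \<Rightarrow> bool" where
  "embedded_hypersurface X A H \<longleftrightarrow>
     (\<forall>p\<in>H. \<exists>c\<in>A. \<exists>W. \<exists>j\<in>cidx c. openin X W \<and> p \<in> W \<and> W \<subseteq> cdom c \<and>
        H \<inter> W = {q \<in> W. cmap c q $ j = 0})"

definition smooth_map_on_mfd ::
    "('a, 'n::finite) chart set \<Rightarrow> ('a \<Rightarrow> 'b::real_normed_vector) \<Rightarrow> bool" where
  "smooth_map_on_mfd A f \<longleftrightarrow> (\<forall>c\<in>A. smooth_on (cimg c) (f \<circ> cinv c))"

text \<open>The differential of \<open>f\<close> at \<open>p\<close> in the chart \<open>c\<close>. The derivative within the image of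
  the chart is unique also at boundary points. With \<open>f = cmap d\<close> it is the Jacobian of the
  transition from \<open>c\<close> to \<open>d\<close>.\<close>

definition coord_deriv ::
    "('a, 'n::finite) chart \<Rightarrow> ('a \<Rightarrow> 'b::real_normed_vector) \<Rightarrow> 'a \<Rightarrow> real^'n \<Rightarrow> 'b" where
  "coord_deriv c f p = frechet_derivative (f \<circ> cinv c) (at (cmap c p) within cimg c)"

definition boundary_defining ::
    "'a topology \<Rightarrow> ('a, 'n::finite) chart set \<Rightarrow> 'a set \<Rightarrow> ('a \<Rightarrow> real) \<Rightarrow> bool" where
  "boundary_defining X A H \<rho> \<longleftrightarrow>
     smooth_map_on_mfd A \<rho> \<and>
     H = {p \<in> topspace X. \<rho> p = 0} \<and>
     (\<forall>p \<in> topspace X - H. \<rho> p > 0) \<and>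
     (\<forall>p\<in>H. \<forall>c\<in>A. p \<in> cdom c \<longrightarrow> coord_deriv c \<rho> p \<noteq> (\<lambda>v. 0))"

subsection \<open>Riemannian metrics\<close>

text \<open>A metric is represented by its Gram matrices in the charts of the atlas, subject to the
  transformation law of covariant 2-tensors.\<close>

type_synonym ('a, 'n) metric_tensor = "('a, 'n) chart \<Rightarrow> 'a \<Rightarrow> real^'n^'n"

definition riemannian_metric ::
    "('a, 'n::finite) chart set \<Rightarrow> ('a, 'n) metric_tensor \<Rightarrow> bool" where
  "riemannian_metric A g \<longleftrightarrow>
     (\<forall>c\<in>A. smooth_on (cimg c) (g c \<circ> cinv c)) \<and>
     (\<forall>c\<in>A. \<forall>p\<in>cdom c. transpose (g c p) = g c p \<and> (\<forall>v. v \<noteq> 0 \<longrightarrow> v \<bullet> (g c p *v v) > 0)) \<and>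
     (\<forall>c\<in>A. \<forall>d\<in>A. \<forall>p\<in>cdom c \<inter> cdom d. \<forall>v w.
        v \<bullet> (g c p *v w) =
        coord_deriv c (cmap d) p v \<bullet> (g d p *v coord_deriv c (cmap d) p w))"

text \<open>Meaningful only on the interior, where all \<open>\<rho> i\<close> are positive.\<close>

definition sum_metric ::
    "nat \<Rightarrow> (nat \<Rightarrow> 'a \<Rightarrow> real) \<Rightarrow> (nat \<Rightarrow> real) \<Rightarrow> ('a, 'n::finite) metric_tensor \<Rightarrow> ('a, 'n) metric_tensor" where
  "sum_metric N \<rho> \<alpha> g0 = (\<lambda>c p. (\<Sum>i\<in>{1..N}. \<rho> i p powr (- \<alpha> i)) *\<^sub>R g0 c p)"

subsection \<open>Absolutely continuous curves, length and distance\<close>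

definition abs_continuous_on_interval ::
    "real \<Rightarrow> real \<Rightarrow> (real \<Rightarrow> 'b::real_normed_vector) \<Rightarrow> bool" where
  "abs_continuous_on_interval s t f \<longleftrightarrow>
     (\<forall>\<epsilon>>0. \<exists>\<delta>>0. \<forall>(m::nat) a b.
        (\<forall>i<m. s \<le> a i \<and> a i \<le> b i \<and> b i \<le> t) \<and>
        (\<forall>i<m. \<forall>j<m. i \<noteq> j \<longrightarrow> {a i<..<b i} \<inter> {a j<..<b j} = {}) \<and>
        (\<Sum>i<m. b i - a i) < \<delta>
        \<longrightarrow> (\<Sum>i<m. norm (f (b i) - f (a i))) < \<epsilon>)"

text \<open>Curves in the interior, parametrised by the interval \<open>T\<close>. Absolute continuity of a curve in
  a manifold is tested in charts, on compact subintervals; in particular for \<open>T = {0..<1}\<close> nothing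
  is required at the missing endpoint.\<close>

definition ac_curve ::
    "'a topology \<Rightarrow> ('a, 'n::finite) chart set \<Rightarrow> real set \<Rightarrow> (real \<Rightarrow> 'a) \<Rightarrow> bool" where
  "ac_curve X A T \<gamma> \<longleftrightarrow>
     continuous_map (top_of_set T) X \<gamma> \<and>
     \<gamma> ` T \<subseteq> mint X A \<and>
     (\<forall>c\<in>A. \<forall>s t. s \<le> t \<and> {s..t} \<subseteq> T \<and> \<gamma> ` {s..t} \<subseteq> cdom c
        \<longrightarrow> abs_continuous_on_interval s t (cmap c \<circ> \<gamma>))"

text \<open>An absolutely continuous curve is differentiable at almost every \<open>t\<close>, and at such \<open>t\<close> the
  speed does not depend on the chart chosen around \<open>\<gamma> t\<close>.\<close>

definition chart_at :: "('a, 'n::finite) chart set \<Rightarrow> 'a \<Rightarrow> ('a, 'n) chart" where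
  "chart_at A p = (SOME c. c \<in> A \<and> p \<in> cdom c)"

definition speed ::
    "('a, 'n::finite) chart set \<Rightarrow> ('a, 'n) metric_tensor \<Rightarrow> real set \<Rightarrow> (real \<Rightarrow> 'a) \<Rightarrow> real \<Rightarrow> real" where
  "speed A g T \<gamma> t =
     (let c = chart_at A (\<gamma> t); v = vector_derivative (cmap c \<circ> \<gamma>) (at t within T)
      in sqrt (v \<bullet> (g c (\<gamma> t) *v v)))"

definition curve_length ::
    "('a, 'n::finite) chart set \<Rightarrow> ('a, 'n) metric_tensor \<Rightarrow> real set \<Rightarrow> (real \<Rightarrow> 'a) \<Rightarrow> ennreal" where
  "curve_length A g T \<gamma> = (\<integral>\<^sup>+t\<in>T. ennreal (speed A g T \<gamma> t) \<partial>lebesgue)"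

text \<open>The value is \<open>\<infinity>\<close> for points in different components of the interior.\<close>

definition rdist ::
    "'a topology \<Rightarrow> ('a, 'n::finite) chart set \<Rightarrow> ('a, 'n) metric_tensor \<Rightarrow> 'a \<Rightarrow> 'a \<Rightarrow> ennreal" where
  "rdist X A g x y =
     Inf {curve_length A g {0..1} \<gamma> | \<gamma>. ac_curve X A {0..1} \<gamma> \<and> \<gamma> 0 = x \<and> \<gamma> 1 = y}"

subsection \<open>Accessible and approachable boundary points\<close>

definition accessible ::
    "'a topology \<Rightarrow> ('a, 'n::finite) chart set \<Rightarrow> ('a, 'n) metric_tensor \<Rightarrow> 'a \<Rightarrow> bool" where
  "accessible X A g p \<longleftrightarrow>
     (\<exists>q::nat \<Rightarrow> 'a. range q \<subseteq> mint X A \<and>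
        (\<forall>\<epsilon>::real. \<epsilon> > 0 \<longrightarrow> (\<exists>M. \<forall>m\<ge>M. \<forall>n\<ge>M. rdist X A g (q m) (q n) < ennreal \<epsilon>)) \<and>
        limitin X q p sequentially)"

definition finite_length_approachable ::
    "'a topology \<Rightarrow> ('a, 'n::finite) chart set \<Rightarrow> ('a, 'n) metric_tensor \<Rightarrow> 'a \<Rightarrow> bool" where
  "finite_length_approachable X A g p \<longleftrightarrow>
     (\<exists>\<gamma>. ac_curve X A {0..<1} \<gamma> \<and> limitin X \<gamma> p (at_left 1) \<and>
        curve_length A g {0..<1} \<gamma> < \<infinity>)"

definition active_index_set :: "nat \<Rightarrow> (nat \<Rightarrow> 'a set) \<Rightarrow> 'a \<Rightarrow> nat set" where
  "active_index_set N H p = {i \<in> {1..N}. p \<in> H i}"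

definition open_face :: "'a topology \<Rightarrow> nat \<Rightarrow> (nat \<Rightarrow> 'a set) \<Rightarrow> nat set \<Rightarrow> 'a set" where
  "open_face X N H I = {p \<in> topspace X. active_index_set N H p = I}"

end

theory Submission
  imports Defs
begin

text \<open>If the largest active exponent \<open>M\<close> is less than 2, move away from \<open>p\<close> in a chart along
  the ray \<open>p + s w\<close> with \<open>w\<close> pointing into the corner. All active \<open>\<rho>\<^sub>i\<close> grow at least linearly in
  \<open>s\<close>, so the speed is \<open>O(s\<^sup>-\<^sup>M\<^sup>/\<^sup>2)\<close>, which is integrable at \<open>0\<close>. If some active exponent is at
  least 2, then \<open>|d ln \<rho>\<^sub>i|\<close> is bounded with respect to the sum metric by compactness of \<open>X\<close>, so
  \<open>ln \<rho>\<^sub>i\<close> is Lipschitz for the distance; but it tends to \<open>-\<infinity>\<close> at \<open>p\<close>. Integrating \<open>d ln \<rho>\<^sub>i\<close>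
  along curves that are only absolutely continuous needs Lebesgue's theorem that an absolutely
  continuous function is the integral of its almost everywhere existing derivative; it is derived
  from the Radon-Nikodym theorem for the Stieltjes measures of the variation function.\<close>

section \<open>Absolutely continuous functions and their variation\<close>

text \<open>Accessibility and approachability are never compared with each other; each is matched
  with the condition on the exponents. Both existence claims come from one family of curves on a
  single ray: affine changes of one parameter give the curve running into \<open>p\<close> as well
  as the curves joining the members of the Cauchy sequence, so \<open>rdist\<close> is bounded
  directly by lengths. The obstacle in the other direction is regularity. A length is the integral
  of a speed built from arbitrarily chosen charts, with no measurability at hand, so sums and
  constants cannot be moved freely through it; the estimates rely on monotonicity and
  superadditivity. A curve stays in one chart only for a short time, so the estimate is proved on
  short intervals and glued. Finally, a boundary point is one that some chart places on its
  boundary. Invariance of domain makes all charts agree about this, and the vanishing of a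
  differential at an interior minimum makes every \<open>\<rho> i\<close> positive in the interior,
  so that its logarithm is available there.\<close>

definition nonoverlapping :: "real \<Rightarrow> real \<Rightarrow> 'i set \<Rightarrow> ('i \<Rightarrow> real) \<Rightarrow> ('i \<Rightarrow> real) \<Rightarrow> bool" where
  "nonoverlapping s t K a b \<longleftrightarrow> (\<forall>i\<in>K. s \<le> a i \<and> a i \<le> b i \<and> b i \<le> t) \<and>
     (\<forall>i\<in>K. \<forall>j\<in>K. i \<noteq> j \<longrightarrow> {a i<..<b i} \<inter> {a j<..<b j} = {})"

lemma abs_continuous_on_interval_iff:
  "abs_continuous_on_interval s t f \<longleftrightarrow>
     (\<forall>\<epsilon>>0. \<exists>\<delta>>0. \<forall>(m::nat) a b. nonoverlapping s t {..<m} a b \<longrightarrow> (\<Sum>i<m. b i - a i) < \<delta>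
        \<longrightarrow> (\<Sum>i<m. norm (f (b i) - f (a i))) < \<epsilon>)"
  by (simp add: abs_continuous_on_interval_def nonoverlapping_def Ball_def conj_assoc imp_conjL)

lemma nonoverlappingD:
  assumes "nonoverlapping s t K a b"
  shows "i \<in> K \<Longrightarrow> s \<le> a i" "i \<in> K \<Longrightarrow> a i \<le> b i" "i \<in> K \<Longrightarrow> b i \<le> t"
    "i \<in> K \<Longrightarrow> j \<in> K \<Longrightarrow> i \<noteq> j \<Longrightarrow> {a i<..<b i} \<inter> {a j<..<b j} = {}"
  using assms unfolding nonoverlapping_def by blast+

text \<open>Families may be indexed by any finite set, transported to an initial segment by a
  bijection. Grid cells lying in an open set, and the pairs arising when several intervals are
  partitioned at once, have no convenient numbering.\<close>

lemma abs_continuous_on_intervalD: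
  fixes f :: "real \<Rightarrow> 'b::real_normed_vector"
  assumes "abs_continuous_on_interval s t f" "\<epsilon> > 0"
  obtains \<delta> where "\<delta> > 0"
    "\<And>(K::'i set) a b. finite K \<Longrightarrow> nonoverlapping s t K a b \<Longrightarrow> (\<Sum>i\<in>K. b i - a i) < \<delta>
      \<Longrightarrow> (\<Sum>i\<in>K. norm (f (b i) - f (a i))) < \<epsilon>"
proof -
  from assms obtain \<delta> where "\<delta> > 0" and
    \<delta>: "\<And>(m::nat) a b. nonoverlapping s t {..<m} a b \<Longrightarrow> (\<Sum>i<m. b i - a i) < \<delta> \<Longrightarrow> (\<Sum>i<m. norm (f (b i) - f (a i))) < \<epsilon>"
    unfolding abs_continuous_on_interval_iff by blast
  show thesis
  proof (rule that[OF \<open>\<delta> > 0\<close>])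
    fix K :: "'i set" and a b
    assume K: "finite K" "nonoverlapping s t K a b" "(\<Sum>i\<in>K. b i - a i) < \<delta>"
    obtain \<pi> where \<pi>: "bij_betw \<pi> {..<card K} K"
      using ex_bij_betw_nat_finite[OF K(1)] by (auto simp: atLeast0LessThan)
    have mem: "\<pi> i \<in> K" if "i \<in> {..<card K}" for i using \<pi> that by (auto simp: bij_betw_def)
    have sum: "(\<Sum>i<card K. F (\<pi> i)) = (\<Sum>i\<in>K. F i)" for F :: "'i \<Rightarrow> real"
      using sum.reindex_bij_betw[OF \<pi>] .
    have dis: "{(a \<circ> \<pi>) i<..<(b \<circ> \<pi>) i} \<inter> {(a \<circ> \<pi>) j<..<(b \<circ> \<pi>) j} = {}"
      if ij: "i \<in> {..<card K}" "j \<in> {..<card K}" "i \<noteq> j" for i j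
    proof -
      have "\<pi> i \<noteq> \<pi> j" using \<pi> ij by (auto simp: bij_betw_def inj_on_def)
      then show ?thesis using nonoverlappingD(4)[OF K(2) mem[OF ij(1)] mem[OF ij(2)]] by simp
    qed
    have "(\<Sum>i<card K. norm (f ((b \<circ> \<pi>) i) - f ((a \<circ> \<pi>) i))) < \<epsilon>"
    proof (rule \<delta>)
      show "nonoverlapping s t {..<card K} (a \<circ> \<pi>) (b \<circ> \<pi>)"
        unfolding nonoverlapping_def using dis nonoverlappingD(1-3)[OF K(2)] mem by auto
      show "(\<Sum>i<card K. (b \<circ> \<pi>) i - (a \<circ> \<pi>) i) < \<delta>"
        using K(3) sum[of "\<lambda>i. b i - a i"] by simp
    qed
    then show "(\<Sum>i\<in>K. norm (f (b i) - f (a i))) < \<epsilon>"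
      using sum[of "\<lambda>i. norm (f (b i) - f (a i))"] by simp
  qed
qed

lemma abs_continuous_imp_continuous_on:
  fixes f :: "real \<Rightarrow> 'b::real_normed_vector"
  assumes "abs_continuous_on_interval s t f"
  shows "continuous_on {s..t} f"
  unfolding continuous_on_iff
proof (intro ballI allI impI)
  fix x e :: real assume x: "x \<in> {s..t}" and "e > 0"
  obtain \<delta> where "\<delta> > 0" and
    \<delta>: "\<And>(K::unit set) a b. finite K \<Longrightarrow> nonoverlapping s t K a b \<Longrightarrow> (\<Sum>i\<in>K. b i - a i) < \<delta>
      \<Longrightarrow> (\<Sum>i\<in>K. norm (f (b i) - f (a i))) < e"
    using abs_continuous_on_intervalD[OF assms \<open>e > 0\<close>] by blast
  have "dist (f y) (f x) < e" if "y \<in> {s..t}" "dist y x < \<delta>" for y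
  proof (cases "x \<le> y")
    case True
    then show ?thesis using \<delta>[of "{()}" "\<lambda>_. x" "\<lambda>_. y"] x that
      by (simp add: dist_norm nonoverlapping_def)
  next
    case False
    then show ?thesis using \<delta>[of "{()}" "\<lambda>_. y" "\<lambda>_. x"] x that
      by (simp add: dist_norm nonoverlapping_def norm_minus_commute)
  qed
  with \<open>\<delta> > 0\<close> show "\<exists>d>0. \<forall>x'\<in>{s..t}. dist x' x < d \<longrightarrow> dist (f x') (f x) < e" by blast
qed

lemma abs_continuous_lipschitz_compose:
  fixes f :: "real \<Rightarrow> 'b::real_normed_vector" and h :: "'b \<Rightarrow> 'c::real_normed_vector"
  assumes f: "abs_continuous_on_interval s t f" and h: "L-lipschitz_on S h" and S: "f ` {s..t} \<subseteq> S"
  shows "abs_continuous_on_interval s t (h \<circ> f)"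
  unfolding abs_continuous_on_interval_iff
proof (intro allI impI)
  fix e :: real assume "e > 0"
  have L: "L \<ge> 0" using h by (rule lipschitz_on_nonneg)
  \<comment> \<open>\<open>L + 1\<close> keeps the quotient meaningful for \<open>L = 0\<close> and
    makes \<open>L * e'\<close> strictly smaller than \<open>e\<close>.\<close>
  define e' where "e' = e / (L + 1)"
  have "e' > 0" using L \<open>e > 0\<close> by (simp add: e'_def)
  then obtain \<delta> where "\<delta> > 0" and
    \<delta>: "\<And>(m::nat) a b. nonoverlapping s t {..<m} a b \<Longrightarrow> (\<Sum>i<m. b i - a i) < \<delta> \<Longrightarrow> (\<Sum>i<m. norm (f (b i) - f (a i))) < e'"
    using f unfolding abs_continuous_on_interval_iff by blast
  have "(\<Sum>i<m. norm ((h \<circ> f) (b i) - (h \<circ> f) (a i))) < e"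
    if ab: "nonoverlapping s t {..<m} a b" "(\<Sum>i<m. b i - a i) < \<delta>" for m :: nat and a b
  proof -
    have "norm ((h \<circ> f) (b i) - (h \<circ> f) (a i)) \<le> L * norm (f (b i) - f (a i))" if "i < m" for i
    proof -
      have "a i \<in> {s..t}" "b i \<in> {s..t}" using nonoverlappingD[OF ab(1), of i] that by auto
      then have "f (b i) \<in> S" "f (a i) \<in> S" using S by blast+
      then show ?thesis using lipschitz_onD[OF h, of "f (b i)" "f (a i)"] by (simp add: dist_norm)
    qed
    then have "(\<Sum>i<m. norm ((h \<circ> f) (b i) - (h \<circ> f) (a i))) \<le> L * (\<Sum>i<m. norm (f (b i) - f (a i)))"
      unfolding sum_distrib_left by (intro sum_mono) auto
    also have "\<dots> \<le> L * e'" using \<delta>[OF ab] L by (intro mult_left_mono) auto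
    also have "\<dots> < e" using L \<open>e > 0\<close> by (simp add: e'_def field_simps)
    finally show ?thesis .
  qed
  with \<open>\<delta> > 0\<close> show "\<exists>\<delta>>0. \<forall>(m::nat) a b. nonoverlapping s t {..<m} a b \<longrightarrow> (\<Sum>i<m. b i - a i) < \<delta>
        \<longrightarrow> (\<Sum>i<m. norm ((h \<circ> f) (b i) - (h \<circ> f) (a i))) < e"
    by blast
qed

lemma abs_continuous_ident: "abs_continuous_on_interval s t (\<lambda>x::real. x)"
proof -
  have "(\<Sum>i<m. norm (b i - a i)) = (\<Sum>i<m. b i - a i)" if "nonoverlapping s t {..<m} a b" for m and a b :: "nat \<Rightarrow> real"
    using nonoverlappingD(2)[OF that] by (intro sum.cong) auto
  then show ?thesis unfolding abs_continuous_on_interval_iff by metis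
qed

lemma lipschitz_imp_abs_continuous:
  fixes h :: "real \<Rightarrow> 'c::real_normed_vector"
  assumes "L-lipschitz_on {s..t} h"
  shows "abs_continuous_on_interval s t h"
  using abs_continuous_lipschitz_compose[OF abs_continuous_ident assms] by (simp add: o_def)

text \<open>Functions on \<open>{a..b}\<close> are extended to the line by composing with this retraction; their
  variation can then be measured from \<open>-\<infinity>\<close>, without reference to the endpoints.\<close>

definition clamp_ivl :: "real \<Rightarrow> real \<Rightarrow> real \<Rightarrow> real" where
  "clamp_ivl a b x = max a (min b x)"

text \<open>Clamping sends each open interval into itself, so a nonoverlapping family stays
  nonoverlapping, and it is 1-Lipschitz, so the total length does not grow. The
  \<open>\<delta>\<close> for \<open>f\<close> therefore serves on every interval.\<close>

lemma abs_continuous_clamp: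
  fixes f :: "real \<Rightarrow> 'b::real_normed_vector"
  assumes "abs_continuous_on_interval a b f" "a \<le> b"
  shows "abs_continuous_on_interval s t (f \<circ> clamp_ivl a b)"
  unfolding abs_continuous_on_interval_iff
proof (intro allI impI)
  let ?c = "clamp_ivl a b"
  fix e :: real assume "e > 0"
  then obtain \<delta> where "\<delta> > 0" and
    \<delta>: "\<And>(m::nat) u v. nonoverlapping a b {..<m} u v \<Longrightarrow> (\<Sum>i<m. v i - u i) < \<delta> \<Longrightarrow> (\<Sum>i<m. norm (f (v i) - f (u i))) < e"
    using assms unfolding abs_continuous_on_interval_iff by blast
  have "(\<Sum>i<m. norm ((f \<circ> ?c) (v i) - (f \<circ> ?c) (u i))) < e"
    if uv: "nonoverlapping s t {..<m} u v" "(\<Sum>i<m. v i - u i) < \<delta>" for m :: nat and u v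
  proof -
    have sub: "{?c (u i)<..<?c (v i)} \<subseteq> {u i<..<v i}" for i
      by (auto simp: clamp_ivl_def max_def min_def split: if_splits)
    have "{?c (u i)<..<?c (v i)} \<inter> {?c (u j)<..<?c (v j)} = {}" if "i \<in> {..<m}" "j \<in> {..<m}" "i \<noteq> j" for i j
      using sub[of i] sub[of j] nonoverlappingD(4)[OF uv(1) that] by blast
    moreover have "a \<le> ?c (u i) \<and> ?c (u i) \<le> ?c (v i) \<and> ?c (v i) \<le> b" if "i \<in> {..<m}" for i
      using nonoverlappingD(2)[OF uv(1) that] \<open>a \<le> b\<close> by (simp add: clamp_ivl_def max_def min_def)
    ultimately have "nonoverlapping a b {..<m} (\<lambda>i. ?c (u i)) (\<lambda>i. ?c (v i))"
      unfolding nonoverlapping_def by blast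
    moreover have "(\<Sum>i<m. ?c (v i) - ?c (u i)) \<le> (\<Sum>i<m. v i - u i)"
    proof (rule sum_mono)
      fix i assume "i \<in> {..<m}"
      then have "u i \<le> v i" using nonoverlappingD(2)[OF uv(1)] by blast
      then show "?c (v i) - ?c (u i) \<le> v i - u i" unfolding clamp_ivl_def by linarith
    qed
    ultimately show ?thesis using \<delta>[of m "\<lambda>i. ?c (u i)" "\<lambda>i. ?c (v i)"] uv(2) by simp
  qed
  with \<open>\<delta> > 0\<close> show "\<exists>\<delta>>0. \<forall>(m::nat) u v. nonoverlapping s t {..<m} u v \<longrightarrow> (\<Sum>i<m. v i - u i) < \<delta> \<longrightarrow>
        (\<Sum>i<m. norm ((f \<circ> ?c) (v i) - (f \<circ> ?c) (u i))) < e"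
    by blast
qed

section \<open>Variation along partitions\<close>

definition variation_sum :: "(real \<Rightarrow> real) \<Rightarrow> (nat \<Rightarrow> real) \<Rightarrow> nat \<Rightarrow> real" where
  "variation_sum f \<tau> m = (\<Sum>i<m. \<bar>f (\<tau> (Suc i)) - f (\<tau> i)\<bar>)"

text \<open>Truncating \<open>\<tau>\<close> above and below at \<open>y\<close> amounts to
  inserting \<open>y\<close> as a partition point. Partitions are monotone sequences that may repeat
  values, so both truncations are again partitions with the same number of increments.\<close>

lemma variation_sum_split:
  assumes "mono \<tau>"
  shows "variation_sum f \<tau> m \<le> variation_sum f (\<lambda>i. min (\<tau> i) y) m + variation_sum f (\<lambda>i. max (\<tau> i) y) m"
  unfolding variation_sum_def sum.distrib[symmetric]
proof (rule sum_mono)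
  fix i
  have "\<tau> i \<le> \<tau> (Suc i)" using assms by (simp add: monoD)
  \<comment> \<open>Only an increment that straddles \<open>y\<close> needs the triangle inequality;
    otherwise one summand reproduces it and the other is 0.\<close>
  then consider "\<tau> (Suc i) \<le> y" | "y \<le> \<tau> i" | "\<tau> i \<le> y" "y \<le> \<tau> (Suc i)" by linarith
  then show "\<bar>f (\<tau> (Suc i)) - f (\<tau> i)\<bar> \<le> \<bar>f (min (\<tau> (Suc i)) y) - f (min (\<tau> i) y)\<bar> +
      \<bar>f (max (\<tau> (Suc i)) y) - f (max (\<tau> i) y)\<bar>"
    using \<open>\<tau> i \<le> \<tau> (Suc i)\<close> by cases (auto simp: min_absorb1 min_absorb2 max_absorb1 max_absorb2)
qed

lemma mono_intervals_disjoint: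
  fixes \<tau> :: "nat \<Rightarrow> real"
  assumes "mono \<tau>" "i \<noteq> j"
  shows "{\<tau> i<..<\<tau> (Suc i)} \<inter> {\<tau> j<..<\<tau> (Suc j)} = {}"
proof -
  have "\<tau> (Suc i) \<le> \<tau> j \<or> \<tau> (Suc j) \<le> \<tau> i"
    using assms by (metis Suc_leI linorder_neqE_nat monoD)
  then show ?thesis by auto
qed

text \<open>Absolute continuity with tolerance 1: the interval lengths telescope to at most
  \<open>d - c\<close>, so the intervals cut out by \<open>\<tau>\<close> are admissible for
  \<open>\<delta>\<close>.\<close>

lemma variation_sum_bounded_short:
  assumes "abs_continuous_on_interval s t f"
  obtains \<delta> where "\<delta> > 0"
    "\<And>\<tau> m c d. mono \<tau> \<Longrightarrow> range \<tau> \<subseteq> {c..d} \<Longrightarrow> {c..d} \<subseteq> {s..t} \<Longrightarrow> d - c < \<delta> \<Longrightarrow> variation_sum f \<tau> m \<le> 1"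
proof -
  obtain \<delta> where "\<delta> > 0" and
    \<delta>: "\<And>(K::nat set) a b. finite K \<Longrightarrow> nonoverlapping s t K a b \<Longrightarrow> (\<Sum>i\<in>K. b i - a i) < \<delta>
      \<Longrightarrow> (\<Sum>i\<in>K. norm (f (b i) - f (a i))) < 1"
    using abs_continuous_on_intervalD[OF assms zero_less_one] by blast
  show thesis
  proof (rule that[OF \<open>\<delta> > 0\<close>])
    fix \<tau> :: "nat \<Rightarrow> real" and m c d
    assume \<tau>: "mono \<tau>" "range \<tau> \<subseteq> {c..d}" "{c..d} \<subseteq> {s..t}" "d - c < \<delta>"
    have tel: "(\<Sum>i<m. \<tau> (Suc i) - \<tau> i) = \<tau> m - \<tau> 0" by (rule sum_lessThan_telescope)
    have cd: "\<tau> i \<in> {c..d}" for i using \<tau>(2) by (rule range_subsetD)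
    then have st: "\<tau> i \<in> {s..t}" for i using \<tau>(3) by blast
    have "nonoverlapping s t {..<m} \<tau> (\<lambda>i. \<tau> (Suc i))"
      unfolding nonoverlapping_def using st mono_intervals_disjoint[OF \<tau>(1)] monoD[OF \<tau>(1)] by simp
    then have "(\<Sum>i<m. norm (f (\<tau> (Suc i)) - f (\<tau> i))) < 1"
      using tel cd[of m] cd[of 0] \<tau>(4) by (intro \<delta>) auto
    then show "variation_sum f \<tau> m \<le> 1" by (simp add: variation_sum_def)
  qed
qed

text \<open>Absolutely continuous functions have bounded variation: \<open>{a..b}\<close> is covered
  by finitely many pieces shorter than \<open>\<delta>\<close>, each contributing at most 1.\<close>

lemma variation_sum_bounded:
  assumes "abs_continuous_on_interval a b f" "a \<le> b"
  obtains B where "\<And>\<tau> m. mono \<tau> \<Longrightarrow> variation_sum (f \<circ> clamp_ivl a b) \<tau> m \<le> B"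
proof -
  let ?f = "f \<circ> clamp_ivl a b"
  obtain \<delta> where "\<delta> > 0" and
    \<delta>: "\<And>\<tau> m c d. mono \<tau> \<Longrightarrow> range \<tau> \<subseteq> {c..d} \<Longrightarrow> {c..d} \<subseteq> {a..b} \<Longrightarrow> d - c < \<delta> \<Longrightarrow> variation_sum f \<tau> m \<le> 1"
    using variation_sum_bounded_short[OF assms(1)] by blast
  \<comment> \<open>Pieces have length \<open>\<delta>/2\<close>, because the short bound asks for a
    length strictly below \<open>\<delta>\<close>. The extra 1 pays for the base case.\<close>
  have step: "variation_sum f \<tau> m \<le> real k + 1"
    if "mono \<tau>" "range \<tau> \<subseteq> {c..b}" "a \<le> c" "b - c \<le> real k * (\<delta>/2)" for k c \<tau> m
    using that
  proof (induction k arbitrary: c \<tau>)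
    case 0
    then have "b - c < \<delta>" using \<open>\<delta> > 0\<close> by simp
    then show ?case using 0 \<delta>[of \<tau> c b m] by auto
  next
    case (Suc k)
    let ?y = "min b (c + \<delta>/2)"
    have r: "\<tau> i \<in> {c..b}" for i using Suc.prems(2) by (rule range_subsetD)
    from r[of 0] have cb: "c \<le> b" by auto
    have m1: "mono (\<lambda>i. min (\<tau> i) ?y)" "mono (\<lambda>i. max (\<tau> i) ?y)"
      using Suc.prems(1) unfolding mono_def by (meson max.mono min.mono order_refl)+
    have "variation_sum f (\<lambda>i. min (\<tau> i) ?y) m \<le> 1"
      using \<delta>[OF m1(1), of c ?y m] r Suc.prems \<open>\<delta> > 0\<close> cb by fastforce
    moreover have "variation_sum f (\<lambda>i. max (\<tau> i) ?y) m \<le> real k + 1"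
    proof (rule Suc.IH[OF m1(2)])
      show "range (\<lambda>i. max (\<tau> i) ?y) \<subseteq> {?y..b}" using r by auto
      show "a \<le> ?y" using Suc.prems \<open>\<delta> > 0\<close> cb by auto
      show "b - ?y \<le> real k * (\<delta>/2)" using Suc.prems \<open>\<delta> > 0\<close> by (auto simp: min_def field_simps)
    qed
    ultimately show ?case using variation_sum_split[OF Suc.prems(1), of f m ?y] by simp
  qed
  obtain k :: nat where k: "(b - a) / (\<delta>/2) \<le> real k" using real_arch_simple by blast
  show thesis
  proof (rule that)
    fix \<tau> :: "nat \<Rightarrow> real" and m assume "mono \<tau>"
    have "variation_sum f (clamp_ivl a b \<circ> \<tau>) m \<le> real k + 1"
    proof (rule step)
      show "mono (clamp_ivl a b \<circ> \<tau>)" using \<open>mono \<tau>\<close> unfolding mono_def clamp_ivl_def o_def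
        by (meson max.mono min.mono order_refl)
      show "range (clamp_ivl a b \<circ> \<tau>) \<subseteq> {a..b}" using assms(2) by (auto simp: clamp_ivl_def)
      show "b - a \<le> real k * (\<delta>/2)" using k \<open>\<delta> > 0\<close> by (simp add: field_simps)
    qed simp
    then show "variation_sum ?f \<tau> m \<le> real k + 1" by (simp add: variation_sum_def)
  qed
qed

definition variation_upto :: "(real \<Rightarrow> real) \<Rightarrow> real \<Rightarrow> real" where
  "variation_upto f x =
     (SUP p\<in>{p. mono (fst p) \<and> range (fst p) \<subseteq> {..x}}. variation_sum f (fst p) (snd p))"

section \<open>The total variation function\<close>

context
  fixes f :: "real \<Rightarrow> real" and B :: real
  assumes bv: "\<And>\<tau> m. mono \<tau> \<Longrightarrow> variation_sum f \<tau> m \<le> B"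
begin

lemma bdd_above_variation_sum:
  "bdd_above ((\<lambda>p. variation_sum f (fst p) (snd p)) ` {p. mono (fst p) \<and> range (fst p) \<subseteq> {..x}})"
  using bv by (intro bdd_aboveI[where M=B]) auto

lemma variation_sum_le_upto:
  assumes "mono \<tau>" "range \<tau> \<subseteq> {..x}"
  shows "variation_sum f \<tau> m \<le> variation_upto f x"
  using assms cSUP_upper[OF _ bdd_above_variation_sum, of "(\<tau>, m)" x] by (simp add: variation_upto_def)

lemma variation_upto_approx:
  assumes "\<eta> > 0"
  obtains \<tau> m where "mono \<tau>" "range \<tau> \<subseteq> {..x}" "variation_upto f x < variation_sum f \<tau> m + \<eta>"
proof -
  let ?P = "{p :: (nat \<Rightarrow> real) \<times> nat. mono (fst p) \<and> range (fst p) \<subseteq> {..x}}"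
  have "(\<lambda>_. x, 0) \<in> ?P" by (simp add: mono_def)
  then have ne: "?P \<noteq> {}" by blast
  have "variation_upto f x - \<eta> < variation_upto f x" using assms by simp
  then obtain p where "p \<in> ?P" "variation_upto f x - \<eta> < variation_sum f (fst p) (snd p)"
    using less_cSUP_iff[OF ne bdd_above_variation_sum] unfolding variation_upto_def by blast
  then show thesis using that[of "fst p" "snd p"] by simp
qed

text \<open>A near-optimal partition of the half-line up to \<open>x\<close>, continued by the
  points \<open>x\<close> and \<open>y\<close>, is a partition of the half-line up to
  \<open>y\<close>.\<close>

lemma variation_upto_increment_ge:
  assumes "x \<le> y"
  shows "\<bar>f y - f x\<bar> \<le> variation_upto f y - variation_upto f x"
proof -
  have "variation_upto f x + \<bar>f y - f x\<bar> \<le> variation_upto f y + \<eta>" if "\<eta> > 0" for \<eta>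
  proof -
    obtain \<tau> m where \<tau>: "mono \<tau>" "range \<tau> \<subseteq> {..x}" "variation_upto f x < variation_sum f \<tau> m + \<eta>"
      using variation_upto_approx \<open>\<eta> > 0\<close> by blast
    have tx: "\<tau> i \<le> x" for i using \<tau>(2) by auto
    \<comment> \<open>The indices 0 to \<open>m\<close> of \<open>\<tau>\<close> are kept, so
      \<open>m + 2\<close> increments count: the last two lead from \<open>\<tau> m\<close> to
      \<open>x\<close> and from \<open>x\<close> to \<open>y\<close>.\<close>
    define \<sigma> where "\<sigma> i = (if i \<le> m then \<tau> i else if i = Suc m then x else y)" for i
    have "\<sigma> i \<le> \<sigma> (Suc i)" for i
      using monoD[OF \<tau>(1), of i "Suc i"] tx[of i] tx[of m] assms by (simp add: \<sigma>_def)
    then have "mono \<sigma>" by (simp add: mono_iff_le_Suc)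
    have "range \<sigma> \<subseteq> {..y}" using tx assms by (auto simp: \<sigma>_def intro: order_trans)
    then have "variation_sum f \<sigma> (m + 2) \<le> variation_upto f y"
      using variation_sum_le_upto \<open>mono \<sigma>\<close> by blast
    moreover have "variation_sum f \<sigma> (m + 2) = variation_sum f \<tau> m + \<bar>f x - f (\<tau> m)\<bar> + \<bar>f y - f x\<bar>"
      by (simp add: variation_sum_def \<sigma>_def)
    ultimately show ?thesis using \<tau>(3) by linarith
  qed
  then have "variation_upto f x + \<bar>f y - f x\<bar> \<le> variation_upto f y" by (rule field_le_epsilon)
  then show ?thesis by linarith
qed

text \<open>A near-optimal partition for \<open>y\<close> is cut at \<open>x\<close>. The part below
  \<open>x\<close> contributes at most the variation up to \<open>x\<close>, so the part inside
  \<open>{x..y}\<close> carries the increment up to \<open>\<eta>\<close>.\<close>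

lemma variation_upto_increment_le:
  assumes "x \<le> y" "\<eta> > 0"
  obtains \<tau> m where "mono \<tau>" "range \<tau> \<subseteq> {x..y}"
    "variation_upto f y - variation_upto f x < variation_sum f \<tau> m + \<eta>"
proof -
  obtain \<tau> m where \<tau>: "mono \<tau>" "range \<tau> \<subseteq> {..y}" "variation_upto f y < variation_sum f \<tau> m + \<eta>"
    using variation_upto_approx \<open>\<eta> > 0\<close> by blast
  have m1: "mono (\<lambda>i. min (\<tau> i) x)" "mono (\<lambda>i. max (\<tau> i) x)"
    using \<tau>(1) unfolding mono_def by (meson max.mono min.mono order_refl)+
  have "variation_sum f (\<lambda>i. min (\<tau> i) x) m \<le> variation_upto f x"
    by (rule variation_sum_le_upto[OF m1(1)]) auto
  then have "variation_upto f y - variation_upto f x < variation_sum f (\<lambda>i. max (\<tau> i) x) m + \<eta>"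
    using \<tau>(3) variation_sum_split[OF \<tau>(1), of f m x] by linarith
  moreover have "range (\<lambda>i. max (\<tau> i) x) \<subseteq> {x..y}" using \<tau>(2) assms by auto
  ultimately show thesis using that m1(2) by blast
qed

text \<open>Each interval of a family is replaced by a near-optimal partition of it. The refined
  family is nonoverlapping and no longer in total, so the \<open>\<delta>\<close> that serves
  \<open>f\<close> with tolerance \<open>\<epsilon>/2\<close> serves its variation with tolerance
  \<open>\<epsilon>\<close>.\<close>

lemma abs_continuous_variation_upto:
  assumes "abs_continuous_on_interval s t f"
  shows "abs_continuous_on_interval s t (variation_upto f)"
  unfolding abs_continuous_on_interval_iff
proof (intro allI impI)
  let ?V = "variation_upto f"
  fix \<epsilon> :: real assume "\<epsilon> > 0"
  then have "\<epsilon>/2 > 0" by simp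
  obtain \<delta> where "\<delta> > 0" and
    \<delta>: "\<And>(K::(nat\<times>nat) set) a b. finite K \<Longrightarrow> nonoverlapping s t K a b \<Longrightarrow> (\<Sum>i\<in>K. b i - a i) < \<delta>
      \<Longrightarrow> (\<Sum>i\<in>K. norm (f (b i) - f (a i))) < \<epsilon>/2"
    using abs_continuous_on_intervalD[OF assms \<open>\<epsilon>/2 > 0\<close>] by blast
  have "(\<Sum>i<m. norm (?V (b i) - ?V (a i))) < \<epsilon>"
    if no: "nonoverlapping s t {..<m} a b" and sml: "(\<Sum>i<m. b i - a i) < \<delta>" for m :: nat and a b
  proof -
    note ab = nonoverlappingD(1-3)[OF no, unfolded lessThan_iff]
      and dis = nonoverlappingD(4)[OF no, unfolded lessThan_iff]
    \<comment> \<open>The errors of the \<open>m\<close> partitions add up to at most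
      \<open>\<epsilon>/2\<close>; \<open>Suc m\<close> covers the empty family.\<close>
    define \<eta> where "\<eta> = \<epsilon> / (2 * real (Suc m))"
    have "\<eta> > 0" using \<open>\<epsilon> > 0\<close> by (simp add: \<eta>_def)
    have "\<exists>p. mono (fst p) \<and> range (fst p) \<subseteq> {a i..b i} \<and>
        ?V (b i) - ?V (a i) < variation_sum f (fst p) (snd p) + \<eta>" if "i < m" for i
    proof -
      have "a i \<le> b i" using ab that by blast
      from variation_upto_increment_le[OF this \<open>\<eta> > 0\<close>] obtain \<tau> l where
        "mono \<tau>" "range \<tau> \<subseteq> {a i..b i}" "?V (b i) - ?V (a i) < variation_sum f \<tau> l + \<eta>" .
      then show ?thesis by (intro exI[of _ "(\<tau>, l)"]) simp
    qed
    then have "\<exists>p. \<forall>i. i < m \<longrightarrow> mono (fst (p i)) \<and> range (fst (p i)) \<subseteq> {a i..b i} \<and>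
        ?V (b i) - ?V (a i) < variation_sum f (fst (p i)) (snd (p i)) + \<eta>"
      by (intro choice) blast
    then obtain p where p: "\<And>i. i < m \<Longrightarrow> mono (fst (p i)) \<and> range (fst (p i)) \<subseteq> {a i..b i} \<and>
        ?V (b i) - ?V (a i) < variation_sum f (fst (p i)) (snd (p i)) + \<eta>"
      by blast
    define \<tau> l where "\<tau> i = fst (p i)" and "l i = snd (p i)" for i
    have \<tau>: "\<And>i. i < m \<Longrightarrow> mono (\<tau> i)" "\<And>i. i < m \<Longrightarrow> range (\<tau> i) \<subseteq> {a i..b i}"
        "\<And>i. i < m \<Longrightarrow> ?V (b i) - ?V (a i) < variation_sum f (\<tau> i) (l i) + \<eta>"
      using p by (auto simp: \<tau>_def l_def)
    have \<tau>2: "a i \<le> \<tau> i j" "\<tau> i j \<le> b i" if "i < m" for i j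
      using range_subsetD[OF \<tau>(2)[OF that], of j] by auto
    let ?K = "Sigma {..<m} (\<lambda>i. {..<l i})"
    have "(\<Sum>(i,j)\<in>?K. norm (f (\<tau> i (Suc j)) - f (\<tau> i j))) < \<epsilon>/2"
    proof -
      have len: "(\<Sum>(i,j)\<in>?K. \<tau> i (Suc j) - \<tau> i j) < \<delta>"
      proof -
        have "(\<Sum>(i,j)\<in>?K. \<tau> i (Suc j) - \<tau> i j) = (\<Sum>i<m. \<Sum>j<l i. \<tau> i (Suc j) - \<tau> i j)"
          by (rule sum.Sigma[symmetric]) auto
        also have "\<dots> = (\<Sum>i<m. \<tau> i (l i) - \<tau> i 0)" by (simp add: sum_lessThan_telescope)
        also have "\<dots> \<le> (\<Sum>i<m. b i - a i)" using \<tau>2 by (intro sum_mono) (simp add: diff_mono)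
        finally show ?thesis using sml by simp
      qed
      have "(\<Sum>k\<in>?K. norm (f ((\<lambda>(i,j). \<tau> i (Suc j)) k) - f ((\<lambda>(i,j). \<tau> i j) k))) < \<epsilon>/2"
      proof (rule \<delta>)
        show "finite ?K" by simp
        have 1: "s \<le> (\<lambda>(i,j). \<tau> i j) k \<and> (\<lambda>(i,j). \<tau> i j) k \<le> (\<lambda>(i,j). \<tau> i (Suc j)) k \<and> (\<lambda>(i,j). \<tau> i (Suc j)) k \<le> t"
          if k: "k \<in> ?K" for k
        proof -
          obtain i j where [simp]: "k = (i,j)" by force
          have i: "i < m" using k by simp
          show ?thesis using \<tau>2[OF i, of j] \<tau>2[OF i, of "Suc j"] monoD[OF \<tau>(1)[OF i], of j "Suc j"] ab(1,3)[OF i]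
            by simp
        qed
        have 2: "{(\<lambda>(i,j). \<tau> i j) k<..<(\<lambda>(i,j). \<tau> i (Suc j)) k} \<inter> {(\<lambda>(i,j). \<tau> i j) k'<..<(\<lambda>(i,j). \<tau> i (Suc j)) k'} = {}"
          if k: "k \<in> ?K" "k' \<in> ?K" "k \<noteq> k'" for k k'
        proof -
          obtain i j i' j' where [simp]: "k = (i,j)" "k' = (i',j')" by force
          have i: "i < m" "i' < m" using k by auto
          show ?thesis
          \<comment> \<open>Intervals of one partition are disjoint by monotonicity, those of
            different partitions because the surrounding intervals are disjoint.\<close>
          proof (cases "i = i'")
            case True
            then show ?thesis using mono_intervals_disjoint[OF \<tau>(1)[OF i(1)], of j j'] k(3) by auto
          next
            case False
            have "{\<tau> i j<..<\<tau> i (Suc j)} \<subseteq> {a i<..<b i}" "{\<tau> i' j'<..<\<tau> i' (Suc j')} \<subseteq> {a i'<..<b i'}"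
              using \<tau>2[OF i(1), of j] \<tau>2[OF i(1), of "Suc j"] \<tau>2[OF i(2), of j'] \<tau>2[OF i(2), of "Suc j'"]
              by auto
            then show ?thesis using dis[OF i False] unfolding case_prod_conv \<open>k = (i,j)\<close> \<open>k' = (i',j')\<close> by blast
          qed
        qed
        show "nonoverlapping s t ?K (\<lambda>(i,j). \<tau> i j) (\<lambda>(i,j). \<tau> i (Suc j))"
          unfolding nonoverlapping_def using 1 2 by blast
        show "(\<Sum>k\<in>?K. (\<lambda>(i,j). \<tau> i (Suc j)) k - (\<lambda>(i,j). \<tau> i j) k) < \<delta>"
          using len by (simp add: case_prod_unfold)
      qed
      then show ?thesis by (simp add: case_prod_unfold)
    qed
    moreover have "(\<Sum>(i,j)\<in>?K. norm (f (\<tau> i (Suc j)) - f (\<tau> i j))) = (\<Sum>i<m. variation_sum f (\<tau> i) (l i))"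
      unfolding variation_sum_def by (subst sum.Sigma) auto
    moreover have "(\<Sum>i<m. norm (?V (b i) - ?V (a i))) \<le> (\<Sum>i<m. variation_sum f (\<tau> i) (l i) + \<eta>)"
    proof (rule sum_mono)
      fix i assume "i \<in> {..<m}"
      then have i: "i < m" by simp
      have "0 \<le> ?V (b i) - ?V (a i)"
        using variation_upto_increment_ge[OF ab(2)[OF i]] by linarith
      then show "norm (?V (b i) - ?V (a i)) \<le> variation_sum f (\<tau> i) (l i) + \<eta>" using \<tau>(3)[OF i] by simp
    qed
    moreover have "real m * \<eta> \<le> \<epsilon>/2" using \<open>\<epsilon> > 0\<close> by (simp add: \<eta>_def field_simps)
    ultimately show ?thesis by (simp add: sum.distrib)
  qed
  with \<open>\<delta> > 0\<close> show "\<exists>\<delta>>0. \<forall>(m::nat) a b. nonoverlapping s t {..<m} a b \<longrightarrow> (\<Sum>i<m. b i - a i) < \<delta> \<longrightarrow>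
        (\<Sum>i<m. norm (?V (b i) - ?V (a i))) < \<epsilon>"
    by blast
qed

end

section \<open>Densities and almost everywhere differentiability\<close>

context
  fixes G :: "real \<Rightarrow> real"
  assumes mono: "\<And>x y. x \<le> y \<Longrightarrow> G x \<le> G y"
    and ac: "\<And>s t. abs_continuous_on_interval s t G"
begin

lemma continuous_on_locally_abs_continuous: "continuous_on UNIV G"
proof (rule continuous_at_imp_continuous_on, rule ballI)
  fix x
  have "continuous_on {x-1..x+1} G" using ac by (rule abs_continuous_imp_continuous_on)
  then have "continuous_on {x-1<..<x+1} G" by (rule continuous_on_subset) auto
  then show "isCont G x" by (simp add: continuous_on_eq_continuous_at)
qed

lemma emeasure_interval_measure_locally_abs_continuous:
  assumes "x \<le> y"
  shows "emeasure (interval_measure G) {x<..y} = ennreal (G y - G x)"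
  using continuous_on_locally_abs_continuous assms
  by (intro emeasure_interval_measure_Ioc mono)
     (auto intro: continuous_within_subset simp: continuous_on_eq_continuous_within)

text \<open>The set measured here consists of the points of \<open>{-R<..R}\<close> at distance at least \<open>r\<close> from the
  complement of \<open>U\<close>; grid cells shorter than \<open>r\<close> that meet it are contained in \<open>U\<close>.\<close>

lemma emeasure_interval_measure_grid_le:
  assumes U: "U \<in> sets borel" "emeasure lborel U < ennreal \<delta>" and "r > 0" "R > 0"
    and \<delta>: "\<And>(K::nat set) a b. finite K \<Longrightarrow> nonoverlapping (-R) R K a b \<Longrightarrow> (\<Sum>i\<in>K. b i - a i) < \<delta>
      \<Longrightarrow> (\<Sum>i\<in>K. norm (G (b i) - G (a i))) < \<epsilon>"
  shows "emeasure (interval_measure G) ({-R<..R} - (\<Union>y\<in>-U. ball y r)) \<le> ennreal \<epsilon>"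
proof -
  obtain n :: nat where n: "2 * R / r < real n" using reals_Archimedean2 by blast
  moreover have "0 < 2 * R / r" using \<open>r > 0\<close> \<open>R > 0\<close> by simp
  ultimately have "n > 0" by (metis gr0I less_asym of_nat_0)
  define w where "w = 2 * R / real n"
  have w: "0 < w" "w < r" "real n * w = 2 * R"
    using n \<open>n > 0\<close> \<open>r > 0\<close> \<open>R > 0\<close> by (simp_all add: w_def field_simps)
  define c where "c i = -R + real i * w" for i
  have c_Suc: "c (Suc i) = c i + w" for i by (simp add: c_def algebra_simps)
  have c_mono: "c i \<le> c j" if "i \<le> j" for i j using that w by (simp add: c_def)
  define J where "J = {i. i < n \<and> {c i<..c (Suc i)} \<subseteq> U}"
  have "finite J" by (simp add: J_def)
  have dis: "disjoint_family_on (\<lambda>i. {c i<..c (Suc i)}) J"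
  proof -
    have "{c i<..c (Suc i)} \<inter> {c j<..c (Suc j)} = {}" if "i \<noteq> j" for i j
    proof -
      have "c (Suc i) \<le> c j \<or> c (Suc j) \<le> c i" using that c_mono by (metis Suc_leI linorder_neqE_nat)
      then show ?thesis by auto
    qed
    then show ?thesis by (auto simp: disjoint_family_on_def)
  qed
  have cover: "{-R<..R} - (\<Union>y\<in>-U. ball y r) \<subseteq> (\<Union>i\<in>J. {c i<..c (Suc i)})"
  proof
    fix x assume x: "x \<in> {-R<..R} - (\<Union>y\<in>-U. ball y r)"
    \<comment> \<open>Cells are open on the left, so the one containing \<open>x\<close> has index
      one below the ceiling. The quotient is positive, hence the subtraction of natural numbers is
      exact.\<close>
    define k where "k = nat \<lceil>(x + R) / w\<rceil> - 1"
    have pos: "0 < (x + R) / w" using x w by simp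
    then have k1: "real k + 1 = of_int \<lceil>(x + R) / w\<rceil>"
      unfolding k_def by linarith
    have kx: "real k < (x + R) / w" "(x + R) / w \<le> real k + 1"
      unfolding atomize_conj using k1 by linarith
    then have xk: "c k < x" "x \<le> c (Suc k)" using w unfolding c_def by (simp_all add: field_simps)
    have "x \<le> R" using x by simp
    then have "(x + R) / w \<le> real n" using w by (simp add: field_simps)
    then have "k < n" using kx by linarith
    moreover have "{c k<..c (Suc k)} \<subseteq> U"
    proof
      fix y assume y: "y \<in> {c k<..c (Suc k)}"
      then have "dist y x < r" using xk w c_Suc[of k] by (auto simp: dist_real_def)
      then show "y \<in> U" using x by (auto simp: mem_ball)
    qed
    ultimately have "k \<in> J" by (simp add: J_def)
    then show "x \<in> (\<Union>i\<in>J. {c i<..c (Suc i)})" using xk by auto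
  qed
  \<comment> \<open>The selected cells are disjoint and lie in \<open>U\<close>, so their total
    length inherits the bound on the measure of \<open>U\<close>.\<close>
  have "ennreal (\<Sum>i\<in>J. c (Suc i) - c i) = (\<Sum>i\<in>J. emeasure lborel {c i<..c (Suc i)})"
    using c_mono by (subst sum_ennreal[symmetric]) (auto intro!: sum.cong)
  also have "\<dots> = emeasure lborel (\<Union>i\<in>J. {c i<..c (Suc i)})"
    using dis \<open>finite J\<close> by (intro sum_emeasure) auto
  also have "\<dots> \<le> emeasure lborel U" using U by (intro emeasure_mono) (auto simp: J_def)
  also have "\<dots> < ennreal \<delta>" by fact
  finally have len: "(\<Sum>i\<in>J. c (Suc i) - c i) < \<delta>"
    using c_mono by (subst (asm) ennreal_less_iff) (auto intro!: sum_nonneg)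
  have no: "nonoverlapping (-R) R J c (\<lambda>i. c (Suc i))"
  proof -
    have "-R \<le> c i \<and> c i \<le> c (Suc i) \<and> c (Suc i) \<le> R" if "i \<in> J" for i
    proof -
      have "Suc i \<le> n" using that by (auto simp: J_def)
      moreover have "c n = R" "c 0 = -R" using w by (auto simp: c_def)
      ultimately show ?thesis using c_mono[of 0 i] c_mono[of i "Suc i"] c_mono[of "Suc i" n] by simp
    qed
    moreover have "{c i<..<c (Suc i)} \<inter> {c j<..<c (Suc j)} = {}" if "i \<in> J" "j \<in> J" "i \<noteq> j" for i j
    proof -
      have "{c i<..c (Suc i)} \<inter> {c j<..c (Suc j)} = {}" using dis that by (auto simp only: disjoint_family_on_def)
      moreover have "{c i<..<c (Suc i)} \<subseteq> {c i<..c (Suc i)}" for i by auto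
      ultimately show ?thesis by blast
    qed
    ultimately show ?thesis unfolding nonoverlapping_def by blast
  qed
  have "emeasure (interval_measure G) ({-R<..R} - (\<Union>y\<in>-U. ball y r))
      \<le> emeasure (interval_measure G) (\<Union>i\<in>J. {c i<..c (Suc i)})"
    using cover by (intro emeasure_mono) auto
  also have "\<dots> \<le> (\<Sum>i\<in>J. emeasure (interval_measure G) {c i<..c (Suc i)})"
    using \<open>finite J\<close> by (intro emeasure_subadditive_finite) auto
  also have "\<dots> = (\<Sum>i\<in>J. ennreal (norm (G (c (Suc i)) - G (c i))))"
    using c_mono mono by (intro sum.cong) (auto simp: emeasure_interval_measure_locally_abs_continuous)
  also have "\<dots> = ennreal (\<Sum>i\<in>J. norm (G (c (Suc i)) - G (c i)))" by (simp add: sum_ennreal)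
  also have "\<dots> \<le> ennreal \<epsilon>" using \<delta>[OF \<open>finite J\<close> no len] by (simp add: ennreal_leI)
  finally show ?thesis .
qed

text \<open>On a bounded window, a null set lies in an open \<open>U\<close> of measure below
  \<open>\<delta>\<close>. The grid estimate bounds the Stieltjes measure of the points well inside
  \<open>U\<close>, and these exhaust the part of \<open>U\<close> in the window. The tolerance then
  tends to 0 and the window grows.\<close>

lemma absolutely_continuous_interval_measure: "absolutely_continuous lborel (interval_measure G)"
  unfolding absolutely_continuous_def
proof
  let ?M = "interval_measure G"
  fix E :: "real set" assume E: "E \<in> null_sets lborel"
  then have Eb: "E \<in> sets borel" by (simp add: null_sets_def)
  have bounded_part: "emeasure ?M (E \<inter> {-R<..R}) \<le> ennreal \<epsilon>" if "R > 0" "\<epsilon> > 0" for R \<epsilon> :: real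
  proof -
    obtain \<delta> where "\<delta> > 0" and
      \<delta>: "\<And>(K::nat set) a b. finite K \<Longrightarrow> nonoverlapping (-R) R K a b \<Longrightarrow> (\<Sum>i\<in>K. b i - a i) < \<delta>
      \<Longrightarrow> (\<Sum>i\<in>K. norm (G (b i) - G (a i))) < \<epsilon>"
      using abs_continuous_on_intervalD[OF ac \<open>\<epsilon> > 0\<close>, of "-R" R] by blast
    obtain U where U: "open U" "E \<subseteq> U" "emeasure lborel (U - E) < \<delta>"
      using outer_regular_lborel[OF Eb \<open>\<delta> > 0\<close>] by blast
    have "emeasure lborel U = emeasure lborel (U - E)"
      using E U(1) by (intro emeasure_Diff_null_set[symmetric]) auto
    then have Ud: "emeasure lborel U < ennreal \<delta>" using U(3) by simp
    define K where "K n = {-R<..R} - (\<Union>y\<in>-U. ball y (1 / real (Suc n)))" for n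
    have "incseq K"
    proof (intro incseq_SucI)
      fix n
      have "1 / real (Suc (Suc n)) \<le> 1 / real (Suc n)" by (simp add: frac_le)
      then show "K n \<le> K (Suc n)" unfolding K_def by (fastforce simp: mem_ball)
    qed
    have "E \<inter> {-R<..R} \<subseteq> (\<Union>n. K n)"
    proof
      fix x assume x: "x \<in> E \<inter> {-R<..R}"
      then obtain e where "e > 0" "ball x e \<subseteq> U" using U(1,2) by (meson IntD1 openE subsetD)
      moreover obtain n where "1 / real (Suc n) < e" using \<open>e > 0\<close> nat_approx_posE by metis
      ultimately have "x \<in> K n" using x by (fastforce simp: K_def mem_ball dist_commute subset_iff)
      then show "x \<in> (\<Union>n. K n)" by blast
    qed
    moreover have Kb: "K n \<in> sets ?M" for n
      unfolding K_def sets_interval_measure by (intro sets.Diff borel_open open_UN greaterThanAtMost_borel) auto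
    ultimately have "emeasure ?M (E \<inter> {-R<..R}) \<le> emeasure ?M (\<Union>n. K n)"
      by (intro emeasure_mono) auto
    also have "\<dots> = (SUP n. emeasure ?M (K n))"
      using \<open>incseq K\<close> Kb by (intro SUP_emeasure_incseq[symmetric]) auto
    also have "\<dots> \<le> ennreal \<epsilon>"
      unfolding K_def using U(1) Ud \<open>R > 0\<close> \<delta>
      by (intro SUP_least emeasure_interval_measure_grid_le) auto
    finally show ?thesis .
  qed
  have "emeasure ?M (E \<inter> {-real (Suc n)<..real (Suc n)}) = 0" for n
  proof -
    have "emeasure ?M (E \<inter> {-real (Suc n)<..real (Suc n)}) \<le> 0"
    proof (rule ennreal_le_epsilon)
      fix \<epsilon> :: real assume "0 < \<epsilon>"
      then show "emeasure ?M (E \<inter> {-real (Suc n)<..real (Suc n)}) \<le> 0 + ennreal \<epsilon>"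
        using bounded_part[of "real (Suc n)" \<epsilon>] by (simp del: of_nat_Suc)
    qed
    then show ?thesis by simp
  qed
  then have "E \<inter> {-real (Suc n)<..real (Suc n)} \<in> null_sets ?M" for n
    using Eb by (auto simp: null_sets_def)
  then have "(\<Union>n. E \<inter> {-real (Suc n)<..real (Suc n)}) \<in> null_sets ?M" by (rule null_sets_UN)
  moreover have "(\<Union>n. E \<inter> {-real (Suc n)<..real (Suc n)}) = E"
  proof -
    have "\<exists>n. -real (Suc n) < x \<and> x \<le> real (Suc n)" for x
    proof -
      obtain n where "\<bar>x\<bar> < real n" using reals_Archimedean2 by blast
      then show ?thesis by (intro exI[of _ n]) auto
    qed
    then show ?thesis by auto
  qed
  ultimately show "E \<in> null_sets ?M" by simp
qed

lemma monotone_abs_continuous_density: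
  obtains h :: "real \<Rightarrow> real" where "\<And>x. 0 \<le> h x" "\<And>x y. x \<le> y \<Longrightarrow> (h has_integral G y - G x) {x..y}"
proof -
  obtain f :: "real \<Rightarrow> ennreal" where f[measurable]: "f \<in> borel_measurable lborel"
    and dens: "density lborel f = interval_measure G"
    using sigma_finite_measure.Radon_Nikodym[OF sigma_finite_lborel absolutely_continuous_interval_measure]
    by auto
  have int: "(\<integral>\<^sup>+t. f t * indicator {x..y} t \<partial>lborel) = ennreal (G y - G x)" if "x \<le> y" for x y
  proof -
    have "emeasure (interval_measure G) {x..y} = ennreal (G y - G x)"
      using that by (intro emeasure_interval_measure_Icc mono continuous_on_locally_abs_continuous) auto
    then show ?thesis by (simp add: dens[symmetric] emeasure_density)
  qed
  \<comment> \<open>\<open>enn2real\<close> sends infinity to 0, so the density must be finite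
    almost everywhere before it is made real; its integrals over the windows
    \<open>{- real n..real n}\<close> are finite.\<close>
  have "AE t in lborel. f t * indicator {- real n..real n} t \<noteq> \<infinity>" for n
    using int[of "- real n" "real n"] by (intro nn_integral_noteq_infinite) auto
  then have "AE t in lborel. \<forall>n. f t * indicator {- real n..real n} t \<noteq> \<infinity>"
    by (simp add: AE_all_countable)
  then have fin: "AE t in lborel. f t \<noteq> \<infinity>"
  proof eventually_elim
    case (elim t)
    obtain n where "\<bar>t\<bar> < real n" using reals_Archimedean2 by blast
    then have "t \<in> {- real n..real n}" by auto
    then show ?case using elim by (metis indicator_simps(1) mult.right_neutral)
  qed
  show thesis
  proof (rule that)
    show "0 \<le> enn2real (f x)" for x by simp
    show "((\<lambda>x. enn2real (f x)) has_integral G y - G x) {x..y}" if "x \<le> y" for x y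
    proof -
      let ?h = "\<lambda>t. enn2real (f t) * indicator {x..y} t"
      have "(\<integral>\<^sup>+t. ennreal (?h t) \<partial>lborel) = (\<integral>\<^sup>+t. f t * indicator {x..y} t \<partial>lborel)"
        using fin by (intro nn_integral_cong_AE) (auto elim!: eventually_mono simp: indicator_def less_top)
      then have "(?h has_integral G y - G x) UNIV"
        using mono[OF that] int[OF that] by (intro nn_integral_has_integral) auto
      moreover have "?h = (\<lambda>t. if t \<in> {x..y} then enn2real (f t) else 0)" by (auto simp: fun_eq_iff)
      ultimately show ?thesis by (simp only: has_integral_restrict_UNIV)
    qed
  qed
qed

end

text \<open>Jordan decomposition: the clamped extension \<open>f'\<close> is the difference of
  \<open>V\<close> and \<open>V - f'\<close>, both monotone and absolutely continuous, hence both
  with nonnegative densities. Because the extension lives on the whole line, \<open>h\<close> is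
  integrable on every interval, also outside \<open>{a..b}\<close>.\<close>

lemma abs_continuous_has_integral:
  fixes f :: "real \<Rightarrow> real"
  assumes f: "abs_continuous_on_interval a b f" and "a \<le> b"
  obtains h :: "real \<Rightarrow> real" where "\<And>x y. x \<le> y \<Longrightarrow> h absolutely_integrable_on {x..y}"
    "\<And>x y. a \<le> x \<Longrightarrow> x \<le> y \<Longrightarrow> y \<le> b \<Longrightarrow> (h has_integral f y - f x) {x..y}"
proof -
  define f' where "f' = f \<circ> clamp_ivl a b"
  have ac: "abs_continuous_on_interval s t f'" for s t
    unfolding f'_def by (rule abs_continuous_clamp[OF f \<open>a \<le> b\<close>])
  obtain B where bv: "\<And>\<tau> m. mono \<tau> \<Longrightarrow> variation_sum f' \<tau> m \<le> B"
    unfolding f'_def using variation_sum_bounded[OF f \<open>a \<le> b\<close>] by blast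
  define V where "V = variation_upto f'"
  have V: "\<bar>f' y - f' x\<bar> \<le> V y - V x" if "x \<le> y" for x y
    unfolding V_def using bv that by (rule variation_upto_increment_ge)
  have acV: "abs_continuous_on_interval s t V" for s t
    unfolding V_def using bv ac by (rule abs_continuous_variation_upto)
  have acD: "abs_continuous_on_interval s t (\<lambda>x. V x - f' x)" for s t
    unfolding abs_continuous_on_interval_iff
  proof (intro allI impI)
    fix e :: real assume "e > 0"
    obtain d1 where "d1 > 0" and d1: "\<And>(m::nat) a b. nonoverlapping s t {..<m} a b \<Longrightarrow> (\<Sum>i<m. b i - a i) < d1
        \<Longrightarrow> (\<Sum>i<m. norm (V (b i) - V (a i))) < e/2"
      using acV[of s t] \<open>e > 0\<close> unfolding abs_continuous_on_interval_iff by (meson half_gt_zero)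
    have "(\<Sum>i<m. norm (V (v i) - f' (v i) - (V (u i) - f' (u i)))) < e"
      if uv: "nonoverlapping s t {..<m} u v" "(\<Sum>i<m. v i - u i) < d1" for m :: nat and u v
    proof -
      \<comment> \<open>Factor 2, because an increment of \<open>f'\<close> is at most the increment
        of \<open>V\<close> in absolute value.\<close>
      have "norm (V (v i) - f' (v i) - (V (u i) - f' (u i))) \<le> 2 * norm (V (v i) - V (u i))" if "i < m" for i
        using V[OF nonoverlappingD(2)[OF uv(1)], of i] that by simp
      then have "(\<Sum>i<m. norm (V (v i) - f' (v i) - (V (u i) - f' (u i)))) \<le> 2 * (\<Sum>i<m. norm (V (v i) - V (u i)))"
        unfolding sum_distrib_left by (intro sum_mono) auto
      then show ?thesis using d1[OF uv] by simp
    qed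
    with \<open>d1 > 0\<close> show "\<exists>\<delta>>0. \<forall>(m::nat) u v. nonoverlapping s t {..<m} u v \<longrightarrow> (\<Sum>i<m. v i - u i) < \<delta> \<longrightarrow>
        (\<Sum>i<m. norm (V (v i) - f' (v i) - (V (u i) - f' (u i)))) < e"
      by blast
  qed
  obtain h1 where h1: "\<And>x. 0 \<le> h1 x" "\<And>x y. x \<le> y \<Longrightarrow> (h1 has_integral V y - V x) {x..y}"
    by (rule monotone_abs_continuous_density[of V]) (use V acV in fastforce)+
  obtain h2 where h2: "\<And>x. 0 \<le> h2 x"
      "\<And>x y. x \<le> y \<Longrightarrow> (h2 has_integral (V y - f' y) - (V x - f' x)) {x..y}"
    by (rule monotone_abs_continuous_density[of "\<lambda>x. V x - f' x"]) (use V acD in fastforce)+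
  show thesis
  proof (rule that)
    fix x y :: real assume "x \<le> y"
    then have "h1 integrable_on {x..y}" "h2 integrable_on {x..y}" using h1(2) h2(2) by blast+
    then show "(\<lambda>x. h1 x - h2 x) absolutely_integrable_on {x..y}"
      using h1(1) h2(1) by (intro set_integral_diff nonnegative_absolutely_integrable_1) auto
  next
    fix x y assume xy: "a \<le> x" "x \<le> y" "y \<le> b"
    have "((\<lambda>x. h1 x - h2 x) has_integral (V y - V x) - ((V y - f' y) - (V x - f' x))) {x..y}"
      using h1(2) h2(2) xy by (intro has_integral_diff) auto
    moreover have "f' y = f y" "f' x = f x" using xy by (auto simp: f'_def clamp_ivl_def)
    ultimately show "((\<lambda>x. h1 x - h2 x) has_integral f y - f x) {x..y}" by simp
  qed
qed

text \<open>\<open>integrable_ccontinuous_explicit\<close> averages over boxes with \<open>x\<close>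
  as lower corner. On the line these are the intervals to the right of \<open>x\<close>, so it
  controls right-hand averages.\<close>

lemma integral_right_derivative_ae:
  fixes h :: "real \<Rightarrow> real"
  assumes "\<And>x y. h integrable_on {x..y}"
  obtains N where "negligible N"
    "\<And>x e. x \<notin> N \<Longrightarrow> 0 < e \<Longrightarrow> \<exists>d>0. \<forall>k. 0 < k \<and> k < d \<longrightarrow> \<bar>integral {x..x + k} h / k - h x\<bar> < e"
proof -
  obtain N where "negligible N" and N: "\<And>x e. x \<notin> N \<Longrightarrow> 0 < e \<Longrightarrow>
      \<exists>d>0. \<forall>k. 0 < k \<and> k < d \<longrightarrow> norm (integral (cbox x (x + k *\<^sub>R One)) h /\<^sub>R k ^ DIM(real) - h x) < e"
    using integrable_ccontinuous_explicit[of h] assms unfolding cbox_interval by blast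
  show thesis
    using N by (intro that[OF \<open>negligible N\<close>]) (simp add: divide_inverse mult.commute)
qed

text \<open>Left-hand difference quotients at \<open>x\<close> are right-hand averages at
  \<open>-x\<close> of the reflected integrand, so the one-sided result is applied twice.\<close>

lemma indefinite_integral_has_derivative_ae:
  fixes f h :: "real \<Rightarrow> real"
  assumes int: "\<And>x y. h integrable_on {x..y}"
    and f: "\<And>x y. a \<le> x \<Longrightarrow> x \<le> y \<Longrightarrow> y \<le> b \<Longrightarrow> (h has_integral f y - f x) {x..y}"
  obtains N where "negligible N" "\<And>x. x \<in> {a<..<b} - N \<Longrightarrow> (f has_real_derivative h x) (at x)"
proof -
  obtain N1 where N1: "negligible N1"
    "\<And>x e. x \<notin> N1 \<Longrightarrow> 0 < e \<Longrightarrow> \<exists>d>0. \<forall>k. 0 < k \<and> k < d \<longrightarrow> \<bar>integral {x..x + k} h / k - h x\<bar> < e"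
    using integral_right_derivative_ae[OF int] by blast
  have int': "(\<lambda>x. h (- x)) integrable_on {x..y}" for x y
    using int[of "-y" "-x"]
      Henstock_Kurzweil_Integration.integrable_reflect_real[where a="-y" and b="-x" and f=h] by simp
  obtain N2 where N2: "negligible N2"
    "\<And>x e. x \<notin> N2 \<Longrightarrow> 0 < e \<Longrightarrow> \<exists>d>0. \<forall>k. 0 < k \<and> k < d \<longrightarrow> \<bar>integral {x..x + k} (\<lambda>x. h (- x)) / k - h (- x)\<bar> < e"
    using integral_right_derivative_ae[OF int'] by blast
  have "negligible (uminus ` N2)"
    using N2(1) by (rule negligible_differentiable_image_negligible[OF order_refl])
       (auto intro!: derivative_intros simp: differentiable_on_def)
  then have "negligible (N1 \<union> uminus ` N2)" using N1(1) by simp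
  moreover have "(f has_real_derivative h x) (at x)" if x: "x \<in> {a<..<b} - (N1 \<union> uminus ` N2)" for x
    unfolding has_field_derivative_iff
  proof (rule LIM_I)
    fix e :: real assume "e > 0"
    obtain d1 where d1: "d1 > 0" "\<And>k. 0 < k \<Longrightarrow> k < d1 \<Longrightarrow> \<bar>integral {x..x + k} h / k - h x\<bar> < e"
      using N1(2)[of x e] x \<open>e > 0\<close> by blast
    have "- x \<notin> N2" using x by force
    then obtain d2 where d2: "d2 > 0"
        "\<And>k. 0 < k \<Longrightarrow> k < d2 \<Longrightarrow> \<bar>integral {-x..-x + k} (\<lambda>x. h (- x)) / k - h x\<bar> < e"
      using N2(2)[of "-x" e] \<open>e > 0\<close> by auto
    \<comment> \<open>The distances to \<open>a\<close> and \<open>b\<close> enter because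
      \<open>h\<close> integrates to the increments of \<open>f\<close> inside
      \<open>{a..b}\<close>.\<close>
    define d where "d = min (min d1 d2) (min (x - a) (b - x))"
    have "d > 0" using d1 d2 x by (simp add: d_def)
    moreover have "norm ((f y - f x) / (y - x) - h x) < e" if y: "y \<noteq> x" "norm (y - x) < d" for y
    proof (cases "x < y")
      case True
      define k where "k = y - x"
      have k: "0 < k" "k < d1" "y = x + k" "y \<le> b" using y True by (auto simp: k_def d_def)
      have "integral {x..x + k} h = f y - f x"
        using f[of x y] x k by (auto intro: integral_unique)
      then show ?thesis using d1(2)[OF k(1,2)] k(3) by simp
    next
      case False
      define k where "k = x - y"
      have k: "0 < k" "k < d2" "y = x - k" "a \<le> y" using y False by (auto simp: k_def d_def)
      have "integral {-x..-x + k} (\<lambda>x. h (- x)) = integral {y..x} h"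
        using Henstock_Kurzweil_Integration.integral_reflect_real[where a=y and b=x and f=h] k by simp
      also have "\<dots> = f x - f y"
        using f[of y x] x k by (auto intro: integral_unique)
      finally have "\<bar>(f x - f y) / k - h x\<bar> < e" using d2(2)[OF k(1,2)] by simp
      moreover have "(f x - f y) / k = (f y - f x) / (y - x)" by (metis k_def minus_diff_eq minus_divide_divide)
      ultimately show ?thesis by simp
    qed
    ultimately show "\<exists>s>0. \<forall>y. y \<noteq> x \<and> norm (y - x) < s \<longrightarrow> norm ((f y - f x) / (y - x) - h x) < e"
      by blast
  qed
  ultimately show thesis by (rule that)
qed

section \<open>Derivatives and increments of absolutely continuous functions\<close>

lemma AE_lebesgue_if_notin_negligible:
  assumes "negligible N" "\<And>x. x \<notin> N \<Longrightarrow> P x"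
  shows "AE x in lebesgue. P x"
  using assms by (intro AE_I'[of N]) (auto simp: negligible_iff_null_sets)

lemma abs_continuous_differentiable_ae_real:
  fixes f :: "real \<Rightarrow> real"
  assumes "abs_continuous_on_interval a b f"
  shows "AE x in lebesgue. x \<in> {a<..<b} \<longrightarrow> f differentiable (at x)"
proof (cases "a \<le> b")
  case True
  obtain h :: "real \<Rightarrow> real" where h: "\<And>x y. x \<le> y \<Longrightarrow> h absolutely_integrable_on {x..y}"
    "\<And>x y. a \<le> x \<Longrightarrow> x \<le> y \<Longrightarrow> y \<le> b \<Longrightarrow> (h has_integral f y - f x) {x..y}"
    using abs_continuous_has_integral[OF assms True] by blast
  have int: "h integrable_on {x..y}" for x y
    using h(1) by (cases "x \<le> y") (auto intro: set_lebesgue_integral_eq_integral)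
  obtain N where "negligible N" "\<And>x. x \<in> {a<..<b} - N \<Longrightarrow> (f has_real_derivative h x) (at x)"
    using indefinite_integral_has_derivative_ae[OF int h(2)] by blast
  then show ?thesis
    by (intro AE_lebesgue_if_notin_negligible[of N]) (auto simp: real_differentiable_def)
qed simp

lemma abs_continuous_differentiable_ae:
  fixes f :: "real \<Rightarrow> 'b::euclidean_space"
  assumes "abs_continuous_on_interval a b f"
  shows "AE x in lebesgue. x \<in> {a<..<b} \<longrightarrow> f differentiable (at x)"
proof -
  have "AE x in lebesgue. x \<in> {a<..<b} \<longrightarrow> (\<lambda>x. f x \<bullet> i) differentiable (at x)" if "i \<in> Basis" for i
  proof (rule abs_continuous_differentiable_ae_real)
    have "1-lipschitz_on UNIV (\<lambda>x. x \<bullet> i)"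
    proof (rule lipschitz_onI)
      fix x y :: 'b
      have "\<bar>(x - y) \<bullet> i\<bar> \<le> norm (x - y)" using that by (rule Basis_le_norm)
      then show "dist (x \<bullet> i) (y \<bullet> i) \<le> 1 * dist x y" by (simp add: dist_norm inner_diff_left)
    qed simp
    then have "abs_continuous_on_interval a b ((\<lambda>x. x \<bullet> i) \<circ> f)"
      by (rule abs_continuous_lipschitz_compose[OF assms]) simp
    then show "abs_continuous_on_interval a b (\<lambda>x. f x \<bullet> i)" by (simp add: o_def)
  qed
  then have "AE x in lebesgue. \<forall>i\<in>Basis. x \<in> {a<..<b} \<longrightarrow> (\<lambda>x. f x \<bullet> i) differentiable (at x)"
    by (intro AE_finite_allI) auto
  then show ?thesis
    by eventually_elim (metis differentiable_componentwise_within)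
qed

text \<open>The bound is asked only where a derivative exists, and \<open>F\<close> is an arbitrary
  function, as suits the speed of a curve. The measurable density \<open>h\<close> carries the
  integration; \<open>F\<close> enters through monotonicity alone.\<close>

lemma abs_continuous_increment_le_nn_integral:
  fixes u :: "real \<Rightarrow> real"
  assumes u: "abs_continuous_on_interval a b u" and "a \<le> b"
    and F: "AE x in lebesgue. x \<in> {a<..<b} \<longrightarrow> (\<forall>D. (u has_real_derivative D) (at x) \<longrightarrow> ennreal \<bar>D\<bar> \<le> F x)"
  shows "ennreal \<bar>u b - u a\<bar> \<le> (\<integral>\<^sup>+x\<in>{a..b}. F x \<partial>lebesgue)"
proof -
  obtain h :: "real \<Rightarrow> real" where h: "\<And>x y. x \<le> y \<Longrightarrow> h absolutely_integrable_on {x..y}"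
    "\<And>x y. a \<le> x \<Longrightarrow> x \<le> y \<Longrightarrow> y \<le> b \<Longrightarrow> (h has_integral u y - u x) {x..y}"
    using abs_continuous_has_integral[OF u \<open>a \<le> b\<close>] by blast
  have int: "h integrable_on {x..y}" for x y
    using h(1) by (cases "x \<le> y") (auto intro: set_lebesgue_integral_eq_integral)
  obtain N where N: "negligible N" "\<And>x. x \<in> {a<..<b} - N \<Longrightarrow> (u has_real_derivative h x) (at x)"
    using indefinite_integral_has_derivative_ae[OF int h(2)] by blast
  have "(\<lambda>x. \<bar>h x\<bar>) integrable_on {a..b}"
    using h(1)[OF \<open>a \<le> b\<close>] by (simp add: absolutely_integrable_on_def)
  then have I: "((\<lambda>x. \<bar>h x\<bar>) has_integral integral {a..b} (\<lambda>x. \<bar>h x\<bar>)) {a..b}" by (rule integrable_integral)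
  have "\<bar>u b - u a\<bar> = \<bar>integral {a..b} h\<bar>" using h(2)[of a b] \<open>a \<le> b\<close> by (simp add: integral_unique)
  also have "\<dots> \<le> integral {a..b} (\<lambda>x. \<bar>h x\<bar>)"
    using integral_norm_bound_integral[OF int \<open>(\<lambda>x. \<bar>h x\<bar>) integrable_on {a..b}\<close>] by simp
  finally have "ennreal \<bar>u b - u a\<bar> \<le> ennreal (integral {a..b} (\<lambda>x. \<bar>h x\<bar>))" by (rule ennreal_leI)
  also have "\<dots> = (\<integral>\<^sup>+x. ennreal \<bar>h x\<bar> * indicator {a..b} x \<partial>lborel)"
    using nn_integral_has_integral_lebesgue'[OF _ I] by simp
  also have "\<dots> = (\<integral>\<^sup>+x. ennreal \<bar>h x\<bar> * indicator {a..b} x \<partial>lebesgue)"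
    by (rule nn_integral_completion[symmetric])
  also have "\<dots> \<le> (\<integral>\<^sup>+x\<in>{a..b}. F x \<partial>lebesgue)"
  proof (rule nn_integral_mono_AE)
    \<comment> \<open>The derivative is identified with \<open>h\<close> inside the open interval,
      so the endpoints join the exceptional set.\<close>
    have "AE x in lebesgue. x \<notin> N \<union> {a, b}"
      using N(1) by (intro AE_lebesgue_if_notin_negligible[of "N \<union> {a, b}"]) auto
    with F show "AE x in lebesgue. ennreal \<bar>h x\<bar> * indicator {a..b} x \<le> F x * indicator {a..b} x"
    proof eventually_elim
      case (elim x)
      then show ?case using N(2)[of x] by (cases "x \<in> {a..b}") auto
    qed
  qed
  finally show ?thesis .
qed

section \<open>Smooth maps and charts\<close>

text \<open>The form in which smoothness enters all that follows: a function differentiable near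
  \<open>x\<close> in the ambient space, whose derivative is continuous in the base point for each
  fixed direction.\<close>

lemma smooth_on_local_C1_extension:
  assumes "smooth_on S f" "x \<in> S"
  obtains V F where "open V" "x \<in> V" "\<And>y. y \<in> V \<Longrightarrow> F differentiable (at y)"
    "\<And>v. continuous_on V (\<lambda>y. frechet_derivative F (at y) v)" "\<And>y. y \<in> S \<Longrightarrow> y \<in> V \<Longrightarrow> F y = f y"
proof -
  obtain V F where VF: "open V" "x \<in> V" "\<forall>k. Ck_on k V F" "\<forall>y\<in>S \<inter> V. F y = f y"
    using assms unfolding smooth_on_def by blast
  from VF(3) have "Ck_on (Suc 0) V F" by blast
  then show thesis using VF(1,2,4) by (intro that[of V F]) auto
qed

lemma smooth_on_imp_continuous_on:
  assumes "smooth_on S f"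
  shows "continuous_on S f"
  unfolding continuous_on_eq_continuous_within
proof
  fix x assume x: "x \<in> S"
  obtain V F where VF: "open V" "x \<in> V" "\<And>y. y \<in> V \<Longrightarrow> F differentiable (at y)"
    "\<And>v. continuous_on V (\<lambda>y. frechet_derivative F (at y) v)" "\<And>y. y \<in> S \<Longrightarrow> y \<in> V \<Longrightarrow> F y = f y"
    using smooth_on_local_C1_extension[OF assms x] by blast
  have "isCont F x" using VF(2,3) by (intro differentiable_imp_continuous_within)
  then have F: "(F \<longlongrightarrow> F x) (at x within S)"
    by (metis continuous_at_imp_continuous_at_within continuous_within)
  have "\<forall>\<^sub>F y in at x within S. y \<in> V"
    using VF(1,2) eventually_at_topological by blast
  moreover have "\<forall>\<^sub>F y in at x within S. y \<in> S" by (simp add: eventually_at_filter)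
  ultimately have "\<forall>\<^sub>F y in at x within S. F y = f y" by eventually_elim (rule VF(5))
  then have "(f \<longlongrightarrow> F x) (at x within S)" using F tendsto_cong by fast
  then show "continuous (at x within S) f" using VF(5)[OF x VF(2)] by (simp add: continuous_within)
qed

lemma smooth_on_differentiable_within:
  assumes "smooth_on S f" "x \<in> S"
  shows "f differentiable (at x within S)"
proof -
  obtain V F where VF: "open V" "x \<in> V" "\<And>y. y \<in> V \<Longrightarrow> F differentiable (at y)"
    "\<And>v. continuous_on V (\<lambda>y. frechet_derivative F (at y) v)" "\<And>y. y \<in> S \<Longrightarrow> y \<in> V \<Longrightarrow> F y = f y"
    using smooth_on_local_C1_extension[OF assms] by blast
  obtain F' where "(F has_derivative F') (at x)" using VF(2,3) by (auto simp: differentiable_def)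
  then have "(F has_derivative F') (at x within S)" by (rule has_derivative_at_withinI)
  moreover obtain e where "e > 0" "ball x e \<subseteq> V" using VF(1,2) by (meson openE)
  ultimately have "(f has_derivative F') (at x within S)"
    using VF(5) assms(2) by (elim has_derivative_transform_within[OF _ \<open>e > 0\<close>]) (auto simp: dist_commute subset_iff)
  then show ?thesis by (auto simp: differentiable_def)
qed

text \<open>At boundary points the derivative of an extension depends on the extension, but its restriction
  to a relatively open part of \<open>S\<close> that is open in the ambient space does not.\<close>

lemma smooth_on_frechet_derivative_extension:
  assumes "open V" "\<And>y. y \<in> V \<Longrightarrow> F differentiable (at y)" "\<And>y. y \<in> S \<Longrightarrow> y \<in> V \<Longrightarrow> F y = f y"
    and "open U" "U \<subseteq> S" "y \<in> U" "y \<in> V"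
  shows "(f has_derivative frechet_derivative F (at y)) (at y)"
proof -
  have "(F has_derivative frechet_derivative F (at y)) (at y)"
    using assms(2)[OF \<open>y \<in> V\<close>] frechet_derivative_works by blast
  then show ?thesis
    using assms by (elim has_derivative_transform_within_open[of _ _ _ _ "U \<inter> V"]) auto
qed

text \<open>Near each point of \<open>U\<close> a local extension agrees with \<open>f\<close>, so
  the two have the same derivative there and continuity passes from the extension to
  \<open>f\<close>.\<close>

lemma smooth_on_C1_open:
  assumes f: "smooth_on S f" and U: "open U" "U \<subseteq> S"
  shows "x \<in> U \<Longrightarrow> f differentiable (at x)"
    and "continuous_on U (\<lambda>x. frechet_derivative f (at x) v)"
proof -
  have "f differentiable (at x) \<and> isCont (\<lambda>x. frechet_derivative f (at x) v) x" if x: "x \<in> U" for x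
  proof -
    obtain V F where VF: "open V" "x \<in> V" "\<And>y. y \<in> V \<Longrightarrow> F differentiable (at y)"
      "\<And>v. continuous_on V (\<lambda>y. frechet_derivative F (at y) v)" "\<And>y. y \<in> S \<Longrightarrow> y \<in> V \<Longrightarrow> F y = f y"
      using smooth_on_local_C1_extension[OF f, of x] x U(2) by blast
    have der: "(f has_derivative frechet_derivative F (at y)) (at y)" if "y \<in> U \<inter> V" for y
      using smooth_on_frechet_derivative_extension[OF VF(1,3,5) U] that by blast
    have eq: "frechet_derivative f (at y) = frechet_derivative F (at y)" if "y \<in> U \<inter> V" for y
      using frechet_derivative_at[OF der[OF that]] by simp
    have "continuous_on (U \<inter> V) (\<lambda>y. frechet_derivative F (at y) v)"
      by (rule continuous_on_subset[OF VF(4)]) auto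
    then have "continuous_on (U \<inter> V) (\<lambda>y. frechet_derivative f (at y) v)"
      by (rule continuous_on_eq) (simp add: eq)
    then have "isCont (\<lambda>x. frechet_derivative f (at x) v) x"
      using x VF(1,2) U(1) continuous_on_eq_continuous_at[OF open_Int[OF U(1) VF(1)]] by blast
    with der[of x] x VF(2) show ?thesis by (auto simp: differentiable_def)
  qed
  then show "x \<in> U \<Longrightarrow> f differentiable (at x)"
    "continuous_on U (\<lambda>x. frechet_derivative f (at x) v)"
    by (auto intro: continuous_at_imp_continuous_on)
qed

text \<open>Continuity of the derivative is known for fixed directions. Expanding in the basis makes
  it usable when the direction varies, as in norm bounds and along curves.\<close>

lemma frechet_derivative_componentwise:
  fixes f :: "'a::euclidean_space \<Rightarrow> 'b::real_normed_vector"
  assumes "f differentiable (at x)"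
  shows "frechet_derivative f (at x) v = (\<Sum>i\<in>Basis. (v \<bullet> i) *\<^sub>R frechet_derivative f (at x) i)"
proof -
  have lin: "linear (frechet_derivative f (at x))"
    using assms linear_frechet_derivative by blast
  have "frechet_derivative f (at x) (\<Sum>i\<in>Basis. (v \<bullet> i) *\<^sub>R i) =
      (\<Sum>i\<in>Basis. (v \<bullet> i) *\<^sub>R frechet_derivative f (at x) i)"
    by (simp add: linear_sum[OF lin] linear_scale[OF lin])
  then show ?thesis by (simp add: euclidean_representation)
qed

lemma frechet_derivative_norm_le:
  fixes f :: "'a::euclidean_space \<Rightarrow> 'b::real_normed_vector"
  assumes "f differentiable (at x)"
  shows "norm (frechet_derivative f (at x) v) \<le> (\<Sum>i\<in>Basis. norm (frechet_derivative f (at x) i)) * norm v"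
  unfolding frechet_derivative_componentwise[OF assms, of v] sum_distrib_right
proof (rule sum_norm_le)
  fix i :: 'a assume "i \<in> Basis"
  then have "\<bar>v \<bullet> i\<bar> \<le> norm v" by (rule Basis_le_norm)
  then show "norm ((v \<bullet> i) *\<^sub>R frechet_derivative f (at x) i) \<le> norm (frechet_derivative f (at x) i) * norm v"
    by (simp add: mult.commute mult_right_mono)
qed

text \<open>A closed ball is compact, which bounds the derivative, and convex, which turns this
  bound into a Lipschitz constant.\<close>

lemma C1_locally_lipschitz:
  fixes f :: "'a::euclidean_space \<Rightarrow> 'b::real_normed_vector"
  assumes "open U" "x \<in> U" and diff: "\<And>y. y \<in> U \<Longrightarrow> f differentiable (at y)"
    and cont: "\<And>v. continuous_on U (\<lambda>y. frechet_derivative f (at y) v)"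
  obtains r L where "r > 0" "cball x r \<subseteq> U" "L-lipschitz_on (cball x r) f"
proof -
  obtain r where r: "r > 0" "cball x r \<subseteq> U" using \<open>open U\<close> \<open>x \<in> U\<close> open_contains_cball by blast
  define m where "m y = (\<Sum>i\<in>Basis. norm (frechet_derivative f (at y) i))" for y
  have "continuous_on (cball x r) m"
    unfolding m_def by (intro continuous_intros continuous_on_subset[OF cont r(2)])
  then have "bounded (m ` cball x r)"
    by (intro compact_imp_bounded compact_continuous_image) auto
  then obtain L where "L > 0" and L: "\<And>y. y \<in> cball x r \<Longrightarrow> \<bar>m y\<bar> \<le> L"
    by (auto simp: bounded_pos)
  have "L-lipschitz_on (cball x r) f"
  proof (rule bounded_derivative_imp_lipschitz)
    fix y assume y: "y \<in> cball x r"
    then have dy: "f differentiable (at y)" using diff r(2) by blast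
    then show "(f has_derivative frechet_derivative f (at y)) (at y within cball x r)"
      by (meson frechet_derivative_works has_derivative_at_withinI)
    show "onorm (frechet_derivative f (at y)) \<le> L"
    proof (rule onorm_bound)
      fix v :: 'a
      have "m y * norm v \<le> L * norm v" using L[OF y] by (intro mult_right_mono) auto
      then show "norm (frechet_derivative f (at y) v) \<le> L * norm v"
        using frechet_derivative_norm_le[OF dy, of v] by (simp add: m_def)
    qed (use \<open>L > 0\<close> in simp)
  qed (use \<open>L > 0\<close> in auto)
  with r show thesis by (rule that)
qed

lemma continuous_vector_derivative_imp_abs_continuous:
  fixes f :: "real \<Rightarrow> 'b::real_normed_vector"
  assumes "\<And>x. x \<in> {s..t} \<Longrightarrow> (f has_vector_derivative f' x) (at x within {s..t})"
    and "continuous_on {s..t} f'"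
  shows "abs_continuous_on_interval s t f"
proof -
  have "bounded (f' ` {s..t})"
    using assms(2) by (intro compact_imp_bounded compact_continuous_image) auto
  then obtain L where L: "L > 0" "\<And>x. x \<in> {s..t} \<Longrightarrow> norm (f' x) \<le> L" by (auto simp: bounded_pos)
  have "L-lipschitz_on {s..t} f"
  proof (rule bounded_derivative_imp_lipschitz)
    fix x assume x: "x \<in> {s..t}"
    show "(f has_derivative (\<lambda>h. h *\<^sub>R f' x)) (at x within {s..t})"
      using assms(1)[OF x] by (simp add: has_vector_derivative_def)
    show "onorm (\<lambda>h. h *\<^sub>R f' x) \<le> L"
      using L(2)[OF x] L(1)
      by (intro onorm_bound) (auto simp: mult.commute[of L] mult_left_mono)
  qed (use L in auto)
  then show ?thesis by (rule lipschitz_imp_abs_continuous)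
qed

section \<open>Charts, their overlaps and the interior\<close>

locale corner_manifold =
  fixes X :: "'a topology" and A :: "('a, 'n::finite) chart set"
  assumes mfd: "manifold_with_corners X A"
begin

text \<open>The view of \<open>mint X A\<close> in the chart. Unlike \<open>cimg c\<close> it is
  open in the ambient space, so ordinary two-sided derivatives apply on it.\<close>

definition chart_interior :: "('a, 'n) chart \<Rightarrow> (real^'n) set" where
  "chart_interior c = {x \<in> cimg c. \<forall>j\<in>cidx c. 0 < x $ j}"

lemma corner_chart: "c \<in> A \<Longrightarrow> corner_chart X c"
  and topspace_charts: "topspace X = (\<Union>c\<in>A. cdom c)"
  and smooth_transition: "c \<in> A \<Longrightarrow> d \<in> A \<Longrightarrow> smooth_on (cmap c ` (cdom c \<inter> cdom d)) (cmap d \<circ> cinv c)"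
  using mfd unfolding manifold_with_corners_def by auto

lemma openin_cdom: "c \<in> A \<Longrightarrow> openin X (cdom c)"
  and openin_cimg: "c \<in> A \<Longrightarrow> openin (top_of_set (corner_model (cidx c))) (cimg c)"
  and homeomorphic_cmap: "c \<in> A \<Longrightarrow> homeomorphic_map (subtopology X (cdom c)) (top_of_set (cimg c)) (cmap c)"
  using corner_chart unfolding corner_chart_def by auto

lemma topspace_cdom: "c \<in> A \<Longrightarrow> topspace (subtopology X (cdom c)) = cdom c"
  using openin_subset[OF openin_cdom] by auto

lemma inj_cmap: "c \<in> A \<Longrightarrow> inj_on (cmap c) (cdom c)"
  using homeomorphic_imp_injective_map[OF homeomorphic_cmap] topspace_cdom by metis

lemma cinv_cmap [simp]: "c \<in> A \<Longrightarrow> q \<in> cdom c \<Longrightarrow> cinv c (cmap c q) = q"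
  using inj_cmap by (rule inv_into_f_f)

lemma cmap_cinv [simp]: "x \<in> cimg c \<Longrightarrow> cmap c (cinv c x) = x"
  by (rule f_inv_into_f)

lemma cinv_in_cdom [simp]: "x \<in> cimg c \<Longrightarrow> cinv c x \<in> cdom c"
  by (rule inv_into_into)

lemma continuous_map_cmap: "c \<in> A \<Longrightarrow> continuous_map (subtopology X (cdom c)) euclidean (cmap c)"
  using homeomorphic_imp_continuous_map[OF homeomorphic_cmap] continuous_map_into_fulltopology by blast

lemma continuous_map_cinv:
  assumes "c \<in> A"
  shows "continuous_map (top_of_set (cimg c)) X (cinv c)"
proof -
  obtain g where g: "homeomorphic_maps (subtopology X (cdom c)) (top_of_set (cimg c)) (cmap c) g"
    using homeomorphic_cmap[OF assms] homeomorphic_map_maps by blast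
  have "continuous_map (top_of_set (cimg c)) (subtopology X (cdom c)) (cinv c)"
  proof (rule continuous_map_eq)
    show "continuous_map (top_of_set (cimg c)) (subtopology X (cdom c)) g"
      using g by (simp add: homeomorphic_maps_def)
    fix x assume "x \<in> topspace (top_of_set (cimg c))"
    then obtain q where "q \<in> cdom c" "x = cmap c q" by auto
    then show "g x = cinv c x" using g assms topspace_cdom[OF assms] by (simp add: homeomorphic_maps_def)
  qed
  then show ?thesis by (rule continuous_map_into_fulltopology)
qed

lemma cimg_subset_corner_model: "c \<in> A \<Longrightarrow> cimg c \<subseteq> corner_model (cidx c)"
  using openin_subset[OF openin_cimg] by auto

lemma open_chart_interior:
  assumes "c \<in> A"
  shows "open (chart_interior c)"
proof -
  obtain T where T: "open T" "cimg c = corner_model (cidx c) \<inter> T"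
    using openin_cimg[OF assms] by (auto simp: openin_open)
  have "chart_interior c = (\<Inter>j\<in>cidx c. {x. 0 < x $ j}) \<inter> T"
    unfolding chart_interior_def T(2) by (auto simp: corner_model_def less_imp_le)
  moreover have "open {x::real^'n. 0 < x $ j}" for j
    by (intro open_Collect_less continuous_intros)
  ultimately show ?thesis using T(1) by (simp add: open_INT open_Int)
qed

lemma chart_interior_subset: "chart_interior c \<subseteq> cimg c"
  by (auto simp: chart_interior_def)

lemma open_overlap:
  assumes "c \<in> A" "openin X W"
  shows "open (cmap c ` (cdom c \<inter> W) \<inter> chart_interior c)"
proof -
  have "openin (top_of_set (cimg c)) {x \<in> topspace (top_of_set (cimg c)). cinv c x \<in> W}"
    using continuous_map_cinv[OF assms(1)] assms(2) by (rule openin_continuous_map_preimage)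
  moreover have "{x \<in> topspace (top_of_set (cimg c)). cinv c x \<in> W} = cmap c ` (cdom c \<inter> W)"
    using assms(1) by force
  ultimately obtain T where "open T" "cmap c ` (cdom c \<inter> W) = cimg c \<inter> T"
    by (auto simp: openin_open)
  then have "cmap c ` (cdom c \<inter> W) \<inter> chart_interior c = T \<inter> chart_interior c"
    using chart_interior_subset by blast
  then show ?thesis using \<open>open T\<close> open_chart_interior[OF assms(1)] by auto
qed

lemma mint_imp_chart_interior:
  assumes "q \<in> mint X A" "c \<in> A" "q \<in> cdom c"
  shows "cmap c q \<in> chart_interior c"
proof -
  have "zero_coords c q = {}" using assms by (auto simp: mint_def mbd_def)
  moreover have "cmap c q \<in> corner_model (cidx c)" using assms cimg_subset_corner_model by blast
  ultimately show ?thesis using assms(3)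
    by (force simp: chart_interior_def zero_coords_def corner_model_def)
qed

text \<open>One chart on whose boundary a point lies suffices to put it in \<open>mbd A\<close>, so
  every other chart \<open>d\<close> must be excluded. The transition to \<open>d\<close> is
  continuous and injective on an open set, hence has open image by invariance of domain; an open set
  inside the model corner contains no point with a vanishing corner coordinate.\<close>

lemma chart_interior_imp_mint:
  assumes c: "c \<in> A" and x: "x \<in> chart_interior c"
  shows "cinv c x \<in> mint X A"
proof -
  let ?q = "cinv c x"
  have xc: "x \<in> cimg c" using x chart_interior_subset by blast
  have "?q \<notin> mbd A"
  proof
    assume "?q \<in> mbd A"
    then obtain d j where d: "d \<in> A" "?q \<in> cdom d" "j \<in> cidx d" "cmap d ?q $ j = 0"
      by (auto simp: mbd_def zero_coords_def)
    define U where "U = cmap c ` (cdom c \<inter> cdom d) \<inter> chart_interior c"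
    have "open U" unfolding U_def using c openin_cdom[OF d(1)] by (rule open_overlap)
    have "x = cmap c ?q" using xc by simp
    then have "x \<in> U" using d(2) x cinv_in_cdom[OF xc] unfolding U_def by blast
    let ?f = "cmap d \<circ> cinv c"
    have "continuous_on U ?f"
      by (rule continuous_on_subset[OF smooth_on_imp_continuous_on[OF smooth_transition[OF c d(1)]]]) (auto simp: U_def)
    moreover have "inj_on ?f U"
    proof (rule comp_inj_on)
      show "inj_on (cinv c) U"
        using chart_interior_subset by (intro inj_on_inv_into) (auto simp: U_def)
      show "inj_on (cmap d) (cinv c ` U)"
        using c by (intro inj_on_subset[OF inj_cmap[OF d(1)]]) (auto simp: U_def)
    qed
    ultimately have "open (?f ` U)" using \<open>open U\<close> by (intro invariance_of_domain)
    then obtain e where "e > 0" "ball (?f x) e \<subseteq> ?f ` U" using \<open>x \<in> U\<close> by (meson imageI openE)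
    \<comment> \<open>A step of length \<open>e/2\<close> out of the corner makes coordinate
      \<open>j\<close> negative.\<close>
    moreover have "?f x - (e/2) *\<^sub>R axis j 1 \<in> ball (?f x) e"
      using \<open>e > 0\<close> by (simp add: dist_norm)
    ultimately have "?f x - (e/2) *\<^sub>R axis j 1 \<in> ?f ` U" by blast
    also have "\<dots> \<subseteq> cimg d" using c by (auto simp: U_def)
    also have "\<dots> \<subseteq> corner_model (cidx d)" using d(1) by (rule cimg_subset_corner_model)
    finally have "0 \<le> (?f x - (e/2) *\<^sub>R axis j 1) $ j" using d(3) unfolding corner_model_def by blast
    then show False using d(4) \<open>e > 0\<close> by (simp add: axis_def)
  qed
  moreover have "?q \<in> topspace X" using xc c openin_subset[OF openin_cdom[OF c]] by (metis cinv_in_cdom subsetD)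
  ultimately show ?thesis by (simp add: mint_def)
qed

lemma mint_in_some_chart: "q \<in> mint X A \<Longrightarrow> \<exists>c\<in>A. q \<in> cdom c"
  using topspace_charts by (auto simp: mint_def)

lemma chart_at:
  assumes "q \<in> mint X A"
  shows "chart_at A q \<in> A" "q \<in> cdom (chart_at A q)"
proof -
  have "\<exists>c. c \<in> A \<and> q \<in> cdom c" using mint_in_some_chart[OF assms] by blast
  then have "chart_at A q \<in> A \<and> q \<in> cdom (chart_at A q)" unfolding chart_at_def by (rule someI_ex)
  then show "chart_at A q \<in> A" "q \<in> cdom (chart_at A q)" by auto
qed

lemma transition_C1:
  assumes "c \<in> A" "d \<in> A"
  defines "U \<equiv> cmap c ` (cdom c \<inter> cdom d) \<inter> chart_interior c"
  shows "open U" "x \<in> U \<Longrightarrow> (cmap d \<circ> cinv c) differentiable (at x)"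
    "continuous_on U (\<lambda>x. frechet_derivative (cmap d \<circ> cinv c) (at x) v)"
proof -
  show U: "open U" unfolding U_def using assms(1) openin_cdom[OF assms(2)] by (rule open_overlap)
  have sub: "U \<subseteq> cmap c ` (cdom c \<inter> cdom d)" by (simp add: U_def)
  note C1 = smooth_on_C1_open[OF smooth_transition[OF assms(1,2)] U sub]
  show "x \<in> U \<Longrightarrow> (cmap d \<circ> cinv c) differentiable (at x)" by (rule C1(1))
  show "continuous_on U (\<lambda>x. frechet_derivative (cmap d \<circ> cinv c) (at x) v)" by (rule C1(2))
qed

lemma coord_deriv_interior:
  assumes "c \<in> A" "q \<in> mint X A" "q \<in> cdom c"
  shows "coord_deriv c f q = frechet_derivative (f \<circ> cinv c) (at (cmap c q))"
proof -
  have "chart_interior c \<subseteq> interior (cimg c)"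
    using chart_interior_subset open_chart_interior[OF assms(1)] by (rule interior_maximal)
  then have "cmap c q \<in> interior (cimg c)"
    using mint_imp_chart_interior[OF assms(2,1,3)] by blast
  then show ?thesis unfolding coord_deriv_def by (simp only: at_within_interior)
qed

end

section \<open>Curves in charts and boundary defining functions\<close>

lemma nonneg_imp_right_derivative_nonneg:
  fixes f :: "real \<Rightarrow> real"
  assumes "(f has_real_derivative D) (at 0 within {0..e})" "e > 0" "f 0 = 0"
    and "\<And>s. 0 < s \<Longrightarrow> s \<le> e \<Longrightarrow> 0 \<le> f s"
  shows "0 \<le> D"
proof (rule tendsto_lowerbound)
  show "((\<lambda>s. (f s - f 0) / (s - 0)) \<longlongrightarrow> D) (at 0 within {0..e})"
    using assms(1) by (simp add: has_field_derivative_iff)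
  show "\<forall>\<^sub>F s in at 0 within {0..e}. 0 \<le> (f s - f 0) / (s - 0)"
    using assms(3,4) by (auto simp: eventually_at_filter)
  show "at 0 within {0..e} \<noteq> bot" using assms(2) by (simp add: trivial_limit_within)
qed

lemma pos_right_derivative_imp_growth:
  fixes f :: "real \<Rightarrow> real"
  assumes "(f has_real_derivative D) (at 0 within {0..e})" "e > 0" "f 0 = 0" "D > 0"
  obtains d where "d > 0" "\<And>s. 0 < s \<Longrightarrow> s \<le> d \<Longrightarrow> D / 2 * s \<le> f s"
proof -
  have "((\<lambda>s. (f s - f 0) / (s - 0)) \<longlongrightarrow> D) (at 0 within {0..e})"
    using assms(1) by (simp add: has_field_derivative_iff)
  then have "\<forall>\<^sub>F s in at 0 within {0..e}. D / 2 < (f s - f 0) / (s - 0)"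
    using \<open>D > 0\<close> by (intro order_tendstoD(1)) auto
  then obtain d where d: "d > 0" "\<And>s. s \<in> {0..e} \<Longrightarrow> s \<noteq> 0 \<Longrightarrow> dist s 0 < d \<Longrightarrow> D / 2 < (f s - f 0) / (s - 0)"
    by (auto simp: eventually_at)
  show thesis
  proof (rule that)
    show "min (d/2) e > 0" using d(1) assms(2) by simp
    fix s assume s: "0 < s" "s \<le> min (d/2) e"
    then have "D / 2 < f s / s" using d(2)[of s] d(1) assms(3) by auto
    then show "D / 2 * s \<le> f s" using s by (simp add: field_simps)
  qed
qed

section \<open>Speed of curves and rays into the corner\<close>

context corner_manifold
begin

lemma sum_metric_quadratic:
  "v \<bullet> (sum_metric N \<rho> \<alpha> g0 c q *v v) = (\<Sum>i\<in>{1..N}. \<rho> i q powr (- \<alpha> i)) * (v \<bullet> (g0 c q *v v))"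
  by (simp add: sum_metric_def scaleR_matrix_vector_assoc[symmetric])

lemma riemannian_metric_change:
  assumes "riemannian_metric A g0" "c \<in> A" "d \<in> A" "q \<in> mint X A" "q \<in> cdom c" "q \<in> cdom d"
  shows "v \<bullet> (g0 c q *v v) = frechet_derivative (cmap d \<circ> cinv c) (at (cmap c q)) v \<bullet>
           (g0 d q *v frechet_derivative (cmap d \<circ> cinv c) (at (cmap c q)) v)"
proof -
  have "v \<bullet> (g0 c q *v v) = coord_deriv c (cmap d) q v \<bullet> (g0 d q *v coord_deriv c (cmap d) q v)"
    using assms unfolding riemannian_metric_def by blast
  then show ?thesis using coord_deriv_interior assms by metis
qed

lemma curve_stays_near:
  assumes "continuous_map (top_of_set T) X \<gamma>" "t \<in> T" "openin X W" "\<gamma> t \<in> W"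
  obtains \<delta> where "\<delta> > 0" "\<And>s. s \<in> T \<Longrightarrow> dist s t < \<delta> \<Longrightarrow> \<gamma> s \<in> W"
proof -
  have "openin (top_of_set T) {x \<in> topspace (top_of_set T). \<gamma> x \<in> W}"
    using assms(1,3) by (rule openin_continuous_map_preimage)
  then obtain U where U: "open U" "{x \<in> T. \<gamma> x \<in> W} = T \<inter> U" by (auto simp: openin_open)
  moreover have "t \<in> U" using assms(2,4) U(2) by blast
  ultimately obtain \<delta> where "\<delta> > 0" "ball t \<delta> \<subseteq> U" by (meson openE)
  then show thesis using U(2) by (intro that[of \<delta>]) (auto simp: dist_commute subset_iff)
qed

lemma interior_overlap_mem:
  assumes "c \<in> A" "q \<in> mint X A" "q \<in> cdom c" "q \<in> W"
  shows "cmap c q \<in> cmap c ` (cdom c \<inter> W) \<inter> chart_interior c"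
  using assms mint_imp_chart_interior by blast

lemma has_vector_derivative_change_chart:
  assumes \<gamma>: "continuous_map (top_of_set T) X \<gamma>" "t \<in> T" "\<gamma> t \<in> mint X A"
    and c: "c \<in> A" "\<gamma> t \<in> cdom c" and d: "d \<in> A" "\<gamma> t \<in> cdom d"
    and v: "((cmap c \<circ> \<gamma>) has_vector_derivative v) (at t within T)"
  shows "((cmap d \<circ> \<gamma>) has_vector_derivative frechet_derivative (cmap d \<circ> cinv c) (at (cmap c (\<gamma> t))) v)
           (at t within T)"
proof -
  let ?\<Phi> = "cmap d \<circ> cinv c"
  have "openin X (cdom c \<inter> cdom d)" using openin_cdom c(1) d(1) by blast
  then obtain \<delta> where \<delta>: "\<delta> > 0" "\<And>s. s \<in> T \<Longrightarrow> dist s t < \<delta> \<Longrightarrow> \<gamma> s \<in> cdom c \<inter> cdom d"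
    using curve_stays_near[OF \<gamma>(1,2)] c(2) d(2) by blast
  have "?\<Phi> differentiable (at (cmap c (\<gamma> t)))"
    using transition_C1(2)[OF c(1) d(1)] interior_overlap_mem[OF c(1) \<gamma>(3) c(2) d(2)] by blast
  then have "(?\<Phi> has_derivative frechet_derivative ?\<Phi> (at (cmap c (\<gamma> t)))) (at ((cmap c \<circ> \<gamma>) t) within (cmap c \<circ> \<gamma>) ` T)"
    by (simp add: frechet_derivative_works[symmetric] has_derivative_at_withinI)
  then have "((?\<Phi> \<circ> (cmap c \<circ> \<gamma>)) has_vector_derivative frechet_derivative ?\<Phi> (at (cmap c (\<gamma> t))) v) (at t within T)"
    by (rule vector_derivative_diff_chain_within[OF v])
  then show ?thesis
    by (rule has_vector_derivative_transform_within[OF _ \<delta>(1) \<gamma>(2)]) (use \<delta>(2) c(1) in auto)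
qed

text \<open>The chart selected by \<open>chart_at\<close> may be replaced by any chart around the
  point: the velocity changes by the Jacobian of the transition, which the transformation law of
  \<open>g0\<close> absorbs, and the conformal factor does not involve charts.\<close>

lemma speed_sum_metric:
  assumes g0: "riemannian_metric A g0"
    and \<gamma>: "continuous_map (top_of_set T) X \<gamma>" "t \<in> T" "\<gamma> t \<in> mint X A" "at t within T \<noteq> bot"
    and c: "c \<in> A" "\<gamma> t \<in> cdom c"
    and v: "((cmap c \<circ> \<gamma>) has_vector_derivative v) (at t within T)"
  shows "speed A (sum_metric N \<rho> \<alpha> g0) T \<gamma> t =
    sqrt ((\<Sum>i\<in>{1..N}. \<rho> i (\<gamma> t) powr (- \<alpha> i)) * (v \<bullet> (g0 c (\<gamma> t) *v v)))"
proof -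
  define d where "d = chart_at A (\<gamma> t)"
  have d: "d \<in> A" "\<gamma> t \<in> cdom d" using chart_at[OF \<gamma>(3)] by (auto simp: d_def)
  let ?Jv = "frechet_derivative (cmap d \<circ> cinv c) (at (cmap c (\<gamma> t))) v"
  have "vector_derivative (cmap d \<circ> \<gamma>) (at t within T) = ?Jv"
    using vector_derivative_within[OF \<gamma>(4)] has_vector_derivative_change_chart[OF \<gamma>(1-3) c d v] by blast
  then show ?thesis
    unfolding speed_def Let_def d_def[symmetric] sum_metric_quadratic
    using riemannian_metric_change[OF g0 c(1) d(1) \<gamma>(3) c(2) d(2), of v] by simp
qed

text \<open>Absolute continuity is demanded in every chart of the atlas, not just in
  \<open>c\<close>. In another chart the curve is a C1 curve followed by a transition map, hence C1
  on compact intervals.\<close>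

lemma ac_curve_in_chart:
  assumes c: "c \<in> A" and \<eta>: "\<And>t. (\<eta> has_vector_derivative \<eta>' t) (at t)" "continuous_on UNIV \<eta>'"
    and T: "\<And>t. t \<in> T \<Longrightarrow> \<eta> t \<in> chart_interior c"
  shows "ac_curve X A T (cinv c \<circ> \<eta>)"
proof -
  have cimg: "\<eta> t \<in> cimg c" if "t \<in> T" for t using T[OF that] chart_interior_subset by blast
  have cont_\<eta>: "continuous_on S \<eta>" for S
    using \<eta>(1) by (meson continuous_at_imp_continuous_on has_vector_derivative_continuous)
  then have "continuous_map (top_of_set T) (top_of_set (cimg c)) \<eta>"
    using cimg by (auto simp: continuous_map_in_subtopology)
  then have 1: "continuous_map (top_of_set T) X (cinv c \<circ> \<eta>)"
    using continuous_map_cinv[OF c] by (rule continuous_map_compose)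
  have 2: "(cinv c \<circ> \<eta>) ` T \<subseteq> mint X A" using chart_interior_imp_mint[OF c] T by auto
  have 3: "abs_continuous_on_interval s t (cmap d \<circ> (cinv c \<circ> \<eta>))"
    if d: "d \<in> A" "{s..t} \<subseteq> T" "(cinv c \<circ> \<eta>) ` {s..t} \<subseteq> cdom d" for d s t
  proof (rule continuous_vector_derivative_imp_abs_continuous)
    let ?\<Phi> = "cmap d \<circ> cinv c"
    let ?U = "cmap c ` (cdom c \<inter> cdom d) \<inter> chart_interior c"
    have U: "\<eta> x \<in> ?U" if x: "x \<in> {s..t}" for x
    proof -
      have "cinv c (\<eta> x) \<in> cdom c \<inter> cdom d" "\<eta> x = cmap c (cinv c (\<eta> x))"
        using d(2,3) cimg x by (auto simp: image_subset_iff subset_iff)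
      then show ?thesis using T d(2) x by (metis IntI image_eqI subsetD)
    qed
    note C1 = transition_C1[OF c d(1)]
    show "((cmap d \<circ> (cinv c \<circ> \<eta>)) has_vector_derivative frechet_derivative ?\<Phi> (at (\<eta> x)) (\<eta>' x)) (at x within {s..t})"
      if "x \<in> {s..t}" for x
    proof -
      have "(?\<Phi> has_derivative frechet_derivative ?\<Phi> (at (\<eta> x))) (at (\<eta> x) within \<eta> ` {s..t})"
        using C1(2)[OF U[OF that]] by (simp add: frechet_derivative_works[symmetric] has_derivative_at_withinI)
      from vector_derivative_diff_chain_within[OF has_vector_derivative_at_within[OF \<eta>(1)] this]
      show ?thesis by (simp only: o_assoc)
    qed
    \<comment> \<open>The velocity varies with \<open>x\<close>, while the derivative of the
      transition is continuous for fixed directions; hence the expansion in the basis.\<close>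
    have "continuous_on {s..t} (\<lambda>x. \<Sum>i\<in>Basis. (\<eta>' x \<bullet> i) *\<^sub>R frechet_derivative ?\<Phi> (at (\<eta> x)) i)"
    proof (intro continuous_on_sum continuous_on_scaleR continuous_on_inner continuous_on_const)
      show "continuous_on {s..t} \<eta>'" using \<eta>(2) by (rule continuous_on_subset) simp
      show "continuous_on {s..t} (\<lambda>x. frechet_derivative ?\<Phi> (at (\<eta> x)) i)" for i
        using continuous_on_compose2[OF C1(3) cont_\<eta>] U by blast
    qed
    then show "continuous_on {s..t} (\<lambda>x. frechet_derivative ?\<Phi> (at (\<eta> x)) (\<eta>' x))"
      by (rule continuous_on_eq) (simp add: frechet_derivative_componentwise[OF C1(2)[OF U], symmetric])
  qed
  show ?thesis unfolding ac_curve_def using 1 2 3 by blast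
qed

text \<open>Entries 1 put this vector in the interior of the cone of directions into the corner:
  adding any vector with entries of absolute value at most 1 leaves it in the cone.\<close>

definition inward :: "('a, 'n) chart \<Rightarrow> real^'n" where
  "inward c = (\<chi> j. if j \<in> cidx c then 1 else 0)"

lemma ray_in_cimg:
  assumes c: "c \<in> A" and p: "p \<in> cdom c" and u: "\<And>j. j \<in> cidx c \<Longrightarrow> 0 \<le> u $ j"
  obtains e where "e > 0" "\<And>s. 0 \<le> s \<Longrightarrow> s \<le> e \<Longrightarrow> cmap c p + s *\<^sub>R u \<in> cimg c"
proof -
  obtain T where T: "open T" "cimg c = corner_model (cidx c) \<inter> T"
    using openin_cimg[OF c] by (auto simp: openin_open)
  have x0: "cmap c p \<in> corner_model (cidx c)" "cmap c p \<in> T" using p T by auto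
  obtain r where r: "r > 0" "ball (cmap c p) r \<subseteq> T" using T(1) x0(2) by (meson openE)
  show thesis
  proof (rule that)
    show "r / (norm u + 1) > 0" using r by (simp add: add_nonneg_pos)
    fix s assume s: "0 \<le> s" "s \<le> r / (norm u + 1)"
    have "norm (s *\<^sub>R u) < r"
    proof (cases "s = 0")
      case False
      then have "s * norm u < s * (norm u + 1)" using s by simp
      also have "\<dots> \<le> r" using s by (simp add: pos_le_divide_eq add_nonneg_pos)
      finally show ?thesis using s by simp
    qed (use r in simp)
    then have "cmap c p + s *\<^sub>R u \<in> T" using r(2) by (auto simp: dist_norm subset_iff)
    moreover have "cmap c p + s *\<^sub>R u \<in> corner_model (cidx c)"
      using x0(1) s(1) u by (auto simp: corner_model_def)
    ultimately show "cmap c p + s *\<^sub>R u \<in> cimg c" using T(2) by blast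
  qed
qed

lemma ray_in_chart_interior:
  assumes c: "c \<in> A" and p: "p \<in> cdom c"
  obtains e where "e > 0" "\<And>s. 0 \<le> s \<Longrightarrow> s \<le> e \<Longrightarrow> cmap c p + s *\<^sub>R inward c \<in> cimg c"
    "\<And>s. 0 < s \<Longrightarrow> s \<le> e \<Longrightarrow> cmap c p + s *\<^sub>R inward c \<in> chart_interior c"
proof -
  obtain e where e: "e > 0" "\<And>s. 0 \<le> s \<Longrightarrow> s \<le> e \<Longrightarrow> cmap c p + s *\<^sub>R inward c \<in> cimg c"
    using ray_in_cimg[OF c p, of "inward c"] by (auto simp: inward_def)
  have "cmap c p \<in> corner_model (cidx c)" using p cimg_subset_corner_model[OF c] by blast
  then have "cmap c p + s *\<^sub>R inward c \<in> chart_interior c" if "0 < s" "s \<le> e" for s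
    using e(2)[of s] that by (auto simp: chart_interior_def corner_model_def inward_def intro: add_nonneg_pos)
  with e show thesis by (rule that)
qed

lemma ray_limit:
  assumes c: "c \<in> A" and p: "p \<in> cdom c" and f: "(f \<longlongrightarrow> 0) F"
    and ev: "\<forall>\<^sub>F t in F. cmap c p + f t *\<^sub>R inward c \<in> cimg c"
  shows "limitin X (\<lambda>t. cinv c (cmap c p + f t *\<^sub>R inward c)) p F"
proof -
  have "((\<lambda>t. cmap c p + f t *\<^sub>R inward c) \<longlongrightarrow> cmap c p + 0 *\<^sub>R inward c) F"
    by (intro tendsto_intros f)
  then have "limitin (top_of_set (cimg c)) (\<lambda>t. cmap c p + f t *\<^sub>R inward c) (cmap c p) F"
    using ev p by (simp add: limitin_subtopology)
  from continuous_map_limit[OF continuous_map_cinv[OF c] this] show ?thesis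
    using c p by (simp add: o_def)
qed

text \<open>The differential of a boundary defining function is nonnegative on vectors pointing into the
  corner. As it does not vanish identically, it is positive on the interior vector \<open>inward c\<close> of this cone.\<close>

lemma boundary_defining_growth:
  assumes bd: "boundary_defining X A H \<rho>" and c: "c \<in> A" and p: "p \<in> cdom c" "p \<in> H"
  obtains m e where "m > 0" "e > 0"
    "\<And>s. 0 < s \<Longrightarrow> s \<le> e \<Longrightarrow> m * s \<le> \<rho> (cinv c (cmap c p + s *\<^sub>R inward c))"
proof -
  define D where "D = coord_deriv c \<rho> p"
  have H: "H = {p \<in> topspace X. \<rho> p = 0}" and pos: "\<forall>p \<in> topspace X - H. \<rho> p > 0"
    using bd by (auto simp: boundary_defining_def)
  have nonneg: "0 \<le> \<rho> q" if "q \<in> cdom c" for q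
  proof -
    have "q \<in> topspace X" using that openin_subset[OF openin_cdom[OF c]] by blast
    then show ?thesis using H pos by (cases "q \<in> H") (auto intro: less_imp_le)
  qed
  have "smooth_on (cimg c) (\<rho> \<circ> cinv c)"
    using bd c by (simp add: boundary_defining_def smooth_map_on_mfd_def)
  then have "(\<rho> \<circ> cinv c) differentiable (at (cmap c p) within cimg c)"
    by (rule smooth_on_differentiable_within) (use p in simp)
  then have D: "((\<rho> \<circ> cinv c) has_derivative D) (at (cmap c p) within cimg c)"
    unfolding D_def coord_deriv_def by (simp only: frechet_derivative_works[symmetric])
  then have lin: "linear D" by (rule has_derivative_linear)
  have "D \<noteq> (\<lambda>v. 0)" using bd c p by (simp add: boundary_defining_def D_def)
  define f where "f u s = \<rho> (cinv c (cmap c p + s *\<^sub>R u))" for u s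
  have f0: "f u 0 = 0" for u using p c H by (simp add: f_def)
  have der: "\<exists>e>0. (f u has_real_derivative D u) (at 0 within {0..e}) \<and> (\<forall>s. 0 < s \<longrightarrow> s \<le> e \<longrightarrow> 0 \<le> f u s)"
    if u: "\<And>j. j \<in> cidx c \<Longrightarrow> 0 \<le> u $ j" for u
  proof -
    obtain e where e: "e > 0" "\<And>s. 0 \<le> s \<Longrightarrow> s \<le> e \<Longrightarrow> cmap c p + s *\<^sub>R u \<in> cimg c"
      using ray_in_cimg[OF c p(1) u] by blast
    let ?l = "\<lambda>s. cmap c p + s *\<^sub>R u"
    have "(?l has_vector_derivative u) (at 0 within {0..e})"
      by (auto intro!: derivative_eq_intros)
    moreover have "((\<rho> \<circ> cinv c) has_derivative D) (at (?l 0) within ?l ` {0..e})"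
    proof -
      have "?l ` {0..e} \<subseteq> cimg c" using e(2) by auto
      from has_derivative_subset[OF D this] show ?thesis by simp
    qed
    ultimately have "(((\<rho> \<circ> cinv c) \<circ> ?l) has_vector_derivative D u) (at 0 within {0..e})"
      by (rule vector_derivative_diff_chain_within)
    then have "(f u has_real_derivative D u) (at 0 within {0..e})"
      by (simp add: has_real_derivative_iff_has_vector_derivative f_def[abs_def] o_def)
    moreover have "0 \<le> f u s" if "0 < s" "s \<le> e" for s
      unfolding f_def using e(2)[of s] that by (intro nonneg cinv_in_cdom) auto
    ultimately show ?thesis using e(1) by blast
  qed
  have Dnonneg: "0 \<le> D u" if "\<And>j. j \<in> cidx c \<Longrightarrow> 0 \<le> u $ j" for u
    using der[OF that] nonneg_imp_right_derivative_nonneg f0 by blast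
  have inw: "j \<in> cidx c \<Longrightarrow> inward c $ j = 1" for j by (simp add: inward_def)
  \<comment> \<open>A linear form that is nonnegative on a cone and vanishes at an interior point of
    it is 0: from \<open>inward c\<close> one can move along \<open>v\<close> a little in both
    directions without leaving the cone.\<close>
  have "D (inward c) \<noteq> 0"
  proof
    assume D0: "D (inward c) = 0"
    have "D v = 0" for v
    proof -
      define r where "r = 1 / (norm v + 1)"
      have r: "r > 0" "r * norm v \<le> 1" by (simp_all add: r_def add_nonneg_pos pos_divide_le_eq)
      have "\<bar>r * v $ j\<bar> \<le> 1" for j
        using component_le_norm_cart[of v j] r by (simp add: abs_mult) (meson mult_left_mono less_imp_le order_trans)
      then have "0 \<le> D (inward c + r *\<^sub>R v)" "0 \<le> D (inward c - r *\<^sub>R v)"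
        by (intro Dnonneg; simp add: inw abs_le_iff; smt (verit))+
      then have "r * D v = 0" using D0 by (simp add: linear_add[OF lin] linear_diff[OF lin] linear_scale[OF lin])
      then show ?thesis using r by simp
    qed
    then show False using \<open>D \<noteq> (\<lambda>v. 0)\<close> by blast
  qed
  then have Dpos: "0 < D (inward c)" using Dnonneg[of "inward c"] inw by fastforce
  obtain e where e: "e > 0" "(f (inward c) has_real_derivative D (inward c)) (at 0 within {0..e})"
    using der[of "inward c"] inw by auto
  obtain d where "d > 0" "\<And>s. 0 < s \<Longrightarrow> s \<le> d \<Longrightarrow> D (inward c) / 2 * s \<le> f (inward c) s"
    using pos_right_derivative_imp_growth[OF e(2,1) f0 Dpos] by blast
  then show thesis using that[of "D (inward c) / 2" d] Dpos by (simp add: f_def)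
qed

end

section \<open>Small exponents: curves of finite length\<close>

text \<open>Linearity in the matrix carries limits of Gram matrices over to the quadratic
  form.\<close>

lemma linear_quadratic_form: "linear (\<lambda>M :: real^'n^'n. v \<bullet> (M *v w))"
  by (rule linearI) (simp_all add: matrix_vector_mult_add_rdistrib inner_add_right scaleR_matrix_vector_assoc[symmetric])

section \<open>Lengths of curves on a ray\<close>

context corner_manifold
begin

definition ray :: "('a, 'n) chart \<Rightarrow> 'a \<Rightarrow> real \<Rightarrow> 'a" where
  "ray c p s = cinv c (cmap c p + s *\<^sub>R inward c)"

lemma eventually_ray_in_chart:
  assumes "c \<in> A" "p \<in> cdom c"
  shows "\<forall>\<^sub>F s in at_right 0. cmap c p + s *\<^sub>R inward c \<in> cimg c"
    and "\<forall>\<^sub>F s in at_right 0. cmap c p + s *\<^sub>R inward c \<in> chart_interior c"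
proof -
  obtain e where "e > 0" "\<And>s. 0 \<le> s \<Longrightarrow> s \<le> e \<Longrightarrow> cmap c p + s *\<^sub>R inward c \<in> cimg c"
    "\<And>s. 0 < s \<Longrightarrow> s \<le> e \<Longrightarrow> cmap c p + s *\<^sub>R inward c \<in> chart_interior c"
    using ray_in_chart_interior[OF assms] by blast
  then show "\<forall>\<^sub>F s in at_right 0. cmap c p + s *\<^sub>R inward c \<in> cimg c"
    "\<forall>\<^sub>F s in at_right 0. cmap c p + s *\<^sub>R inward c \<in> chart_interior c"
    unfolding eventually_at_right_field by (meson less_imp_le)+
qed

lemma tendsto_along_ray:
  assumes "c \<in> A" "p \<in> cdom c" "continuous_on (cimg c) (f \<circ> cinv c)"
  shows "((\<lambda>s. f (ray c p s)) \<longlongrightarrow> f p) (at_right 0)"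
proof -
  have "((\<lambda>s. cmap c p + s *\<^sub>R inward c) \<longlongrightarrow> cmap c p + 0 *\<^sub>R inward c) (at_right 0)"
    by (intro tendsto_intros)
  then have "((\<lambda>s. (f \<circ> cinv c) (cmap c p + s *\<^sub>R inward c)) \<longlongrightarrow> (f \<circ> cinv c) (cmap c p)) (at_right 0)"
    using assms eventually_ray_in_chart(1)[OF assms(1,2)]
    by (intro continuous_on_tendsto_compose[OF assms(3)]) auto
  then show ?thesis using assms by (simp add: ray_def)
qed

text \<open>If \<open>p\<close> lies on \<open>H\<close>, then \<open>\<rho>\<close> grows at least
  linearly and \<open>s < 1\<close> lets the exponent be raised to \<open>M\<close>. Otherwise
  \<open>\<rho>\<close> stays above half of \<open>\<rho> p\<close>, and \<open>s powr (- M)\<close>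
  is at least 1.\<close>

lemma powr_bdf_along_ray:
  assumes bd: "boundary_defining X A H \<rho>" and c: "c \<in> A" and p: "p \<in> cdom c"
    and \<alpha>: "0 \<le> \<alpha>" "0 \<le> M" "p \<in> H \<Longrightarrow> \<alpha> \<le> M"
  obtains K where "\<forall>\<^sub>F s in at_right 0. \<rho> (ray c p s) powr (- \<alpha>) \<le> K * s powr (- M)"
proof (cases "p \<in> H")
  case True
  obtain m e where m: "m > 0" "e > 0" "\<And>s. 0 < s \<Longrightarrow> s \<le> e \<Longrightarrow> m * s \<le> \<rho> (ray c p s)"
    using boundary_defining_growth[OF bd c p True] unfolding ray_def by blast
  have "\<rho> (ray c p s) powr (- \<alpha>) \<le> m powr (- \<alpha>) * s powr (- M)" if s: "0 < s" "s < min e 1" for s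
  proof -
    have "\<rho> (ray c p s) powr (- \<alpha>) \<le> (m * s) powr (- \<alpha>)"
      using m s \<alpha>(1) by (intro powr_mono2') auto
    also have "\<dots> = m powr (- \<alpha>) * s powr (- \<alpha>)" using m s by (simp add: powr_mult)
    also have "\<dots> \<le> m powr (- \<alpha>) * s powr (- M)"
      using s \<alpha>(3)[OF True] by (intro mult_left_mono powr_mono') auto
    finally show ?thesis .
  qed
  moreover have "min e 1 > 0" using m by simp
  ultimately have "\<forall>\<^sub>F s in at_right 0. \<rho> (ray c p s) powr (- \<alpha>) \<le> m powr (- \<alpha>) * s powr (- M)"
    unfolding eventually_at_right_field by blast
  then show thesis by (rule that)
next
  case False
  have "p \<in> topspace X" using p openin_subset[OF openin_cdom[OF c]] by blast
  then have pos: "\<rho> p > 0" using False bd by (simp add: boundary_defining_def)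
  have "smooth_on (cimg c) (\<rho> \<circ> cinv c)"
    using bd c by (simp add: boundary_defining_def smooth_map_on_mfd_def)
  then have "((\<lambda>s. \<rho> (ray c p s)) \<longlongrightarrow> \<rho> p) (at_right 0)"
    by (intro tendsto_along_ray[OF c p] smooth_on_imp_continuous_on)
  then have "\<forall>\<^sub>F s in at_right 0. \<rho> p / 2 < \<rho> (ray c p s)"
    using pos by (intro order_tendstoD(1)) auto
  moreover have "\<forall>\<^sub>F s in at_right (0::real). 0 < s" "\<forall>\<^sub>F s in at_right (0::real). s < 1"
    unfolding eventually_at_right_field by (auto intro: exI[of _ 1])
  ultimately have "\<forall>\<^sub>F s in at_right 0. \<rho> (ray c p s) powr (- \<alpha>) \<le> (\<rho> p / 2) powr (- \<alpha>) * s powr (- M)"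
  proof eventually_elim
    case (elim s)
    have "\<rho> (ray c p s) powr (- \<alpha>) \<le> (\<rho> p / 2) powr (- \<alpha>) * 1"
      using elim pos \<alpha>(1) powr_mono2'[of "- \<alpha>" "\<rho> p / 2" "\<rho> (ray c p s)"] by simp
    also have "\<dots> \<le> (\<rho> p / 2) powr (- \<alpha>) * s powr (- M)"
      using elim \<alpha>(2) powr_mono'[of "- M" 0 s] by (intro mult_left_mono) auto
    finally show ?case .
  qed
  then show thesis by (rule that)
qed

lemma sum_metric_along_ray:
  fixes N :: nat
  assumes bd: "\<And>i. i \<in> {1..N} \<Longrightarrow> boundary_defining X A (H i) (\<rho> i)" and g0: "riemannian_metric A g0"
    and c: "c \<in> A" and p: "p \<in> cdom c"
    and \<alpha>: "\<And>i. i \<in> {1..N} \<Longrightarrow> 0 \<le> \<alpha> i" "0 \<le> M" "\<And>i. i \<in> {1..N} \<Longrightarrow> p \<in> H i \<Longrightarrow> \<alpha> i \<le> M"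
  obtains K \<epsilon> where "K > 0" "0 < \<epsilon>" "\<epsilon> \<le> 1"
    "\<And>s. 0 < s \<Longrightarrow> s \<le> \<epsilon> \<Longrightarrow> cmap c p + s *\<^sub>R inward c \<in> chart_interior c"
    "\<And>s. 0 < s \<Longrightarrow> s \<le> \<epsilon> \<Longrightarrow> (\<Sum>i\<in>{1..N}. \<rho> i (ray c p s) powr (- \<alpha> i)) *
        (inward c \<bullet> (g0 c (ray c p s) *v inward c)) \<le> K * s powr (- M)"
proof -
  let ?w = "inward c"
  let ?q = "\<lambda>s. ?w \<bullet> (g0 c (ray c p s) *v ?w)"
  have "\<forall>i\<in>{1..N}. \<exists>K. \<forall>\<^sub>F s in at_right 0. \<rho> i (ray c p s) powr (- \<alpha> i) \<le> K * s powr (- M)"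
  proof
    fix i assume i: "i \<in> {1..N}"
    show "\<exists>K. \<forall>\<^sub>F s in at_right 0. \<rho> i (ray c p s) powr (- \<alpha> i) \<le> K * s powr (- M)"
      using powr_bdf_along_ray[OF bd[OF i] c p \<alpha>(1)[OF i] \<alpha>(2) \<alpha>(3)[OF i]] by blast
  qed
  then obtain K where K: "\<And>i. i \<in> {1..N} \<Longrightarrow> \<forall>\<^sub>F s in at_right 0. \<rho> i (ray c p s) powr (- \<alpha> i) \<le> K i * s powr (- M)"
    by metis
  have E1: "\<forall>\<^sub>F s in at_right 0. \<forall>i\<in>{1..N}. \<rho> i (ray c p s) powr (- \<alpha> i) \<le> K i * s powr (- M)"
    using K by (intro eventually_ball_finite) auto
  have "smooth_on (cimg c) (g0 c \<circ> cinv c)" using g0 c by (simp add: riemannian_metric_def)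
  then have "((\<lambda>s. g0 c (ray c p s)) \<longlongrightarrow> g0 c p) (at_right 0)"
    by (intro tendsto_along_ray[OF c p] smooth_on_imp_continuous_on)
  then have "(?q \<longlongrightarrow> ?w \<bullet> (g0 c p *v ?w)) (at_right 0)"
    using linear_quadratic_form linear_conv_bounded_linear bounded_linear.tendsto by blast
  then have E2: "\<forall>\<^sub>F s in at_right 0. ?q s < \<bar>?w \<bullet> (g0 c p *v ?w)\<bar> + 1"
    by (rule order_tendstoD(2)) linarith
  define B where "B = \<bar>?w \<bullet> (g0 c p *v ?w)\<bar> + 1"
  have "B > 0" by (simp add: B_def add_nonneg_pos)
  \<comment> \<open>The \<open>K i\<close> come without a sign: the absolute value permits
    multiplication by \<open>B\<close>, and adding 1 makes the constant positive.\<close>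
  define K' where "K' = \<bar>\<Sum>i\<in>{1..N}. K i\<bar> * B + 1"
  have "\<forall>\<^sub>F s in at_right (0::real). 0 < s" unfolding eventually_at_right_field by (auto intro: exI[of _ 1])
  with E1 E2 eventually_ray_in_chart(2)[OF c p]
  have "\<forall>\<^sub>F s in at_right 0. cmap c p + s *\<^sub>R ?w \<in> chart_interior c \<and>
      (\<Sum>i\<in>{1..N}. \<rho> i (ray c p s) powr (- \<alpha> i)) * ?q s \<le> K' * s powr (- M)"
  proof eventually_elim
    case (elim s)
    let ?S = "\<Sum>i\<in>{1..N}. \<rho> i (ray c p s) powr (- \<alpha> i)"
    have "?S \<le> (\<Sum>i\<in>{1..N}. K i * s powr (- M))" using elim by (intro sum_mono) auto
    also have "\<dots> = (\<Sum>i\<in>{1..N}. K i) * s powr (- M)" by (rule sum_distrib_right[symmetric])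
    also have "\<dots> \<le> \<bar>\<Sum>i\<in>{1..N}. K i\<bar> * s powr (- M)" by (intro mult_right_mono) auto
    finally have S: "?S \<le> \<bar>\<Sum>i\<in>{1..N}. K i\<bar> * s powr (- M)" .
    have "0 \<le> ?S" by (intro sum_nonneg) auto
    then have "?S * ?q s \<le> ?S * B" using elim by (intro mult_left_mono) (auto simp: B_def)
    also have "\<dots> \<le> (\<bar>\<Sum>i\<in>{1..N}. K i\<bar> * s powr (- M)) * B"
      using S \<open>B > 0\<close> by (intro mult_right_mono) auto
    also have "\<dots> \<le> K' * s powr (- M)" by (simp add: K'_def algebra_simps)
    finally show ?case using elim by blast
  qed
  then obtain b where b: "b > 0" "\<And>s. 0 < s \<Longrightarrow> s < b \<Longrightarrow> cmap c p + s *\<^sub>R ?w \<in> chart_interior c \<and>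
      (\<Sum>i\<in>{1..N}. \<rho> i (ray c p s) powr (- \<alpha> i)) * ?q s \<le> K' * s powr (- M)"
    unfolding eventually_at_right_field by blast
  have "K' > 0" using \<open>B > 0\<close> by (simp add: K'_def add_nonneg_pos)
  \<comment> \<open>\<open>b/2\<close> turns a strict bound on \<open>s\<close> into a weak one; the
    bound 1 later keeps powers of the parameter below the parameter itself.\<close>
  then show thesis using b by (intro that[of K' "min (b/2) 1"]) auto
qed

text \<open>The reparametrisation of the ray by \<open>s = \<sigma>\<^sup>k\<close> turns the speed \<open>s\<^sup>-\<^sup>M\<^sup>/\<^sup>2 ds\<close> into a multiple
  of \<open>\<sigma>\<close> to the power \<open>k (1 - M/2) - 1\<close>, which is bounded as soon as \<open>k (2 - M) \<ge> 2\<close>.\<close>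

lemma ray_curve:
  assumes g0: "riemannian_metric A g0" and c: "c \<in> A" and p: "p \<in> cdom c"
    and K: "K > 0" "0 < \<epsilon>" "\<epsilon> \<le> 1"
    "\<And>s. 0 < s \<Longrightarrow> s \<le> \<epsilon> \<Longrightarrow> cmap c p + s *\<^sub>R inward c \<in> chart_interior c"
    "\<And>s. 0 < s \<Longrightarrow> s \<le> \<epsilon> \<Longrightarrow> (\<Sum>i\<in>{1..N}. \<rho> i (ray c p s) powr (- \<alpha> i)) *
        (inward c \<bullet> (g0 c (ray c p s) *v inward c)) \<le> K * s powr (- M)"
    and k: "2 \<le> real k * (2 - M)" "k > 0"
    and T: "T = {0..1} \<or> T = {0..<1}" and ab: "\<And>t. t \<in> T \<Longrightarrow> 0 < a + b * t" "\<And>t. t \<in> T \<Longrightarrow> a + b * t \<le> \<epsilon>"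
  shows "ac_curve X A T (\<lambda>t. ray c p ((a + b * t) ^ k))"
    and "curve_length A (sum_metric N \<rho> \<alpha> g0) T (\<lambda>t. ray c p ((a + b * t) ^ k)) \<le> ennreal (sqrt K * real k * \<bar>b\<bar>)"
proof -
  let ?w = "inward c"
  define \<sigma> where "\<sigma> t = a + b * t" for t
  define \<eta> where "\<eta> t = cmap c p + (\<sigma> t) ^ k *\<^sub>R ?w" for t
  define \<eta>' where "\<eta>' t = (real k * (\<sigma> t) ^ (k - 1) * b) *\<^sub>R ?w" for t
  have \<sigma>: "0 < \<sigma> t" "\<sigma> t \<le> 1" "0 < \<sigma> t ^ k" "\<sigma> t ^ k \<le> \<epsilon>" if "t \<in> T" for t
  proof -
    show 1: "0 < \<sigma> t" "\<sigma> t \<le> 1" using ab[OF that] K by (auto simp: \<sigma>_def)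
    then show "0 < \<sigma> t ^ k" by simp
    have "\<sigma> t ^ k \<le> \<sigma> t ^ 1" using 1 k(2) by (intro power_decreasing) auto
    then show "\<sigma> t ^ k \<le> \<epsilon>" using ab(2)[OF that] by (simp add: \<sigma>_def)
  qed
  have \<gamma>: "(\<lambda>t. ray c p ((a + b * t) ^ k)) = cinv c \<circ> \<eta>" by (simp add: fun_eq_iff ray_def \<eta>_def \<sigma>_def)
  have der: "(\<eta> has_vector_derivative \<eta>' t) (at t)" for t
    unfolding \<eta>_def[abs_def] \<eta>'_def \<sigma>_def has_vector_derivative_def
    by (auto intro!: derivative_eq_intros simp: fun_eq_iff)
  have "continuous_on UNIV \<eta>'"
    unfolding \<eta>'_def[abs_def] \<sigma>_def by (intro continuous_intros)
  moreover have int: "\<eta> t \<in> chart_interior c" if "t \<in> T" for t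
    unfolding \<eta>_def using \<sigma>[OF that] K(4) by blast
  ultimately have ac: "ac_curve X A T (cinv c \<circ> \<eta>)"
    using der by (intro ac_curve_in_chart[OF c]) auto
  then show "ac_curve X A T (\<lambda>t. ray c p ((a + b * t) ^ k))" by (simp add: \<gamma>)
  have speed: "speed A (sum_metric N \<rho> \<alpha> g0) T (cinv c \<circ> \<eta>) t \<le> sqrt K * real k * \<bar>b\<bar>" if t: "t \<in> T" for t
  proof -
    let ?s = "\<sigma> t ^ k"
    let ?S = "\<Sum>i\<in>{1..N}. \<rho> i (ray c p ?s) powr (- \<alpha> i)"
    have \<eta>c: "\<eta> t \<in> cimg c" using int[OF t] chart_interior_subset by blast
    \<comment> \<open>A nondegenerate interval has no isolated points, so the velocity within
      \<open>T\<close> is unique, also at an endpoint.\<close>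
    have "at t within T \<noteq> bot" using T t by (auto simp: trivial_limit_within)
    moreover obtain \<delta> where \<delta>: "\<delta> > 0" "\<And>x. x \<in> T \<Longrightarrow> dist x t < \<delta> \<Longrightarrow> \<eta> x = (cmap c \<circ> (cinv c \<circ> \<eta>)) x"
    proof (rule that[of 1])
      fix x assume "x \<in> T"
      then show "\<eta> x = (cmap c \<circ> (cinv c \<circ> \<eta>)) x" using int[of x] chart_interior_subset by (auto simp: subset_iff)
    qed simp
    moreover have "((cmap c \<circ> (cinv c \<circ> \<eta>)) has_vector_derivative \<eta>' t) (at t within T)"
      using has_vector_derivative_transform_within[OF has_vector_derivative_at_within[OF der] \<delta>(1) t \<delta>(2)] .
    ultimately have "speed A (sum_metric N \<rho> \<alpha> g0) T (cinv c \<circ> \<eta>) t =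
        sqrt ((\<Sum>i\<in>{1..N}. \<rho> i ((cinv c \<circ> \<eta>) t) powr (- \<alpha> i)) * (\<eta>' t \<bullet> (g0 c ((cinv c \<circ> \<eta>) t) *v \<eta>' t)))"
      using ac t c \<eta>c unfolding ac_curve_def
      by (intro speed_sum_metric[OF g0]) auto
    also have "(cinv c \<circ> \<eta>) t = ray c p ?s" by (simp add: \<eta>_def ray_def)
    finally have eq: "speed A (sum_metric N \<rho> \<alpha> g0) T (cinv c \<circ> \<eta>) t =
        sqrt (?S * (\<eta>' t \<bullet> (g0 c (ray c p ?s) *v \<eta>' t)))" .
    have "?S * (\<eta>' t \<bullet> (g0 c (ray c p ?s) *v \<eta>' t)) =
        (real k * \<sigma> t ^ (k - 1) * b)\<^sup>2 * (?S * (?w \<bullet> (g0 c (ray c p ?s) *v ?w)))"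
      by (simp add: \<eta>'_def matrix_vector_mult_scaleR power2_eq_square mult_ac)
    also have "\<dots> \<le> (real k * \<sigma> t ^ (k - 1) * b)\<^sup>2 * (K * ?s powr (- M))"
      using K(5)[OF \<sigma>(3,4)[OF t]] by (intro mult_left_mono) auto
    also have "\<dots> = K * (real k * b)\<^sup>2 * ((\<sigma> t ^ (k - 1))\<^sup>2 * ?s powr (- M))"
      by (simp add: power_mult_distrib mult_ac)
    also have "\<dots> \<le> K * (real k * b)\<^sup>2 * 1"
    proof (rule mult_left_mono)
      \<comment> \<open>With \<open>?s = \<sigma> t ^ k\<close> the total exponent is
        \<open>k * (2 - M) - 2\<close>, nonnegative by the choice of \<open>k\<close>, and the base
        is at most 1.\<close>
      have "(\<sigma> t ^ (k - 1))\<^sup>2 * ?s powr (- M) = \<sigma> t powr (real (2 * (k - 1)) - real k * M)"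
        using \<sigma>(1)[OF t]
        by (simp add: powr_realpow[symmetric] powr_powr powr_add[symmetric] power_mult[symmetric] mult.commute)
      also have "\<dots> \<le> \<sigma> t powr 0"
        using \<sigma>(1,2)[OF t] k by (intro powr_mono') (auto simp: of_nat_diff algebra_simps)
      finally show "(\<sigma> t ^ (k - 1))\<^sup>2 * ?s powr (- M) \<le> 1" using \<sigma>(1)[OF t] by simp
    qed (use K in simp)
    finally have "speed A (sum_metric N \<rho> \<alpha> g0) T (cinv c \<circ> \<eta>) t \<le> sqrt (K * (real k * b)\<^sup>2)"
      unfolding eq by simp
    also have "\<dots> = sqrt K * real k * \<bar>b\<bar>" by (simp add: real_sqrt_mult abs_mult)
    finally show ?thesis .
  qed
  \<comment> \<open>Both choices of \<open>T\<close> have measure 1, so the bound on the speed is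
    the bound on the length.\<close>
  have "curve_length A (sum_metric N \<rho> \<alpha> g0) T (cinv c \<circ> \<eta>) \<le>
      (\<integral>\<^sup>+t. ennreal (sqrt K * real k * \<bar>b\<bar>) * indicator T t \<partial>lebesgue)"
    unfolding curve_length_def using speed by (intro nn_integral_mono) (auto simp: indicator_def intro: ennreal_leI)
  also have "\<dots> = ennreal (sqrt K * real k * \<bar>b\<bar>)"
    using T by (subst nn_integral_cmult_indicator) auto
  finally show "curve_length A (sum_metric N \<rho> \<alpha> g0) T (\<lambda>t. ray c p ((a + b * t) ^ k)) \<le> ennreal (sqrt K * real k * \<bar>b\<bar>)"
    by (simp add: \<gamma>)
qed

text \<open>In the parameter whose \<open>k\<close>-th power is the position on the ray, the speed
  is bounded. Running this parameter to 0 gives a curve of finite length into \<open>p\<close>, and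
  any sequence of parameters tending to 0 gives a Cauchy sequence of points.\<close>

lemma small_exponent_imp_approachable_accessible:
  assumes bd: "\<And>i. i \<in> {1..N} \<Longrightarrow> boundary_defining X A (H i) (\<rho> i)" and g0: "riemannian_metric A g0"
    and p: "p \<in> topspace X"
    and \<alpha>: "\<And>i. i \<in> {1..N} \<Longrightarrow> 0 \<le> \<alpha> i" "0 \<le> M" "\<And>i. i \<in> {1..N} \<Longrightarrow> p \<in> H i \<Longrightarrow> \<alpha> i \<le> M" "M < 2"
  shows "finite_length_approachable X A (sum_metric N \<rho> \<alpha> g0) p"
    and "accessible X A (sum_metric N \<rho> \<alpha> g0) p"
proof -
  let ?g = "sum_metric N \<rho> \<alpha> g0"
  obtain c where c: "c \<in> A" "p \<in> cdom c" using p topspace_charts by blast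
  obtain K \<epsilon> where K: "K > 0" "0 < \<epsilon>" "\<epsilon> \<le> 1"
    "\<And>s. 0 < s \<Longrightarrow> s \<le> \<epsilon> \<Longrightarrow> cmap c p + s *\<^sub>R inward c \<in> chart_interior c"
    "\<And>s. 0 < s \<Longrightarrow> s \<le> \<epsilon> \<Longrightarrow> (\<Sum>i\<in>{1..N}. \<rho> i (ray c p s) powr (- \<alpha> i)) *
        (inward c \<bullet> (g0 c (ray c p s) *v inward c)) \<le> K * s powr (- M)"
    using sum_metric_along_ray[where N=N and \<rho>=\<rho> and \<alpha>=\<alpha> and H=H and M=M, OF bd g0 c \<alpha>(1-3)] by blast
  obtain k :: nat where "2 / (2 - M) < real k" using reals_Archimedean2 by blast
  moreover have "0 < 2 / (2 - M)" using \<alpha>(4) by simp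
  ultimately have k: "2 \<le> real k * (2 - M)" "k > 0" using \<alpha>(4)
    by (simp add: pos_divide_less_eq less_imp_le, metis gr0I less_asym of_nat_0)
  note curve = ray_curve[OF g0 c K k]
  have lim: "limitin X (\<lambda>t. ray c p (f t ^ k)) p F"
    if f: "(f \<longlongrightarrow> 0) F" "\<forall>\<^sub>F t in F. 0 < f t \<and> f t \<le> \<epsilon>" for f :: "'b \<Rightarrow> real" and F
    unfolding ray_def
  proof (rule ray_limit[OF c])
    show "((\<lambda>t. f t ^ k) \<longlongrightarrow> 0) F" using tendsto_power[OF f(1), of k] k(2) by (simp add: power_0_left)
    show "\<forall>\<^sub>F t in F. cmap c p + f t ^ k *\<^sub>R inward c \<in> cimg c"
      using f(2)
    proof eventually_elim
      case (elim t)
      have "f t ^ k \<le> f t ^ 1" using elim K(3) k(2) by (intro power_decreasing) auto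
      then show ?case using K(4)[of "f t ^ k"] elim chart_interior_subset by auto
    qed
  qed
  show "finite_length_approachable X A ?g p"
    unfolding finite_length_approachable_def
  proof (intro exI conjI)
    let ?\<gamma> = "\<lambda>t. ray c p ((\<epsilon> + (- \<epsilon>) * t) ^ k)"
    have ab: "0 < \<epsilon> + (- \<epsilon>) * t" "\<epsilon> + (- \<epsilon>) * t \<le> \<epsilon>" if "t \<in> {0..<1}" for t
      using that K(2) by auto
    show "ac_curve X A {0..<1} ?\<gamma>" using curve(1)[of "{0..<1}" \<epsilon> "- \<epsilon>"] ab by blast
    have "curve_length A ?g {0..<1} ?\<gamma> \<le> ennreal (sqrt K * real k * \<bar>- \<epsilon>\<bar>)"
      using curve(2)[of "{0..<1}" \<epsilon> "- \<epsilon>"] ab by blast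
    then show "curve_length A ?g {0..<1} ?\<gamma> < \<infinity>" by (simp add: le_less_trans)
    show "limitin X ?\<gamma> p (at_left 1)"
    proof (rule lim)
      have "((\<lambda>t. \<epsilon> + (- \<epsilon>) * t) \<longlongrightarrow> \<epsilon> + (- \<epsilon>) * 1) (at_left (1::real))" by (intro tendsto_intros)
      then show "((\<lambda>t. \<epsilon> + (- \<epsilon>) * t) \<longlongrightarrow> 0) (at_left 1)" by simp
      show "\<forall>\<^sub>F t in at_left 1. 0 < \<epsilon> + (- \<epsilon>) * t \<and> \<epsilon> + (- \<epsilon>) * t \<le> \<epsilon>"
        unfolding eventually_at_left_field using ab by (intro exI[of _ 0]) auto
    qed
  qed
  show "accessible X A ?g p"
  proof -
    define \<sigma> where "\<sigma> n = \<epsilon> * (1 / real (Suc n))" for n :: nat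
    have \<sigma>: "0 < \<sigma> n" "\<sigma> n \<le> \<epsilon>" for n using K(2) by (auto simp: \<sigma>_def field_simps)
    have "(\<lambda>n. \<epsilon> * (1 / real (Suc n))) \<longlonglongrightarrow> \<epsilon> * 0"
      by (intro tendsto_mult_left LIMSEQ_Suc[OF lim_1_over_n])
    then have \<sigma>0: "\<sigma> \<longlonglongrightarrow> 0" by (simp add: \<sigma>_def[abs_def])
    let ?q = "\<lambda>n. ray c p (\<sigma> n ^ k)"
    \<comment> \<open>Two points of the ray are joined along the ray itself, with length controlled
      by the difference of their parameters.\<close>
    have conn: "ac_curve X A {0..1} (\<lambda>t. ray c p ((\<sigma> m + (\<sigma> n - \<sigma> m) * t) ^ k))"
      "curve_length A ?g {0..1} (\<lambda>t. ray c p ((\<sigma> m + (\<sigma> n - \<sigma> m) * t) ^ k)) \<le> ennreal (sqrt K * real k * \<bar>\<sigma> n - \<sigma> m\<bar>)" for m n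
    proof -
      have "\<sigma> m + (\<sigma> n - \<sigma> m) * t \<in> {0<..\<epsilon>}" if "t \<in> {0..1}" for t
      proof -
        have "convex {0<..\<epsilon>}" by (rule convex_real_interval)
        then have "(1 - t) *\<^sub>R \<sigma> m + t *\<^sub>R \<sigma> n \<in> {0<..\<epsilon>}" using that \<sigma> by (intro convexD) auto
        then show ?thesis by (simp add: algebra_simps)
      qed
      then show "ac_curve X A {0..1} (\<lambda>t. ray c p ((\<sigma> m + (\<sigma> n - \<sigma> m) * t) ^ k))"
        "curve_length A ?g {0..1} (\<lambda>t. ray c p ((\<sigma> m + (\<sigma> n - \<sigma> m) * t) ^ k)) \<le> ennreal (sqrt K * real k * \<bar>\<sigma> n - \<sigma> m\<bar>)"
        using curve[of "{0..1}" "\<sigma> m" "\<sigma> n - \<sigma> m"] by auto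
    qed
    have "?q n \<in> mint X A" for n
    proof -
      \<comment> \<open>The constant curve, obtained for equal indices, shows that the point lies in
        the interior.\<close>
      have "(\<lambda>t. ray c p ((\<sigma> n + (\<sigma> n - \<sigma> n) * t) ^ k)) ` {0..1} \<subseteq> mint X A"
        using conn(1)[of n n] unfolding ac_curve_def by blast
      then show ?thesis by (simp add: image_constant_conv)
    qed
    then have range: "range ?q \<subseteq> mint X A" by blast
    have limit: "limitin X ?q p sequentially" using \<sigma>0 \<sigma> by (intro lim) auto
    have cauchy: "\<exists>M. \<forall>m\<ge>M. \<forall>n\<ge>M. rdist X A ?g (?q m) (?q n) < ennreal e" if "e > 0" for e :: real
    proof -
    define C where "C = sqrt K * real k"
    have "C > 0" using K k by (simp add: C_def)
    have "Cauchy \<sigma>" using \<sigma>0 by (rule LIMSEQ_imp_Cauchy)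
    then obtain M0 where M0: "\<And>m n. m \<ge> M0 \<Longrightarrow> n \<ge> M0 \<Longrightarrow> dist (\<sigma> m) (\<sigma> n) < e / C"
      using metric_CauchyD[of \<sigma> "e / C"] \<open>e > 0\<close> \<open>C > 0\<close> by auto
    show ?thesis
    proof (intro exI[of _ M0] allI impI)
      fix m n assume mn: "M0 \<le> m" "M0 \<le> n"
      have "rdist X A ?g (?q m) (?q n) \<le> curve_length A ?g {0..1} (\<lambda>t. ray c p ((\<sigma> m + (\<sigma> n - \<sigma> m) * t) ^ k))"
        unfolding rdist_def using conn(1)[of m n] by (intro Inf_lower) auto
      also have "\<dots> \<le> ennreal (C * \<bar>\<sigma> n - \<sigma> m\<bar>)" using conn(2)[of m n] by (simp add: C_def)
      also have "\<dots> < ennreal e"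
        using M0[OF mn] \<open>C > 0\<close> \<open>e > 0\<close> by (intro ennreal_lessI) (auto simp: dist_real_def field_simps abs_minus_commute)
      finally show "rdist X A ?g (?q m) (?q n) < ennreal e" .
    qed
    qed
    show ?thesis unfolding accessible_def using range cauchy limit by blast
  qed
qed

end

section \<open>Bounds for the differential of a smooth function\<close>

text \<open>The minimum on the compact unit sphere, extended by homogeneity of degree 2.\<close>

lemma positive_definite_lower_bound:
  fixes M :: "real^'n^'n"
  assumes "\<And>v. v \<noteq> 0 \<Longrightarrow> v \<bullet> (M *v v) > 0"
  obtains m where "m > 0" "\<And>v. m * (norm v)\<^sup>2 \<le> v \<bullet> (M *v v)"
proof -
  have "continuous_on (sphere 0 1) (\<lambda>v. v \<bullet> (M *v v))"
    by (intro continuous_intros matrix_vector_mult_linear_continuous_on)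
  moreover have "sphere (0::real^'n) 1 \<noteq> {}" by simp
  ultimately obtain u where u: "u \<in> sphere 0 1" "\<And>v. v \<in> sphere 0 1 \<Longrightarrow> u \<bullet> (M *v u) \<le> v \<bullet> (M *v v)"
    using continuous_attains_inf[of "sphere 0 1" "\<lambda>v. v \<bullet> (M *v v)"] compact_sphere by blast
  show thesis
  proof (rule that)
    show "u \<bullet> (M *v u) > 0" using u(1) by (intro assms) auto
    fix v :: "real^'n"
    show "u \<bullet> (M *v u) * (norm v)\<^sup>2 \<le> v \<bullet> (M *v v)"
    proof (cases "v = 0")
      case False
      have "u \<bullet> (M *v u) \<le> (v /\<^sub>R norm v) \<bullet> (M *v (v /\<^sub>R norm v))"
        using False by (intro u(2)) simp
      also have "\<dots> = (v \<bullet> (M *v v)) / (norm v)\<^sup>2"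
        by (simp add: matrix_vector_mult_scaleR power2_eq_square divide_inverse mult_ac)
      finally show ?thesis using False by (simp add: pos_le_divide_eq)
    qed simp
  qed
qed

text \<open>Each entry of \<open>M *v v\<close> is at most \<open>norm M * norm v\<close> by the
  Cauchy-Schwarz inequality, and there are \<open>CARD('n)\<close> entries. The crude constant
  suffices to compare Gram matrices at nearby points.\<close>

lemma abs_quadratic_form_le:
  fixes M :: "real^'n^'n"
  shows "\<bar>v \<bullet> (M *v v)\<bar> \<le> real CARD('n) * norm M * (norm v)\<^sup>2"
proof -
  have "norm (M *v v) \<le> (\<Sum>i\<in>UNIV. \<bar>(M *v v) $ i\<bar>)" by (rule norm_le_l1_cart)
  also have "\<dots> \<le> (\<Sum>i\<in>(UNIV::'n set). norm M * norm v)"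
  proof (rule sum_mono)
    fix i
    have "\<bar>(M *v v) $ i\<bar> \<le> norm (M $ i) * norm v"
      by (simp add: matrix_vector_mul_component Cauchy_Schwarz_ineq2)
    also have "\<dots> \<le> norm M * norm v" by (intro mult_right_mono Finite_Cartesian_Product.norm_nth_le) auto
    finally show "\<bar>(M *v v) $ i\<bar> \<le> norm M * norm v" .
  qed
  finally have "norm (M *v v) \<le> real CARD('n) * (norm M * norm v)" by simp
  then have "norm v * norm (M *v v) \<le> norm v * (real CARD('n) * (norm M * norm v))"
    by (intro mult_left_mono) auto
  then show ?thesis
    using Cauchy_Schwarz_ineq2[of v "M *v v"] by (simp add: power2_eq_square mult_ac)
qed

text \<open>Stated without measurability, so that it applies to the speed of an arbitrary curve.\<close>

lemma nn_integral_superadditive: "(\<integral>\<^sup>+x. f x \<partial>M) + (\<integral>\<^sup>+x. g x \<partial>M) \<le> (\<integral>\<^sup>+x. f x + g x \<partial>M)"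
proof -
  let ?S = "\<lambda>f. {s. simple_function M s \<and> s \<le> f}"
  have ne: "?S f \<noteq> {}" for f :: "'a \<Rightarrow> ennreal"
  proof -
    have "(\<lambda>_. 0) \<in> ?S f" by (simp add: le_fun_def)
    then show ?thesis by blast
  qed
  have "integral\<^sup>S M s + integral\<^sup>S M t \<le> (\<integral>\<^sup>+x. f x + g x \<partial>M)" if "s \<in> ?S f" "t \<in> ?S g" for s t
  proof -
    have "integral\<^sup>S M s + integral\<^sup>S M t = (\<integral>\<^sup>+x. s x + t x \<partial>M)"
      using that by (simp add: nn_integral_eq_simple_integral[symmetric] nn_integral_add borel_measurable_simple_function)
    also have "\<dots> \<le> (\<integral>\<^sup>+x. f x + g x \<partial>M)"
      using that by (intro nn_integral_mono add_mono) (auto simp: le_fun_def)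
    finally show ?thesis .
  qed
  \<comment> \<open>Both integrals are suprema over simple functions, for which additivity holds;
    the suprema are taken one after the other.\<close>
  then have "(SUP t\<in>?S g. integral\<^sup>S M s + integral\<^sup>S M t) \<le> (\<integral>\<^sup>+x. f x + g x \<partial>M)" if "s \<in> ?S f" for s
    using that by (intro SUP_least) auto
  moreover have "(SUP t\<in>?S g. integral\<^sup>S M s + integral\<^sup>S M t) = integral\<^sup>S M s + (\<integral>\<^sup>+x. g x \<partial>M)" for s
    unfolding nn_integral_def[of M g] by (rule ennreal_SUP_add_right[OF ne, symmetric])
  ultimately have "(SUP s\<in>?S f. integral\<^sup>S M s + (\<integral>\<^sup>+x. g x \<partial>M)) \<le> (\<integral>\<^sup>+x. f x + g x \<partial>M)"
    by (intro SUP_least) simp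
  also have "(SUP s\<in>?S f. integral\<^sup>S M s + (\<integral>\<^sup>+x. g x \<partial>M)) = (\<integral>\<^sup>+x. f x \<partial>M) + (\<integral>\<^sup>+x. g x \<partial>M)"
    unfolding nn_integral_def[of M f] by (rule ennreal_SUP_add_left[OF ne])
  finally show ?thesis .
qed

lemma abs_continuous_on_interval_cong:
  assumes "\<And>x. x \<in> {s..t} \<Longrightarrow> f x = g x" "abs_continuous_on_interval s t f"
  shows "abs_continuous_on_interval s t g"
proof -
  have "(\<Sum>i<m. norm (f (b i) - f (a i))) = (\<Sum>i<m. norm (g (b i) - g (a i)))"
    if "nonoverlapping s t {..<m} a b" for m :: nat and a b
  proof (rule sum.cong)
    fix i assume "i \<in> {..<m}"
    then have "a i \<in> {s..t}" "b i \<in> {s..t}" using nonoverlappingD(1-3)[OF that, of i] by auto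
    then show "norm (f (b i) - f (a i)) = norm (g (b i) - g (a i))" using assms(1) by simp
  qed simp
  then show ?thesis using assms(2) unfolding abs_continuous_on_interval_iff by metis
qed

lemma ln_C1_open:
  fixes f :: "'a::real_normed_vector \<Rightarrow> real"
  assumes "\<And>x. x \<in> U \<Longrightarrow> f differentiable (at x)" "\<And>x. x \<in> U \<Longrightarrow> 0 < f x"
    and "\<And>v. continuous_on U (\<lambda>x. frechet_derivative f (at x) v)"
  shows "x \<in> U \<Longrightarrow> ((\<lambda>x. ln (f x)) has_derivative (\<lambda>v. frechet_derivative f (at x) v / f x)) (at x)"
    and "continuous_on U (\<lambda>x. frechet_derivative (\<lambda>x. ln (f x)) (at x) v)"
proof -
  have der: "((\<lambda>x. ln (f x)) has_derivative (\<lambda>v. frechet_derivative f (at x) v / f x)) (at x)" if "x \<in> U" for x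
  proof -
    have "(f has_derivative frechet_derivative f (at x)) (at x)"
      using assms(1)[OF that] frechet_derivative_works by blast
    from has_derivative_ln[OF assms(2)[OF that] this] show ?thesis by (simp add: divide_inverse)
  qed
  then show "x \<in> U \<Longrightarrow> ((\<lambda>x. ln (f x)) has_derivative (\<lambda>v. frechet_derivative f (at x) v / f x)) (at x)" .
  have "continuous_on U f"
    using assms(1) by (intro continuous_at_imp_continuous_on) (simp add: differentiable_imp_continuous_within)
  then have "continuous_on U (\<lambda>x. frechet_derivative f (at x) v / f x)"
    using assms(2) by (intro continuous_on_divide assms(3)) force+
  then show "continuous_on U (\<lambda>x. frechet_derivative (\<lambda>x. ln (f x)) (at x) v)"
    by (rule continuous_on_eq) (simp add: frechet_derivative_at[OF der, symmetric])
qed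

section \<open>Differentials measured by the background metric\<close>

context corner_manifold
begin

lemma openin_chart_preimage:
  assumes "c \<in> A" "open U"
  shows "openin X {q \<in> cdom c. cmap c q \<in> U}"
proof -
  have "openin (subtopology X (cdom c)) {q \<in> topspace (subtopology X (cdom c)). cmap c q \<in> U}"
    using continuous_map_cmap[OF assms(1)] assms(2) by (intro openin_continuous_map_preimage) auto
  then show ?thesis
    unfolding topspace_cdom[OF assms(1)] using openin_cdom[OF assms(1)] by (rule openin_trans_full)
qed

lemma continuous_map_smooth:
  fixes f :: "'a \<Rightarrow> real"
  assumes "smooth_map_on_mfd A f"
  shows "continuous_map X euclidean f"
  unfolding continuous_map_def
proof (intro conjI allI impI)
  fix U :: "real set" assume "openin euclidean U"
  then have "open U" by simp
  show "openin X {x \<in> topspace X. f x \<in> U}"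
  proof (subst openin_subopen, intro ballI)
    fix x assume "x \<in> {x \<in> topspace X. f x \<in> U}"
    then obtain c where c: "c \<in> A" "x \<in> cdom c" "f x \<in> U" using topspace_charts by blast
    have "smooth_on (cimg c) (f \<circ> cinv c)" using assms c by (simp add: smooth_map_on_mfd_def)
    then have "continuous_on (cimg c) (f \<circ> cinv c)" by (rule smooth_on_imp_continuous_on)
    then obtain V where V: "open V" "V \<inter> cimg c = (f \<circ> cinv c) -` U \<inter> cimg c"
      using continuous_on_open_invariant[THEN iffD1, rule_format, of "cimg c" "f \<circ> cinv c" U] \<open>open U\<close> by blast
    have mem: "cmap c q \<in> V \<longleftrightarrow> f q \<in> U" if "q \<in> cdom c" for q
    proof -
      have "cmap c q \<in> V \<longleftrightarrow> cmap c q \<in> V \<inter> cimg c" using that by blast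
      then show ?thesis unfolding V(2) using that c(1) by simp
    qed
    show "\<exists>T. openin X T \<and> x \<in> T \<and> T \<subseteq> {x \<in> topspace X. f x \<in> U}"
      using openin_chart_preimage[OF c(1) V(1)] mem c openin_subset[OF openin_cdom[OF c(1)]]
      by (intro exI[of _ "{q \<in> cdom c. cmap c q \<in> V}"]) auto
  qed
qed auto

lemma coord_deriv_change:
  assumes f: "smooth_map_on_mfd A (f :: 'a \<Rightarrow> real)" and c: "c \<in> A" "d \<in> A"
    and q: "q \<in> mint X A" "q \<in> cdom c" "q \<in> cdom d"
  shows "coord_deriv c f q v = coord_deriv d f q (frechet_derivative (cmap d \<circ> cinv c) (at (cmap c q)) v)"
proof -
  let ?\<Phi> = "cmap d \<circ> cinv c"
  let ?U = "cmap c ` (cdom c \<inter> cdom d) \<inter> chart_interior c"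
  have U: "cmap c q \<in> ?U" using interior_overlap_mem[OF c(1) q] .
  have "(?\<Phi> has_derivative frechet_derivative ?\<Phi> (at (cmap c q))) (at (cmap c q))"
    using transition_C1(2)[OF c U] frechet_derivative_works by blast
  moreover have "?\<Phi> (cmap c q) = cmap d q" using c q by simp
  moreover have "(f \<circ> cinv d) differentiable (at (cmap d q))"
  proof (rule smooth_on_C1_open(1)[OF _ open_chart_interior[OF c(2)] chart_interior_subset])
    show "smooth_on (cimg d) (f \<circ> cinv d)" using f c(2) by (simp add: smooth_map_on_mfd_def)
    show "cmap d q \<in> chart_interior d" using mint_imp_chart_interior[OF q(1) c(2) q(3)] .
  qed
  then have "((f \<circ> cinv d) has_derivative frechet_derivative (f \<circ> cinv d) (at (cmap d q))) (at (cmap d q))"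
    using frechet_derivative_works by blast
  ultimately have "((f \<circ> cinv d) \<circ> ?\<Phi> has_derivative
      frechet_derivative (f \<circ> cinv d) (at (cmap d q)) \<circ> frechet_derivative ?\<Phi> (at (cmap c q))) (at (cmap c q))"
    by (intro diff_chain_at) auto
  then have "((f \<circ> cinv c) has_derivative
      frechet_derivative (f \<circ> cinv d) (at (cmap d q)) \<circ> frechet_derivative ?\<Phi> (at (cmap c q))) (at (cmap c q))"
    by (rule has_derivative_transform_within_open[OF _ transition_C1(1)[OF c] U]) (use c in auto)
  from frechet_derivative_at[OF this, symmetric] show ?thesis
    using coord_deriv_interior[OF c(1) q(1,2), of f] coord_deriv_interior[OF c(2) q(1,3), of f] by simp
qed

lemma riemannian_metric_pos:
  assumes "riemannian_metric A g" "c \<in> A" "p \<in> cdom c" "v \<noteq> 0"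
  shows "v \<bullet> (g c p *v v) > 0"
  using assms unfolding riemannian_metric_def by blast

text \<open>\<open>p\<close> may lie on the boundary, so the differential is estimated through a C1
  extension \<open>F\<close> across it, whose derivative agrees with that of \<open>f\<close> at
  interior points. Near \<open>p\<close> the Gram matrix keeps half of its lower bound.\<close>

lemma differential_bounded_locally:
  assumes g0: "riemannian_metric A g0" and f: "smooth_map_on_mfd A (f :: 'a \<Rightarrow> real)"
    and c: "c \<in> A" and p: "p \<in> cdom c"
  obtains W B where "openin X W" "p \<in> W" "W \<subseteq> cdom c" "B > 0"
    "\<And>q v. q \<in> W \<Longrightarrow> q \<in> mint X A \<Longrightarrow> (coord_deriv c f q v)\<^sup>2 \<le> B * (v \<bullet> (g0 c q *v v))"
proof -
  define x0 where "x0 = cmap c p"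
  have x0: "x0 \<in> cimg c" using p by (simp add: x0_def)
  obtain m where m: "m > 0" "\<And>v. m * (norm v)\<^sup>2 \<le> v \<bullet> (g0 c p *v v)"
    using positive_definite_lower_bound[OF riemannian_metric_pos[OF g0 c p]] by blast
  define n where "n = real CARD('n)"
  have "n > 0" by (simp add: n_def)
  have "smooth_on (cimg c) (g0 c \<circ> cinv c)" using g0 c by (simp add: riemannian_metric_def)
  then have "continuous_on (cimg c) (g0 c \<circ> cinv c)" by (rule smooth_on_imp_continuous_on)
  \<comment> \<open>If the Gram matrix deviates by less than this,
    \<open>abs_quadratic_form_le\<close> limits the loss in the quadratic form to
    \<open>m / 2\<close>.\<close>
  moreover have "m / (2 * n) > 0" using m \<open>n > 0\<close> by simp
  ultimately obtain d1 where d1: "d1 > 0"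
      "\<And>x. x \<in> cimg c \<Longrightarrow> dist x x0 < d1 \<Longrightarrow> dist ((g0 c \<circ> cinv c) x) ((g0 c \<circ> cinv c) x0) < m / (2 * n)"
    using x0 unfolding continuous_on_iff by metis
  have fc: "smooth_on (cimg c) (f \<circ> cinv c)" using f c by (simp add: smooth_map_on_mfd_def)
  obtain V F where VF: "open V" "x0 \<in> V" "\<And>y. y \<in> V \<Longrightarrow> F differentiable (at y)"
    "\<And>v. continuous_on V (\<lambda>y. frechet_derivative F (at y) v)" "\<And>y. y \<in> cimg c \<Longrightarrow> y \<in> V \<Longrightarrow> F y = (f \<circ> cinv c) y"
    using smooth_on_local_C1_extension[OF fc x0] by blast
  define L where "L y = (\<Sum>i\<in>Basis. norm (frechet_derivative F (at y) i))" for y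
  have "continuous_on V L" unfolding L_def by (intro continuous_intros VF(4))
  then obtain d2 where d2: "d2 > 0" "\<And>x. x \<in> V \<Longrightarrow> dist x x0 < d2 \<Longrightarrow> dist (L x) (L x0) < 1"
    using VF(2) zero_less_one unfolding continuous_on_iff by metis
  define U where "U = V \<inter> ball x0 (min d1 d2)"
  have "open U" "x0 \<in> U" using VF d1 d2 by (auto simp: U_def)
  \<comment> \<open>\<open>(L x0 + 1)\<^sup>2\<close> bounds the squared norm of the differential,
    and \<open>2 / m\<close> converts squared Euclidean length into
    \<open>g0\<close>-length.\<close>
  define B where "B = (L x0 + 1)\<^sup>2 * (2 / m)"
  have "L x0 \<ge> 0" unfolding L_def by (intro sum_nonneg) auto
  then have "B > 0" using m by (simp add: B_def)
  have bound: "(coord_deriv c f q v)\<^sup>2 \<le> B * (v \<bullet> (g0 c q *v v))"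
    if q: "q \<in> cdom c" "cmap c q \<in> U" "q \<in> mint X A" for q v
  proof -
    let ?x = "cmap c q"
    have x: "?x \<in> cimg c" "?x \<in> V" "dist ?x x0 < d1" "dist ?x x0 < d2"
      using q by (auto simp: U_def dist_commute)
    have "norm (g0 c q - g0 c p) \<le> m / (2 * n)"
      using d1(2)[OF x(1,3)] q(1) p c by (simp add: x0_def dist_norm)
    then have "n * norm (g0 c q - g0 c p) \<le> m / 2" using \<open>n > 0\<close> by (simp add: field_simps)
    then have "n * norm (g0 c q - g0 c p) * (norm v)\<^sup>2 \<le> m / 2 * (norm v)\<^sup>2" by (intro mult_right_mono) auto
    with abs_quadratic_form_le[of v "g0 c q - g0 c p"]
    have "\<bar>v \<bullet> ((g0 c q - g0 c p) *v v)\<bar> \<le> m / 2 * (norm v)\<^sup>2" by (simp add: n_def)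
    then have "\<bar>v \<bullet> (g0 c q *v v) - v \<bullet> (g0 c p *v v)\<bar> \<le> m / 2 * (norm v)\<^sup>2"
      by (simp add: matrix_vector_mult_diff_rdistrib inner_diff_right)
    moreover have "m * (norm v)\<^sup>2 = m / 2 * (norm v)\<^sup>2 + m / 2 * (norm v)\<^sup>2" by (simp add: field_simps)
    ultimately have lower: "m / 2 * (norm v)\<^sup>2 \<le> v \<bullet> (g0 c q *v v)" using m(2)[of v] by linarith
    have "(f \<circ> cinv c has_derivative frechet_derivative F (at ?x)) (at ?x)"
      using mint_imp_chart_interior[OF q(3) c q(1)] x(2) VF(3,5)
      by (intro smooth_on_frechet_derivative_extension[OF VF(1) _ _ open_chart_interior[OF c] chart_interior_subset]) auto
    then have "coord_deriv c f q v = frechet_derivative F (at ?x) v"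
      using coord_deriv_interior[OF c q(3,1)] frechet_derivative_at by metis
    also have "\<bar>\<dots>\<bar> \<le> L ?x * norm v"
      using frechet_derivative_norm_le[OF VF(3)[OF x(2)], of v] by (simp add: L_def)
    finally have "\<bar>coord_deriv c f q v\<bar> \<le> L ?x * norm v" .
    also have "\<dots> \<le> (L x0 + 1) * norm v"
      using d2(2)[OF x(2,4)] by (intro mult_right_mono) (auto simp: dist_real_def)
    finally have "(coord_deriv c f q v)\<^sup>2 \<le> ((L x0 + 1) * norm v)\<^sup>2"
      using abs_le_square_iff[of "coord_deriv c f q v" "(L x0 + 1) * norm v"] \<open>L x0 \<ge> 0\<close> by (simp add: abs_mult)
    also have "\<dots> = B * (m / 2 * (norm v)\<^sup>2)" using m(1) by (simp add: B_def power_mult_distrib)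
    also have "\<dots> \<le> B * (v \<bullet> (g0 c q *v v))" using lower \<open>B > 0\<close> by (intro mult_left_mono) auto
    finally show ?thesis .
  qed
  show thesis
  proof (rule that)
    show "openin X {q \<in> cdom c. cmap c q \<in> U}" using openin_chart_preimage[OF c \<open>open U\<close>] .
    show "p \<in> {q \<in> cdom c. cmap c q \<in> U}" using p \<open>x0 \<in> U\<close> by (simp add: x0_def)
    show "B > 0" by fact
  qed (use bound in auto)
qed

text \<open>Compactness gives finitely many local bounds, each in its own chart. Both sides of the
  inequality are independent of the chart, so the largest constant serves all charts of the atlas,
  however many there are.\<close>

lemma differential_bounded:
  assumes compact: "compact_space X" and g0: "riemannian_metric A g0" and f: "smooth_map_on_mfd A (f :: 'a \<Rightarrow> real)"
  obtains B where "B > 0"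
    "\<And>c q v. c \<in> A \<Longrightarrow> q \<in> mint X A \<Longrightarrow> q \<in> cdom c \<Longrightarrow> (coord_deriv c f q v)\<^sup>2 \<le> B * (v \<bullet> (g0 c q *v v))"
proof -
  define good where "good W B \<longleftrightarrow> B > 0 \<and> (\<exists>c\<in>A. W \<subseteq> cdom c \<and> (\<forall>q v. q \<in> W \<longrightarrow> q \<in> mint X A \<longrightarrow>
      (coord_deriv c f q v)\<^sup>2 \<le> B * (v \<bullet> (g0 c q *v v))))" for W and B :: real
  have local: "\<exists>W. openin X W \<and> p \<in> W \<and> (\<exists>B. good W B)" if pX: "p \<in> topspace X" for p
  proof -
    obtain c where c: "c \<in> A" "p \<in> cdom c" using pX topspace_charts by blast
    obtain W B where "openin X W" "p \<in> W" "W \<subseteq> cdom c" "B > 0"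
      "\<And>q v. q \<in> W \<Longrightarrow> q \<in> mint X A \<Longrightarrow> (coord_deriv c f q v)\<^sup>2 \<le> B * (v \<bullet> (g0 c q *v v))"
      using differential_bounded_locally[OF g0 f c] by blast
    then have "openin X W \<and> p \<in> W \<and> good W B" unfolding good_def using c(1) by blast
    then show ?thesis by blast
  qed
  let ?\<W> = "{W. openin X W \<and> (\<exists>B. good W B)}"
  have "topspace X \<subseteq> \<Union>?\<W>" using local by blast
  then have "\<exists>\<F>. finite \<F> \<and> \<F> \<subseteq> ?\<W> \<and> topspace X \<subseteq> \<Union>\<F>"
    using compact unfolding compact_space_def by (elim compactinD[rotated 2]) auto
  then obtain \<F> where \<F>: "finite \<F>" "\<F> \<subseteq> ?\<W>" "topspace X \<subseteq> \<Union>\<F>" by blast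
  then have "\<forall>W\<in>\<F>. \<exists>B. good W B" by blast
  then obtain B where B: "\<And>W. W \<in> \<F> \<Longrightarrow> good W (B W)" by metis
  \<comment> \<open>The sum dominates every local constant; adding 1 keeps it positive even for an
    empty cover.\<close>
  define B' where "B' = (\<Sum>W\<in>\<F>. B W) + 1"
  have Bpos: "\<And>W. W \<in> \<F> \<Longrightarrow> 0 \<le> B W" using B by (auto simp: good_def intro: less_imp_le)
  have B': "B W \<le> B'" if "W \<in> \<F>" for W
    using member_le_sum[OF that, of B] Bpos \<F>(1) by (simp add: B'_def add_increasing2)
  show thesis
  proof (rule that)
    show "B' > 0" using Bpos by (simp add: B'_def add_nonneg_pos sum_nonneg)
    fix d q v assume d: "d \<in> A" and q: "q \<in> mint X A" "q \<in> cdom d"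
    then obtain W where W: "W \<in> \<F>" "q \<in> W" using \<F>(3) by (auto simp: mint_def)
    then obtain c where c: "c \<in> A" "q \<in> cdom c" and
      le: "\<And>v. (coord_deriv c f q v)\<^sup>2 \<le> B W * (v \<bullet> (g0 c q *v v))"
      using B[OF W(1)] q unfolding good_def by blast
    let ?Jv = "frechet_derivative (cmap c \<circ> cinv d) (at (cmap d q)) v"
    have nonneg: "0 \<le> ?Jv \<bullet> (g0 c q *v ?Jv)"
      using riemannian_metric_pos[OF g0 c, of ?Jv] by (cases "?Jv = 0") (auto intro: less_imp_le)
    have "(coord_deriv d f q v)\<^sup>2 = (coord_deriv c f q ?Jv)\<^sup>2"
      using coord_deriv_change[OF f d c(1) q c(2)] by simp
    also have "\<dots> \<le> B W * (?Jv \<bullet> (g0 c q *v ?Jv))" by (rule le)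
    also have "\<dots> \<le> B' * (?Jv \<bullet> (g0 c q *v ?Jv))" using B'[OF W(1)] nonneg by (intro mult_right_mono) auto
    also have "\<dots> = B' * (v \<bullet> (g0 d q *v v))"
      using riemannian_metric_change[OF g0 d c(1) q c(2)] by simp
    finally show "(coord_deriv d f q v)\<^sup>2 \<le> B' * (v \<bullet> (g0 d q *v v))" .
  qed
qed

text \<open>At an interior zero the nonnegative function \<open>\<rho>\<close> would have a minimum,
  so its differential would vanish, contrary to the condition on \<open>H\<close>.\<close>

lemma boundary_defining_pos:
  assumes bd: "boundary_defining X A H \<rho>" and q: "q \<in> mint X A"
  shows "\<rho> q > 0"
proof -
  have top: "q \<in> topspace X" using q by (simp add: mint_def)
  have H: "H = {p \<in> topspace X. \<rho> p = 0}" and pos: "\<forall>p \<in> topspace X - H. \<rho> p > 0"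
    using bd by (auto simp: boundary_defining_def)
  have "q \<notin> H"
  proof
    assume qH: "q \<in> H"
    obtain c where c: "c \<in> A" "q \<in> cdom c" using mint_in_some_chart[OF q] by blast
    have int: "cmap c q \<in> chart_interior c" using mint_imp_chart_interior[OF q c] .
    have "smooth_on (cimg c) (\<rho> \<circ> cinv c)" using bd c by (simp add: boundary_defining_def smooth_map_on_mfd_def)
    then have "(\<rho> \<circ> cinv c) differentiable (at (cmap c q))"
      using smooth_on_C1_open(1)[OF _ open_chart_interior[OF c(1)] chart_interior_subset int] by blast
    then have "((\<rho> \<circ> cinv c) has_derivative frechet_derivative (\<rho> \<circ> cinv c) (at (cmap c q))) (at (cmap c q))"
      using frechet_derivative_works by blast
    moreover have "\<forall>y\<in>chart_interior c. (\<rho> \<circ> cinv c) (cmap c q) \<le> (\<rho> \<circ> cinv c) y"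
    proof
      fix y assume "y \<in> chart_interior c"
      then have "cinv c y \<in> topspace X" using chart_interior_imp_mint[OF c(1)] by (auto simp: mint_def)
      then have "0 \<le> \<rho> (cinv c y)" using H pos by (cases "cinv c y \<in> H") (auto intro: less_imp_le)
      moreover have "\<rho> q = 0" using qH H by simp
      ultimately show "(\<rho> \<circ> cinv c) (cmap c q) \<le> (\<rho> \<circ> cinv c) y" using c by simp
    qed
    ultimately have "frechet_derivative (\<rho> \<circ> cinv c) (at (cmap c q)) = (\<lambda>v. 0)"
      using differential_zero_maxmin[OF int open_chart_interior[OF c(1)]] by blast
    then have "coord_deriv c \<rho> q = (\<lambda>v. 0)" using coord_deriv_interior[OF c(1) q c(2), of \<rho>] by simp
    then show False using bd c qH by (simp add: boundary_defining_def)
  qed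
  then show ?thesis using pos top by blast
qed

end

section \<open>Large exponents: the logarithm of a boundary defining function\<close>

context corner_manifold
begin

lemma boundary_defining_C1:
  assumes bd: "boundary_defining X A H \<rho>" and c: "c \<in> A"
  shows "x \<in> chart_interior c \<Longrightarrow> (\<rho> \<circ> cinv c) differentiable (at x)"
    and "x \<in> chart_interior c \<Longrightarrow> 0 < (\<rho> \<circ> cinv c) x"
    and "continuous_on (chart_interior c) (\<lambda>x. frechet_derivative (\<rho> \<circ> cinv c) (at x) v)"
proof -
  have sm: "smooth_on (cimg c) (\<rho> \<circ> cinv c)" using bd c by (simp add: boundary_defining_def smooth_map_on_mfd_def)
  note C1 = smooth_on_C1_open[OF sm open_chart_interior[OF c] chart_interior_subset]
  show "x \<in> chart_interior c \<Longrightarrow> (\<rho> \<circ> cinv c) differentiable (at x)" by (rule C1(1))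
  show "continuous_on (chart_interior c) (\<lambda>x. frechet_derivative (\<rho> \<circ> cinv c) (at x) v)" by (rule C1(2))
  show "x \<in> chart_interior c \<Longrightarrow> 0 < (\<rho> \<circ> cinv c) x"
    using boundary_defining_pos[OF bd chart_interior_imp_mint[OF c]] by simp
qed

lemma ln_boundary_defining_C1:
  assumes bd: "boundary_defining X A H \<rho>" and c: "c \<in> A"
  shows "x \<in> chart_interior c \<Longrightarrow> ((\<lambda>x. ln ((\<rho> \<circ> cinv c) x)) has_derivative
      (\<lambda>v. frechet_derivative (\<rho> \<circ> cinv c) (at x) v / (\<rho> \<circ> cinv c) x)) (at x)"
    and "continuous_on (chart_interior c) (\<lambda>x. frechet_derivative (\<lambda>x. ln ((\<rho> \<circ> cinv c) x)) (at x) v)"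
proof -
  note C1 = boundary_defining_C1[OF bd c]
  show "x \<in> chart_interior c \<Longrightarrow> ((\<lambda>x. ln ((\<rho> \<circ> cinv c) x)) has_derivative
      (\<lambda>v. frechet_derivative (\<rho> \<circ> cinv c) (at x) v / (\<rho> \<circ> cinv c) x)) (at x)"
    by (rule ln_C1_open(1)[of "chart_interior c"]) (erule C1(1) C1(2) | rule C1(3) | assumption)+
  show "continuous_on (chart_interior c) (\<lambda>x. frechet_derivative (\<lambda>x. ln ((\<rho> \<circ> cinv c) x)) (at x) v)"
    by (rule ln_C1_open(2)) (erule C1(1) C1(2) | rule C1(3))+
qed

text \<open>\<open>D\<close> is the differential of \<open>\<rho> i\<close> on the velocity, divided
  by \<open>\<rho> i\<close>. The inverse square of \<open>\<rho> i\<close> is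
  \<open>\<rho> i powr (- \<alpha> i)\<close>, a single term of the conformal factor, times
  \<open>\<rho> i powr (\<alpha> i - 2)\<close>, which is bounded because its exponent is
  nonnegative.\<close>

lemma ln_bdf_derivative_le_speed:
  assumes bd: "boundary_defining X A H (\<rho> i)" and g0: "riemannian_metric A g0" and i: "i \<in> {1..N}" "2 \<le> \<alpha> i"
    and B: "B > 0" "\<And>c q v. c \<in> A \<Longrightarrow> q \<in> mint X A \<Longrightarrow> q \<in> cdom c \<Longrightarrow>
        (coord_deriv c (\<rho> i) q v)\<^sup>2 \<le> B * (v \<bullet> (g0 c q *v v))"
    and R: "\<And>q. q \<in> topspace X \<Longrightarrow> \<rho> i q \<le> R"
    and \<gamma>: "continuous_map (top_of_set T) X \<gamma>" "t \<in> interior T" "\<gamma> t \<in> mint X A"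
    and c: "c \<in> A" "\<gamma> t \<in> cdom c" "(cmap c \<circ> \<gamma>) differentiable (at t)"
    and D: "((\<lambda>t. ln (\<rho> i (\<gamma> t))) has_real_derivative D) (at t)"
  shows "\<bar>D\<bar> \<le> sqrt (B * R powr (\<alpha> i - 2)) * speed A (sum_metric N \<rho> \<alpha> g0) T \<gamma> t"
proof -
  let ?x = "cmap c (\<gamma> t)"
  let ?f = "\<rho> i \<circ> cinv c"
  have tT: "t \<in> T" using \<gamma>(2) interior_subset by blast
  have at: "at t within T = at t" using \<gamma>(2) by (rule at_within_interior)
  obtain v where v: "((cmap c \<circ> \<gamma>) has_vector_derivative v) (at t)"
    using c(3) vector_derivative_works by blast
  define S where "S = (\<Sum>j\<in>{1..N}. \<rho> j (\<gamma> t) powr (- \<alpha> j))"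
  define Q where "Q = v \<bullet> (g0 c (\<gamma> t) *v v)"
  have speed: "speed A (sum_metric N \<rho> \<alpha> g0) T \<gamma> t = sqrt (S * Q)"
    unfolding S_def Q_def using v tT by (intro speed_sum_metric[OF g0 \<gamma>(1) _ \<gamma>(3) _ c(1,2)]) (auto simp: at)
  have int: "?x \<in> chart_interior c" using mint_imp_chart_interior[OF \<gamma>(3) c(1,2)] .
  have "((\<lambda>x. ln (?f x)) has_derivative (\<lambda>v. frechet_derivative ?f (at ?x) v / ?f ?x)) (at ((cmap c \<circ> \<gamma>) t) within (cmap c \<circ> \<gamma>) ` UNIV)"
    using ln_boundary_defining_C1(1)[OF bd c(1) int] by (simp add: has_derivative_at_withinI)
  from vector_derivative_diff_chain_within[OF v this]
  have "(((\<lambda>x. ln (?f x)) \<circ> (cmap c \<circ> \<gamma>)) has_vector_derivative frechet_derivative ?f (at ?x) v / ?f ?x) (at t)" .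
  moreover obtain \<delta> where \<delta>: "\<delta> > 0" "\<And>s. s \<in> T \<Longrightarrow> dist s t < \<delta> \<Longrightarrow> \<gamma> s \<in> cdom c"
    using curve_stays_near[OF \<gamma>(1) tT openin_cdom[OF c(1)] c(2)] by blast
  have "((\<lambda>x. ln (?f x)) \<circ> (cmap c \<circ> \<gamma>)) s = ln (\<rho> i (\<gamma> s))" if "s \<in> interior T \<inter> ball t \<delta>" for s
  proof -
    have "s \<in> T" "dist s t < \<delta>" using that interior_subset by (auto simp: dist_commute)
    then have "\<gamma> s \<in> cdom c" by (rule \<delta>(2))
    then show ?thesis using c(1) by simp
  qed
  ultimately have "((\<lambda>t. ln (\<rho> i (\<gamma> t))) has_vector_derivative frechet_derivative ?f (at ?x) v / ?f ?x) (at t)"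
    using \<delta>(1) \<gamma>(2) by (elim has_vector_derivative_transform_within_open[of _ _ _ "interior T \<inter> ball t \<delta>"]) auto
  then have "D = frechet_derivative ?f (at ?x) v / ?f ?x"
    using D DERIV_unique by (auto simp: has_real_derivative_iff_has_vector_derivative[symmetric])
  then have D_eq: "D = coord_deriv c (\<rho> i) (\<gamma> t) v / \<rho> i (\<gamma> t)"
    using coord_deriv_interior[OF c(1) \<gamma>(3) c(2), of "\<rho> i"] c by simp
  have pos: "\<rho> i (\<gamma> t) > 0" using boundary_defining_pos[OF bd \<gamma>(3)] .
  have Q: "0 \<le> Q" unfolding Q_def using riemannian_metric_pos[OF g0 c(1,2), of v] by (cases "v = 0") (auto intro: less_imp_le)
  have "1 / (\<rho> i (\<gamma> t))\<^sup>2 = \<rho> i (\<gamma> t) powr (- 2)"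
    using pos by (simp add: powr_minus_divide)
  also have "\<dots> = \<rho> i (\<gamma> t) powr (\<alpha> i - 2) * \<rho> i (\<gamma> t) powr (- \<alpha> i)"
    by (simp add: powr_add[symmetric])
  also have "\<dots> \<le> R powr (\<alpha> i - 2) * \<rho> i (\<gamma> t) powr (- \<alpha> i)"
    using pos i(2) R[of "\<gamma> t"] \<gamma>(3) by (intro mult_right_mono powr_mono2) (auto simp: mint_def)
  also have "\<dots> \<le> R powr (\<alpha> i - 2) * S"
    unfolding S_def using i(1) member_le_sum[of i "{1..N}" "\<lambda>j. \<rho> j (\<gamma> t) powr (- \<alpha> j)"]
    by (intro mult_left_mono) auto
  finally have inv: "1 / (\<rho> i (\<gamma> t))\<^sup>2 \<le> R powr (\<alpha> i - 2) * S" .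
  have "D\<^sup>2 = (coord_deriv c (\<rho> i) (\<gamma> t) v)\<^sup>2 * (1 / (\<rho> i (\<gamma> t))\<^sup>2)"
    unfolding D_eq by (simp add: power_divide)
  also have "\<dots> \<le> (B * Q) * (1 / (\<rho> i (\<gamma> t))\<^sup>2)"
    using B(2)[OF c(1) \<gamma>(3) c(2), of v] by (intro mult_right_mono) (auto simp: Q_def)
  also have "\<dots> \<le> (B * Q) * (R powr (\<alpha> i - 2) * S)"
    using inv B(1) Q by (intro mult_left_mono) auto
  also have "\<dots> = (B * R powr (\<alpha> i - 2)) * (S * Q)" by (simp add: mult_ac)
  finally have "sqrt (D\<^sup>2) \<le> sqrt ((B * R powr (\<alpha> i - 2)) * (S * Q))" by (rule real_sqrt_le_mono)
  then show ?thesis by (simp add: speed real_sqrt_mult)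
qed

text \<open>In a chart the logarithm is Lipschitz on a small ball, and for a short time the curve
  stays there. One \<open>d\<close> serves all intervals around \<open>x\<close>, the form that the
  bisection argument \<open>Bolzano\<close> requires; the chart coordinates are included because
  their derivative determines the speed.\<close>

lemma ln_bdf_abs_continuous_locally:
  assumes bd: "boundary_defining X A H \<rho>" and \<gamma>: "ac_curve X A T \<gamma>" and x: "x \<in> T"
  obtains d c where "d > 0" "c \<in> A"
    "\<And>s t. {s..t} \<subseteq> T \<Longrightarrow> s \<le> x \<Longrightarrow> x \<le> t \<Longrightarrow> t - s < d \<Longrightarrow>
      abs_continuous_on_interval s t (cmap c \<circ> \<gamma>) \<and> \<gamma> ` {s..t} \<subseteq> cdom c \<and>
      abs_continuous_on_interval s t (\<lambda>t. ln (\<rho> (\<gamma> t)))"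
proof -
  have cont: "continuous_map (top_of_set T) X \<gamma>" and mint: "\<gamma> ` T \<subseteq> mint X A"
    and ac: "\<And>c s t. c \<in> A \<Longrightarrow> s \<le> t \<Longrightarrow> {s..t} \<subseteq> T \<Longrightarrow> \<gamma> ` {s..t} \<subseteq> cdom c \<Longrightarrow>
        abs_continuous_on_interval s t (cmap c \<circ> \<gamma>)"
    using \<gamma> unfolding ac_curve_def by blast+
  have xm: "\<gamma> x \<in> mint X A" using mint x by blast
  obtain c where c: "c \<in> A" "\<gamma> x \<in> cdom c" using mint_in_some_chart[OF xm] by blast
  let ?F = "\<lambda>y. ln ((\<rho> \<circ> cinv c) y)"
  note lnC1 = ln_boundary_defining_C1[OF bd c(1)]
  have lnd: "?F differentiable (at y)" if "y \<in> chart_interior c" for y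
    using lnC1(1)[OF that] differentiable_def by blast
  obtain r L where r: "r > 0" "cball (cmap c (\<gamma> x)) r \<subseteq> chart_interior c"
      "L-lipschitz_on (cball (cmap c (\<gamma> x)) r) ?F"
    using C1_locally_lipschitz[OF open_chart_interior[OF c(1)] mint_imp_chart_interior[OF xm c] lnd lnC1(2)] by blast
  let ?W = "{q \<in> cdom c. cmap c q \<in> ball (cmap c (\<gamma> x)) r}"
  have "openin X ?W" using c(1) open_ball by (rule openin_chart_preimage)
  moreover have "\<gamma> x \<in> ?W" using c(2) r(1) by simp
  ultimately obtain d where d: "d > 0" "\<And>s. s \<in> T \<Longrightarrow> dist s x < d \<Longrightarrow> \<gamma> s \<in> ?W"
    using curve_stays_near[OF cont x] by blast
  show thesis
  proof (rule that[OF d(1) c(1)])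
    fix s t assume st: "{s..t} \<subseteq> T" "s \<le> x" "x \<le> t" "t - s < d"
    have W: "\<gamma> y \<in> ?W" if "y \<in> {s..t}" for y
      using that st by (intro d(2)) (auto simp: dist_real_def)
    then have sub: "\<gamma> ` {s..t} \<subseteq> cdom c" by blast
    then have acc: "abs_continuous_on_interval s t (cmap c \<circ> \<gamma>)" using st by (intro ac c(1)) auto
    have "(cmap c \<circ> \<gamma>) ` {s..t} \<subseteq> cball (cmap c (\<gamma> x)) r"
      using W by (auto simp: less_imp_le)
    then have "abs_continuous_on_interval s t (?F \<circ> (cmap c \<circ> \<gamma>))"
      by (rule abs_continuous_lipschitz_compose[OF acc r(3)])
    then have "abs_continuous_on_interval s t (\<lambda>t. ln (\<rho> (\<gamma> t)))"
      by (rule abs_continuous_on_interval_cong[rotated]) (use sub c(1) in \<open>auto simp: image_subset_iff\<close>)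
    with acc sub show "abs_continuous_on_interval s t (cmap c \<circ> \<gamma>) \<and> \<gamma> ` {s..t} \<subseteq> cdom c \<and>
      abs_continuous_on_interval s t (\<lambda>t. ln (\<rho> (\<gamma> t)))" by blast
  qed
qed

text \<open>Local estimates glued by bisection. Dividing the logarithm by \<open>C\<close> keeps
  constants out of the integral of a speed that may fail to be measurable.\<close>

lemma ln_bdf_increment_le_length:
  assumes compact: "compact_space X" and bd: "boundary_defining X A H (\<rho> i)" and g0: "riemannian_metric A g0"
    and i: "i \<in> {1..N}" "2 \<le> \<alpha> i"
  obtains C where "C > 0"
    "\<And>T \<gamma> a b. ac_curve X A T \<gamma> \<Longrightarrow> a \<le> b \<Longrightarrow> {a..b} \<subseteq> T \<Longrightarrow>
      ennreal \<bar>ln (\<rho> i (\<gamma> b)) / C - ln (\<rho> i (\<gamma> a)) / C\<bar>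
        \<le> (\<integral>\<^sup>+t\<in>{a..b}. ennreal (speed A (sum_metric N \<rho> \<alpha> g0) T \<gamma> t) \<partial>lebesgue)"
proof -
  have sm: "smooth_map_on_mfd A (\<rho> i)" using bd by (simp add: boundary_defining_def)
  obtain B where B: "B > 0" "\<And>c q v. c \<in> A \<Longrightarrow> q \<in> mint X A \<Longrightarrow> q \<in> cdom c \<Longrightarrow>
      (coord_deriv c (\<rho> i) q v)\<^sup>2 \<le> B * (v \<bullet> (g0 c q *v v))"
    using differential_bounded[OF compact g0 sm] by blast
  have "compactin euclidean (\<rho> i ` topspace X)"
    using compact continuous_map_smooth[OF sm] unfolding compact_space_def by (rule image_compactin)
  then have "bounded (\<rho> i ` topspace X)" by (simp add: compact_imp_bounded)
  then obtain R where R: "R > 0" "\<And>q. q \<in> topspace X \<Longrightarrow> \<bar>\<rho> i q\<bar> \<le> R" by (auto simp: bounded_pos)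
  define C where "C = sqrt (B * R powr (\<alpha> i - 2))"
  have "C > 0" using B(1) R(1) by (simp add: C_def)
  moreover have "ennreal \<bar>ln (\<rho> i (\<gamma> b)) / C - ln (\<rho> i (\<gamma> a)) / C\<bar>
      \<le> (\<integral>\<^sup>+t\<in>{a..b}. ennreal (speed A (sum_metric N \<rho> \<alpha> g0) T \<gamma> t) \<partial>lebesgue)"
    if \<gamma>: "ac_curve X A T \<gamma>" and ab: "a \<le> b" "{a..b} \<subseteq> T" for T \<gamma> a b
  proof -
    let ?u = "\<lambda>t. ln (\<rho> i (\<gamma> t)) / C"
    let ?sp = "\<lambda>t. ennreal (speed A (sum_metric N \<rho> \<alpha> g0) T \<gamma> t)"
    have cont: "continuous_map (top_of_set T) X \<gamma>" and mint: "\<gamma> ` T \<subseteq> mint X A"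
      using \<gamma> unfolding ac_curve_def by blast+
    \<comment> \<open>The trivial premises generalise to \<open>a \<le> s\<close> and
      \<open>t \<le> b\<close>, which keep every interval of the bisection inside
      \<open>T\<close>.\<close>
    have "a \<le> a \<longrightarrow> b \<le> b \<longrightarrow> ennreal \<bar>?u b - ?u a\<bar> \<le> (\<integral>\<^sup>+t\<in>{a..b}. ?sp t \<partial>lebesgue)"
      using ab(1)
    proof (induction rule: Bolzano[where P="\<lambda>s t. a \<le> s \<longrightarrow> t \<le> b \<longrightarrow>
        ennreal \<bar>?u t - ?u s\<bar> \<le> (\<integral>\<^sup>+t\<in>{s..t}. ?sp t \<partial>lebesgue)"])
      case (trans x y z)
      show ?case
      proof (intro impI)
        assume xz: "a \<le> x" "z \<le> b"
        have "ennreal \<bar>?u z - ?u x\<bar> \<le> ennreal (\<bar>?u y - ?u x\<bar> + \<bar>?u z - ?u y\<bar>)"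
          by (intro ennreal_leI) simp
        also have "\<dots> = ennreal \<bar>?u y - ?u x\<bar> + ennreal \<bar>?u z - ?u y\<bar>" by (rule ennreal_plus) auto
        also have "\<dots> \<le> (\<integral>\<^sup>+t\<in>{x..y}. ?sp t \<partial>lebesgue) + (\<integral>\<^sup>+t\<in>{y..z}. ?sp t \<partial>lebesgue)"
          using trans xz by (intro add_mono) auto
        also have "\<dots> \<le> (\<integral>\<^sup>+t. ?sp t * indicator {x..y} t + ?sp t * indicator {y..z} t \<partial>lebesgue)"
          by (rule nn_integral_superadditive)
        also have "\<dots> \<le> (\<integral>\<^sup>+t\<in>{x..z}. ?sp t \<partial>lebesgue)"
        proof (rule nn_integral_mono_AE)
          \<comment> \<open>Adjacent intervals overlap only in \<open>y\<close>, a null set;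
            superadditivity then joins the two lengths.\<close>
          have "AE t in lebesgue. t \<noteq> y" by (rule AE_lebesgue_if_notin_negligible[of "{y}"]) auto
          then show "AE t in lebesgue. ?sp t * indicator {x..y} t + ?sp t * indicator {y..z} t \<le> ?sp t * indicator {x..z} t"
          proof eventually_elim
            case (elim t)
            then show ?case using trans(3,4) by (auto simp: indicator_def)
          qed
        qed
        finally show "ennreal \<bar>?u z - ?u x\<bar> \<le> (\<integral>\<^sup>+t\<in>{x..z}. ?sp t \<partial>lebesgue)" .
      qed
    next
      case (local x)
      have xT: "x \<in> T" using local ab by auto
      obtain d c where d: "d > 0" "c \<in> A" "\<And>s t. {s..t} \<subseteq> T \<Longrightarrow> s \<le> x \<Longrightarrow> x \<le> t \<Longrightarrow> t - s < d \<Longrightarrow>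
          abs_continuous_on_interval s t (cmap c \<circ> \<gamma>) \<and> \<gamma> ` {s..t} \<subseteq> cdom c \<and>
          abs_continuous_on_interval s t (\<lambda>t. ln (\<rho> i (\<gamma> t)))"
        using ln_bdf_abs_continuous_locally[OF bd \<gamma> xT] by blast
      have "ennreal \<bar>?u t - ?u s\<bar> \<le> (\<integral>\<^sup>+t\<in>{s..t}. ?sp t \<partial>lebesgue)"
        if st: "s \<le> x" "x \<le> t" "t - s < d" "a \<le> s" "t \<le> b" for s t
      proof (rule abs_continuous_increment_le_nn_integral)
        have sT: "{s..t} \<subseteq> T" using st ab by auto
        note D = d(3)[OF sT st(1-3)]
        have "(1/C)-lipschitz_on UNIV (\<lambda>y. y / C)"
          using \<open>C > 0\<close> by (intro lipschitz_onI) (auto simp: dist_real_def diff_divide_distrib[symmetric])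
        from abs_continuous_lipschitz_compose[OF conjunct2[OF conjunct2[OF D]] this]
        show "abs_continuous_on_interval s t ?u" by (simp add: o_def)
        show "s \<le> t" using st by simp
        show "AE y in lebesgue. y \<in> {s<..<t} \<longrightarrow> (\<forall>E. (?u has_real_derivative E) (at y) \<longrightarrow> ennreal \<bar>E\<bar> \<le> ?sp y)"
          using abs_continuous_differentiable_ae[OF conjunct1[OF D]]
        proof eventually_elim
          case (elim y)
          show ?case
          proof (intro impI allI)
            fix E assume y: "y \<in> {s<..<t}" and E: "(?u has_real_derivative E) (at y)"
            \<comment> \<open>At interior points of \<open>T\<close> the one-sided derivative in the
              definition of the speed is the two-sided one.\<close>
            have "{s<..<t} \<subseteq> interior T" using sT by (intro interior_maximal) auto
            then have yT: "y \<in> interior T" "y \<in> T" using y interior_subset[of T] by auto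
            have "((\<lambda>t. ?u t * C) has_real_derivative E * C) (at y)" using E by (rule DERIV_cmult_right)
            then have "((\<lambda>t. ln (\<rho> i (\<gamma> t))) has_real_derivative E * C) (at y)" using \<open>C > 0\<close> by simp
            moreover have "\<gamma> y \<in> cdom c" using D y by (auto simp: image_subset_iff)
            ultimately have "\<bar>E * C\<bar> \<le> C * speed A (sum_metric N \<rho> \<alpha> g0) T \<gamma> y"
              unfolding C_def using elim y mint yT R(2)
              by (intro ln_bdf_derivative_le_speed[where c=c and H=H and B=B and R=R]) 
                (use bd g0 i B cont d(2) in \<open>auto intro: order_trans[OF abs_ge_self]\<close>)
            then show "ennreal \<bar>E\<bar> \<le> ?sp y" using \<open>C > 0\<close> by (intro ennreal_leI) (simp add: abs_mult mult.commute)
          qed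
        qed
      qed
      then show ?case using d(1) by blast
    qed
    then show ?thesis by simp
  qed
  ultimately show thesis by (rule that)
qed

section \<open>Divergence of the logarithm at the boundary point\<close>

context
  fixes N i :: nat and H and \<rho> :: "nat \<Rightarrow> 'a \<Rightarrow> real" and g0 :: "('a, 'n) metric_tensor" and \<alpha> :: "nat \<Rightarrow> real" and p
  assumes compact: "compact_space X" and bd: "boundary_defining X A H (\<rho> i)" and g0: "riemannian_metric A g0"
    and i: "i \<in> {1..N}" "2 \<le> \<alpha> i" and p: "p \<in> H"
begin

lemma eventually_bdf_less:
  assumes "limitin X q p F" "0 < e"
  shows "\<forall>\<^sub>F t in F. \<rho> i (q t) < e"
proof -
  have "continuous_map X euclidean (\<rho> i)"
    using bd by (intro continuous_map_smooth) (simp add: boundary_defining_def)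
  from continuous_map_limit[OF this assms(1)] have "((\<lambda>t. \<rho> i (q t)) \<longlongrightarrow> \<rho> i p) F" by (simp add: o_def)
  moreover have "\<rho> i p = 0" using p bd by (simp add: boundary_defining_def)
  ultimately show ?thesis using assms(2) by (intro order_tendstoD(2)) auto
qed

lemma large_exponent_imp_not_approachable: "\<not> finite_length_approachable X A (sum_metric N \<rho> \<alpha> g0) p"
proof
  let ?g = "sum_metric N \<rho> \<alpha> g0"
  assume "finite_length_approachable X A ?g p"
  then obtain \<gamma> where \<gamma>: "ac_curve X A {0..<1} \<gamma>" "limitin X \<gamma> p (at_left 1)" "curve_length A ?g {0..<1} \<gamma> < \<infinity>"
    unfolding finite_length_approachable_def by blast
  obtain C where C: "C > 0" "\<And>T \<gamma> a b. ac_curve X A T \<gamma> \<Longrightarrow> a \<le> b \<Longrightarrow> {a..b} \<subseteq> T \<Longrightarrow>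
      ennreal \<bar>ln (\<rho> i (\<gamma> b)) / C - ln (\<rho> i (\<gamma> a)) / C\<bar>
        \<le> (\<integral>\<^sup>+t\<in>{a..b}. ennreal (speed A ?g T \<gamma> t) \<partial>lebesgue)"
    using ln_bdf_increment_le_length[where \<rho>=\<rho> and N=N and \<alpha>=\<alpha>, OF compact bd g0 i] by blast
  define L where "L = enn2real (curve_length A ?g {0..<1} \<gamma>)"
  have L: "curve_length A ?g {0..<1} \<gamma> = ennreal L" "L \<ge> 0" using \<gamma>(3) by (auto simp: L_def less_top)
  define u where "u t = ln (\<rho> i (\<gamma> t)) / C" for t
  have bound: "\<bar>u t - u 0\<bar> \<le> L" if "t \<in> {0..<1}" for t
  proof -
    have "{0..t} \<subseteq> {0..<1}" using that by auto
    then have "ennreal \<bar>u t - u 0\<bar> \<le> (\<integral>\<^sup>+x\<in>{0..t}. ennreal (speed A ?g {0..<1} \<gamma> x) \<partial>lebesgue)"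
      unfolding u_def using that by (intro C(2)[OF \<gamma>(1)]) auto
    also have "\<dots> \<le> ennreal L"
      unfolding L(1)[symmetric] curve_length_def using that
      by (intro nn_integral_mono) (auto simp: indicator_def)
    finally show ?thesis using L(2) by simp
  qed
  \<comment> \<open>Below this threshold \<open>u\<close> has dropped by more than \<open>L\<close>
    from its initial value, exceeding the length of the curve.\<close>
  have "\<forall>\<^sub>F t in at_left 1. \<rho> i (\<gamma> t) < exp (C * (u 0 - L - 1))"
    using \<gamma>(2) by (rule eventually_bdf_less) simp
  moreover have "\<forall>\<^sub>F t in at_left (1::real). t \<in> {0..<1}"
    unfolding eventually_at_left_field by (intro exI[of _ 0]) auto
  ultimately have "\<forall>\<^sub>F t in at_left (1::real). \<rho> i (\<gamma> t) < exp (C * (u 0 - L - 1)) \<and> t \<in> {0..<1}"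
    by (rule eventually_conj)
  then obtain t where t: "\<rho> i (\<gamma> t) < exp (C * (u 0 - L - 1))" "t \<in> {0..<1}"
    using eventually_happens'[OF trivial_limit_at_left_real] by blast
  have "\<gamma> t \<in> mint X A" using \<gamma>(1) t(2) by (auto simp: ac_curve_def)
  then have "ln (\<rho> i (\<gamma> t)) < C * (u 0 - L - 1)"
    using t(1) boundary_defining_pos[OF bd] by (metis ln_exp ln_less_cancel_iff exp_gt_zero)
  then have "u t < u 0 - L - 1" using C(1) by (simp add: u_def pos_divide_less_eq mult.commute)
  then show False using bound[OF t(2)] by linarith
qed

lemma large_exponent_imp_not_accessible: "\<not> accessible X A (sum_metric N \<rho> \<alpha> g0) p"
proof
  let ?g = "sum_metric N \<rho> \<alpha> g0"
  assume "accessible X A ?g p"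
  then obtain q :: "nat \<Rightarrow> 'a" where q: "range q \<subseteq> mint X A" "limitin X q p sequentially"
    and cauchy: "\<And>\<epsilon>::real. \<epsilon> > 0 \<Longrightarrow> \<exists>M. \<forall>m\<ge>M. \<forall>n\<ge>M. rdist X A ?g (q m) (q n) < ennreal \<epsilon>"
    unfolding accessible_def by blast
  obtain C where C: "C > 0" "\<And>T \<gamma> a b. ac_curve X A T \<gamma> \<Longrightarrow> a \<le> b \<Longrightarrow> {a..b} \<subseteq> T \<Longrightarrow>
      ennreal \<bar>ln (\<rho> i (\<gamma> b)) / C - ln (\<rho> i (\<gamma> a)) / C\<bar>
        \<le> (\<integral>\<^sup>+t\<in>{a..b}. ennreal (speed A ?g T \<gamma> t) \<partial>lebesgue)"
    using ln_bdf_increment_le_length[where \<rho>=\<rho> and N=N and \<alpha>=\<alpha>, OF compact bd g0 i] by blast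
  define u where "u n = ln (\<rho> i (q n)) / C" for n
  \<comment> \<open>Tolerance 1 suffices: it confines \<open>u\<close> to distance 1 from
    \<open>u M\<close> on a whole tail, while \<open>u n\<close> tends to minus infinity.\<close>
  obtain M where M: "\<And>m n. m \<ge> M \<Longrightarrow> n \<ge> M \<Longrightarrow> rdist X A ?g (q m) (q n) < ennreal 1"
    using cauchy[of 1] by auto
  have bound: "\<bar>u n - u M\<bar> < 1" if "n \<ge> M" for n
  proof -
    have "rdist X A ?g (q M) (q n) < ennreal 1" using M that by blast
    then obtain \<gamma> where \<gamma>: "ac_curve X A {0..1} \<gamma>" "\<gamma> 0 = q M" "\<gamma> 1 = q n" "curve_length A ?g {0..1} \<gamma> < ennreal 1"
      unfolding rdist_def Inf_less_iff by blast
    have "ennreal \<bar>u n - u M\<bar> \<le> curve_length A ?g {0..1} \<gamma>"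
      using C(2)[OF \<gamma>(1), of 0 1] \<gamma>(2,3) by (simp add: u_def curve_length_def)
    also have "\<dots> < ennreal 1" by fact
    finally show ?thesis by (simp add: ennreal_less_iff del: ennreal_1)
  qed
  have "\<forall>\<^sub>F n in sequentially. \<rho> i (q n) < exp (C * (u M - 1))"
    using q(2) by (rule eventually_bdf_less) simp
  then obtain n where n: "n \<ge> M" "\<rho> i (q n) < exp (C * (u M - 1))"
    unfolding eventually_sequentially by (meson nat_le_linear order_refl)
  have "q n \<in> mint X A" using q(1) by blast
  then have "ln (\<rho> i (q n)) < C * (u M - 1)"
    using n(2) boundary_defining_pos[OF bd] by (metis ln_exp ln_less_cancel_iff exp_gt_zero)
  then have "u n < u M - 1" using C(1) by (simp add: u_def pos_divide_less_eq mult.commute)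
  then show False using bound[OF n(1)] by linarith
qed

end

end

theorem theorem3p4:
  fixes X :: "'a topology"
    and A :: "('a, 'n::finite) chart set"
    and N :: nat
    and H :: "nat \<Rightarrow> 'a set"
    and \<rho> :: "nat \<Rightarrow> 'a \<Rightarrow> real"
    and g0 :: "('a, 'n) metric_tensor"
    and \<alpha> :: "nat \<Rightarrow> real"
    and I :: "nat set"
    and p :: 'a
  assumes "manifold_with_corners X A" and "compact_space X"
    and "bij_betw H {1..N} (boundary_hypersurfaces X A)"
    and "\<And>i. i \<in> {1..N} \<Longrightarrow> embedded_hypersurface X A (H i)"
    and "\<And>i. i \<in> {1..N} \<Longrightarrow> boundary_defining X A (H i) (\<rho> i)"
    and "riemannian_metric A g0"
    and "\<And>i. i \<in> {1..N} \<Longrightarrow> \<alpha> i \<ge> 0"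
    and "p \<in> mbd A"
    and "p \<in> open_face X N H I" and "I \<noteq> {}"
  shows "(accessible X A (sum_metric N \<rho> \<alpha> g0) p
            \<longleftrightarrow> finite_length_approachable X A (sum_metric N \<rho> \<alpha> g0) p) \<and>
         (finite_length_approachable X A (sum_metric N \<rho> \<alpha> g0) p
            \<longleftrightarrow> Max (\<alpha> ` I) < 2)"
proof -
  interpret corner_manifold X A by unfold_locales (rule assms(1))
  let ?M = "Max (\<alpha> ` I)"
  have I: "I = {i \<in> {1..N}. p \<in> H i}" and p: "p \<in> topspace X"
    using assms(9) by (auto simp: open_face_def active_index_set_def)
  have fin: "finite (\<alpha> ` I)" by (simp add: I)
  show ?thesis
  proof (cases "?M < 2")
    case True
    have le: "\<alpha> i \<le> ?M" if "i \<in> {1..N}" "p \<in> H i" for i using fin that by (simp add: I)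
    \<comment> \<open>Nonnegativity lets \<open>s powr (- M)\<close> dominate the bounded terms of
      the inactive hypersurfaces; it is inherited from any active exponent.\<close>
    have "0 \<le> ?M"
    proof -
      obtain i where i: "i \<in> {1..N}" "p \<in> H i" using assms(10) I by blast
      show ?thesis using assms(7)[OF i(1)] le[OF i] by (rule order_trans)
    qed
    then show ?thesis
      using small_exponent_imp_approachable_accessible[where H=H and \<rho>=\<rho> and N=N and \<alpha>=\<alpha>, OF assms(5,6) p assms(7) _ le True] True
      by blast
  next
    case False
    have "?M \<in> \<alpha> ` I" using fin assms(10) by (intro Max_in) auto
    then obtain i where "i \<in> I" "\<alpha> i = ?M" by force
    then have i: "i \<in> {1..N}" "2 \<le> \<alpha> i" "p \<in> H i" using False I by auto
    show ?thesis
      using large_exponent_imp_not_approachable[where \<rho>=\<rho> and \<alpha>=\<alpha>, OF assms(2) assms(5)[OF i(1)] assms(6) i]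
        large_exponent_imp_not_accessible[where \<rho>=\<rho> and \<alpha>=\<alpha>, OF assms(2) assms(5)[OF i(1)] assms(6) i] False
      by blast
  qed
qed

end
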